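(* Let $p$ be a selfadjoint $*$-polynomial in two noncommuting variables. Then the spectrum $\sigma(p(u_\theta,v_\theta))$ is $\frac12$-H\"older continuous in $\theta\in\mathbb{R}$ with respect to the Hausdorff distance for compact subsets of $\mathbb{C}$.
   Context: For $\theta\in\mathbb{R}$, $A_\theta=C^*(u,v \text{ unitary}\mid vu=e^{i\theta}uv)$ denotes the universal C*-algebra generated by two unitaries $u,v$ satisfying $vu=e^{i\theta}uv$; its generators are denoted $u_\theta,v_\theta$. A $*$-polynomial $p=p(x_1,x_2)$ in two noncommuting variables is a polynomial with complex coefficients in four noncommuting variables evaluated at $(x_1,x_1^*,x_2,x_2^* )$. It is selfadjoint if the formal application of the adjoint leaves it invariant. *)

theory Defs
  imports
    "HOL-Analysis.Analysis"
    "HOL-Library.Poly_Mapping"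
    "HOL-Algebra.QuotRing"
    "HOL-Algebra.Module"
begin

section \<open>\<open>*\<close>-polynomials in two noncommuting variables\<close>

text \<open>
  The four letters stand for \<open>x\<^sub>1, x\<^sub>1\<^sup>*, x\<^sub>2, x\<^sub>2\<^sup>*\<close>. Words form the free monoid on these
  letters; it is written additively because \<^theory>\<open>HOL-Library.Poly_Mapping\<close> builds monoid
  algebras over additive monoids. The type \<open>star_poly\<close> is therefore the algebra of complex
  polynomials in four noncommuting variables, with its ring structure from the library.
\<close>

datatype letter = X1 | X1s | X2 | X2s

datatype "word" = Word (letters: "letter list")

instantiation "word" :: monoid_add
begin
definition "0 = Word []"
definition "v + w = Word (letters v @ letters w)"
instance
  by standard (simp_all add: zero_word_def plus_word_def)
end

type_synonym star_poly = "word \<Rightarrow>\<^sub>0 complex"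

definition var :: "letter \<Rightarrow> star_poly" where
  "var l = Poly_Mapping.single (Word [l]) 1"

definition const :: "complex \<Rightarrow> star_poly" where
  "const c = Poly_Mapping.single 0 c"

fun letter_adj :: "letter \<Rightarrow> letter" where
  "letter_adj X1 = X1s"
| "letter_adj X1s = X1"
| "letter_adj X2 = X2s"
| "letter_adj X2s = X2"

definition word_adj :: "word \<Rightarrow> word" where
  "word_adj w = Word (rev (map letter_adj (letters w)))"

definition formal_adj :: "star_poly \<Rightarrow> star_poly" where
  "formal_adj p = (\<Sum>w\<in>Poly_Mapping.keys p. Poly_Mapping.single (word_adj w) (cnj (Poly_Mapping.lookup p w)))"

definition selfadjoint :: "star_poly \<Rightarrow> bool" where
  "selfadjoint p \<longleftrightarrow> formal_adj p = p"


section \<open>Unital complex \<open>*\<close>-algebras with a norm\<close>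

record 'a cstar_alg = "(complex, 'a) module" +
  star :: "'a \<Rightarrow> 'a"
  cnorm :: "'a \<Rightarrow> real"

fun letter_eval :: "('a, 'm) cstar_alg_scheme \<Rightarrow> 'a \<Rightarrow> 'a \<Rightarrow> letter \<Rightarrow> 'a" where
  "letter_eval A a b X1 = a"
| "letter_eval A a b X1s = star A a"
| "letter_eval A a b X2 = b"
| "letter_eval A a b X2s = star A b"

definition word_eval :: "('a, 'm) cstar_alg_scheme \<Rightarrow> 'a \<Rightarrow> 'a \<Rightarrow> word \<Rightarrow> 'a" where
  "word_eval A a b w = foldr (\<lambda>l x. letter_eval A a b l \<otimes>\<^bsub>A\<^esub> x) (letters w) \<one>\<^bsub>A\<^esub>"

definition star_poly_eval :: "('a, 'm) cstar_alg_scheme \<Rightarrow> star_poly \<Rightarrow> 'a \<Rightarrow> 'a \<Rightarrow> 'a" where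
  "star_poly_eval A p a b = (\<Oplus>\<^bsub>A\<^esub>w\<in>Poly_Mapping.keys p. Poly_Mapping.lookup p w \<odot>\<^bsub>A\<^esub> word_eval A a b w)"

definition spectrum :: "('a, 'm) cstar_alg_scheme \<Rightarrow> 'a \<Rightarrow> complex set" where
  "spectrum A a = {c. c \<odot>\<^bsub>A\<^esub> \<one>\<^bsub>A\<^esub> \<ominus>\<^bsub>A\<^esub> a \<notin> Units A}"


section \<open>The universal C*-algebra \<open>A\<^sub>\<theta>\<close>\<close>

text \<open>
  \<open>A\<^sub>\<theta>\<close> is built by the standard construction of a universal C*-algebra from generators and
  relations: the Hausdorff completion of the free unital \<open>*\<close>-algebra \<open>star_poly\<close> in the largest
  C*-seminorm that annihilates the relations. A C*-seminorm annihilating the relations is the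
  same thing as a function \<open>p \<mapsto> \<parallel>p(U, V)\<parallel>\<close> for a pair of unitaries \<open>U, V\<close>, in some C*-algebra,
  with \<open>VU = e\<^bsup>i\<theta>\<^esup>UV\<close>; so the supremum below runs over all representations of the relations
  without quantifying over types.
\<close>

definition cstar_seminorm :: "(star_poly \<Rightarrow> real) \<Rightarrow> bool" where
  "cstar_seminorm \<nu> \<longleftrightarrow>
     (\<forall>p q. \<nu> (p + q) \<le> \<nu> p + \<nu> q) \<and>
     (\<forall>c p. \<nu> (const c * p) = cmod c * \<nu> p) \<and>
     (\<forall>p q. \<nu> (p * q) \<le> \<nu> p * \<nu> q) \<and>
     (\<forall>p. \<nu> (formal_adj p * p) = (\<nu> p)\<^sup>2)"

definition rotation_relations :: "real \<Rightarrow> star_poly set" where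
  "rotation_relations \<theta> =
     {var X1s * var X1 - 1, var X1 * var X1s - 1,
      var X2s * var X2 - 1, var X2 * var X2s - 1,
      var X2 * var X1 - const (cis \<theta>) * (var X1 * var X2)}"

text \<open>
  The supremum is over a nonempty set (\<open>\<nu> = 0\<close> is admissible) that is bounded: the relations
  force \<open>\<nu> (var l)\<^sup>2 = \<nu> 1 \<le> 1\<close> for every letter, so \<open>\<nu> p\<close> is at most the sum of the moduli of
  the coefficients of \<open>p\<close>.
\<close>

definition rotation_seminorm :: "real \<Rightarrow> star_poly \<Rightarrow> real" where
  "rotation_seminorm \<theta> p =
     Sup {\<nu> p | \<nu>. cstar_seminorm \<nu> \<and> (\<forall>r\<in>rotation_relations \<theta>. \<nu> r = 0)}"

definition cauchy_ring :: "real \<Rightarrow> (nat \<Rightarrow> star_poly) ring" where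
  "cauchy_ring \<theta> =
     \<lparr>carrier = {X. \<forall>e>0. \<exists>N. \<forall>m\<ge>N. \<forall>n\<ge>N. rotation_seminorm \<theta> (X m - X n) < e},
      mult = (\<lambda>X Y n. X n * Y n), one = (\<lambda>n. 1),
      zero = (\<lambda>n. 0), add = (\<lambda>X Y n. X n + Y n)\<rparr>"

definition null_ideal :: "real \<Rightarrow> (nat \<Rightarrow> star_poly) set" where
  "null_ideal \<theta> = {X. (\<lambda>n. rotation_seminorm \<theta> (X n)) \<longlonglongrightarrow> 0}"

definition cauchy_class :: "real \<Rightarrow> (nat \<Rightarrow> star_poly) \<Rightarrow> (nat \<Rightarrow> star_poly) set" where
  "cauchy_class \<theta> X = null_ideal \<theta> +>\<^bsub>cauchy_ring \<theta>\<^esub> X"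

definition rotation_algebra :: "real \<Rightarrow> (nat \<Rightarrow> star_poly) set cstar_alg" where
  "rotation_algebra \<theta> = (let Q = cauchy_ring \<theta> Quot null_ideal \<theta> in
     \<lparr>carrier = carrier Q, mult = mult Q, one = one Q, zero = zero Q, add = add Q,
      smult = (\<lambda>c S. \<Union>X\<in>S. cauchy_class \<theta> (\<lambda>n. const c * X n)),
      star = (\<lambda>S. \<Union>X\<in>S. cauchy_class \<theta> (\<lambda>n. formal_adj (X n))),
      cnorm = (\<lambda>S. lim (\<lambda>n. rotation_seminorm \<theta> ((SOME X. X \<in> S) n)))\<rparr>)"

definition u_gen :: "real \<Rightarrow> (nat \<Rightarrow> star_poly) set" where
  "u_gen \<theta> = cauchy_class \<theta> (\<lambda>n. var X1)"

definition v_gen :: "real \<Rightarrow> (nat \<Rightarrow> star_poly) set" where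
  "v_gen \<theta> = cauchy_class \<theta> (\<lambda>n. var X2)"


definition rotation_spectrum :: "star_poly \<Rightarrow> real \<Rightarrow> complex set" where
  "rotation_spectrum p \<theta> =
     spectrum (rotation_algebra \<theta>) (star_poly_eval (rotation_algebra \<theta>) p (u_gen \<theta>) (v_gen \<theta>))"


section \<open>Hausdorff distance\<close>

text \<open>Meaningful for nonempty bounded sets only; its uses are for nonempty compact sets.\<close>

definition hausdorff_dist :: "'a::metric_space set \<Rightarrow> 'a set \<Rightarrow> real" where
  "hausdorff_dist S T = max (SUP x\<in>S. infdist x T) (SUP y\<in>T. infdist y S)"

end

theory Submission
  imports Defs "HOL-Real_Asymp.Real_Asymp"
begin

text \<open>
  Write \<open>\<parallel>p\<parallel>\<^sub>\<theta>\<close> for the rotation seminorm. An element of the completion that comes from a selfadjoint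
  \<open>*\<close>-polynomial is invertible iff it is bounded below, and its optimal lower bound is the distance of
  \<open>0\<close> to its spectrum; both facts only need the C*-seminorm, not a completion or functional calculus.

  The seminorm \<open>\<parallel>p\<parallel>\<^sub>\<theta>\<close> equals the operator norm in the lattice representation on \<open>\<ell>\<^sup>2(\<int>\<^sup>2)\<close>: a power \<open>y\<^sup>n\<close>
  has only polynomially many normal forms \<open>u\<^sup>i v\<^sup>j\<close>, so \<open>\<parallel>y\<parallel>\<^sub>\<theta>\<^bsup>n\<^esup>\<close> is at most a polynomial in \<open>n\<close> times the
  \<open>n\<close>-th power of the operator norm.

  To compare \<open>\<theta>\<close> with \<open>\<theta>' = \<theta> + \<delta>\<close>, tensor the lattice representation of angle \<open>\<theta>\<close> with the
  representation of angle \<open>\<delta>\<close> on \<open>\<ell>\<^sup>2(\<int>)\<close> by a diagonal unitary and the shift; this has angle \<open>\<theta>'\<close>. A tent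
  function \<open>f\<close> of width \<open>M\<close> is moved by the diagonal unitary and the shift by at most
  \<open>O(M \<bar>\<delta>\<bar> + 1/M) \<parallel>f\<parallel>\<close>, so on \<open>\<psi> \<otimes> f\<close> the representations of angle \<open>\<theta>\<close> and \<open>\<theta>'\<close> differ by that much.
  Hence a spectral gap at \<open>\<theta>'\<close> persists at \<open>\<theta>\<close> up to this error, and \<open>M \<approx> \<bar>\<delta>\<bar>\<^bsup>-1/2\<^esup>\<close> gives the exponent \<open>1/2\<close>.
\<close>

section \<open>C\<open>*\<close>-seminorms\<close>

text \<open>The algebras of two angles share no common space, so elements of one are never compared
  with elements of the other; what passes between the angles is a lower bound. At
  \<open>\<theta>'\<close> it yields approximate inverses of bounded seminorm, and these act in
  every representation of angle \<open>\<theta>'\<close>, because the rotation seminorm dominates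
  each such operator norm. Thus the bound holds on every vector of the tensor product. The way back
  is the delicate one: a lower bound in a single representation says something about the seminorm
  only if that representation is isometric, which is why the lattice representation is chosen as the
  factor of angle \<open>\<theta>\<close>. Its isometry reflects the amenability of the group of
  pairs of integers. Unless \<open>\<delta>\<close> is a multiple of 2 pi, no nonzero vector is
  fixed by both unitaries of angle \<open>\<delta>\<close>, since the commutation relation would
  force \<open>cis \<delta> = 1\<close>. Hence only almost fixed vectors exist, and a vector spread
  widely enough for the shift meets many values of the diagonal phase; this conflict costs the
  square root.\<close>

locale complex_star_ring =
  fixes sc :: "complex \<Rightarrow> 'a::ring_1" and adj :: "'a \<Rightarrow> 'a"
  assumes sc_add: "sc (c + d) = sc c + sc d"
    and sc_mult: "sc (c * d) = sc c * sc d"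
    and sc_1 [simp]: "sc 1 = 1"
    and sc_central: "x * sc c = sc c * x"
    and adj_add: "adj (x + y) = adj x + adj y"
    and adj_mult: "adj (x * y) = adj y * adj x"
    and adj_adj [simp]: "adj (adj x) = x"
    and adj_sc: "adj (sc c) = sc (cnj c)"
begin

lemma sc_0 [simp]: "sc 0 = 0"
  using sc_add[of 0 0] by simp

lemma sc_minus: "sc (- c) = - sc c"
  using sc_add[of c "- c"] by (simp add: eq_neg_iff_add_eq_0 add.commute)

lemma sc_diff: "sc (c - d) = sc c - sc d"
  using sc_add[of c "- d"] by (simp add: sc_minus)

lemma sc_left_commute: "x * (sc c * y) = sc c * (x * y)"
  by (metis mult.assoc sc_central)

lemma adj_0 [simp]: "adj 0 = 0"
  using adj_add[of 0 0] by simp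

lemma adj_1 [simp]: "adj 1 = 1"
  using adj_sc[of 1] by simp

lemma adj_minus: "adj (- x) = - adj x"
  using adj_add[of x "- x"] by (simp add: eq_neg_iff_add_eq_0 add.commute)

lemma adj_diff: "adj (x - y) = adj x - adj y"
  using adj_add[of x "- y"] by (simp add: adj_minus)

lemma adj_power: "adj (x ^ n) = adj x ^ n"
  by (induction n) (simp_all add: adj_mult power_commutes)

end

text \<open>A kernel is allowed, and the constant 0 is an instance. Hence the inequality in
  \<open>norm_1_le\<close>, where \<open>\<nu> 1\<close> is 0 or 1, and the hypothesis
  \<open>\<nu> 1 \<noteq> 0\<close> in \<open>spec_nonempty\<close>.\<close>

locale star_seminorm = complex_star_ring sc adj
  for sc :: "complex \<Rightarrow> 'a::ring_1" and adj :: "'a \<Rightarrow> 'a" +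
  fixes \<nu> :: "'a \<Rightarrow> real"
  assumes triangle: "\<nu> (x + y) \<le> \<nu> x + \<nu> y"
    and scale: "\<nu> (sc c * x) = cmod c * \<nu> x"
    and submult: "\<nu> (x * y) \<le> \<nu> x * \<nu> y"
    and cstar: "\<nu> (adj x * x) = (\<nu> x)\<^sup>2"
begin

lemma norm_0 [simp]: "\<nu> 0 = 0"
  using scale[of 0 0] by simp

lemma norm_minus: "\<nu> (- x) = \<nu> x"
  using scale[of "-1" x] by (simp add: sc_minus)

lemma norm_diff_commute: "\<nu> (x - y) = \<nu> (y - x)"
  using norm_minus[of "x - y"] by simp

lemma norm_ge_0 [simp]: "\<nu> x \<ge> 0"
  using triangle[of x "- x"] by (simp add: norm_minus)

lemma triangle_diff: "\<nu> (x - y) \<le> \<nu> x + \<nu> y"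
  using triangle[of x "- y"] by (simp add: norm_minus)

lemma norm_diff_ge: "\<nu> x - \<nu> y \<le> \<nu> (x - y)"
  using triangle[of "x - y" y] by simp

lemma norm_diff_le: "\<nu> (x - z) \<le> \<nu> (x - y) + \<nu> (y - z)"
  using triangle[of "x - y" "y - z"] by simp

lemma norm_sum_le: "\<nu> (sum f A) \<le> (\<Sum>i\<in>A. \<nu> (f i))"
  by (induction A rule: infinite_finite_induct) (auto intro: order_trans[OF triangle])

lemma norm_adj: "\<nu> (adj x) = \<nu> x"
proof -
  have "\<nu> y \<le> \<nu> (adj y)" for y
  proof (cases "\<nu> y = 0")
    case False
    then have "\<nu> y > 0"
      using norm_ge_0[of y] by linarith
    moreover have "\<nu> y * \<nu> y \<le> \<nu> (adj y) * \<nu> y"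
      using submult[of "adj y" y] cstar[of y] by (simp add: power2_eq_square)
    ultimately show ?thesis
      by simp
  qed simp
  from this[of x] this[of "adj x"] show ?thesis
    by simp
qed

lemma norm_1_le: "\<nu> 1 \<le> 1"
proof -
  have "\<nu> 1 * \<nu> 1 = 1 * \<nu> 1"
    using cstar[of 1] by (simp add: power2_eq_square)
  then show ?thesis
    by (simp only: mult_cancel_right) auto
qed

lemma norm_power_le: "\<nu> (x ^ n) \<le> \<nu> x ^ n"
proof (induction n)
  case (Suc n)
  have "\<nu> (x * x ^ n) \<le> \<nu> x * \<nu> (x ^ n)"
    by (rule submult)
  also have "\<dots> \<le> \<nu> x * \<nu> x ^ n"
    by (intro mult_left_mono Suc) simp
  finally show ?case
    by simp
qed (simp add: norm_1_le)

lemma norm_sa_square: "adj x = x \<Longrightarrow> \<nu> (x * x) = (\<nu> x)\<^sup>2"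
  using cstar[of x] by simp

text \<open>Iterates the C*-identity along repeated squaring. It stands in for the spectral radius
  formula: exact control of the powers with exponent \<open>2 ^ m\<close> replaces a limit of
  roots.\<close>

lemma norm_sa_power:
  assumes "adj x = x"
  shows "\<nu> (x ^ (2 ^ m)) = \<nu> x ^ (2 ^ m)"
proof (induction m)
  case (Suc m)
  have "x ^ (2 ^ Suc m) = x ^ (2 ^ m) * x ^ (2 ^ m)"
    by (simp add: mult_2 power_add)
  moreover have "\<nu> (x ^ (2 ^ m) * x ^ (2 ^ m)) = (\<nu> (x ^ (2 ^ m)))\<^sup>2"
    by (rule norm_sa_square) (simp add: adj_power assms)
  ultimately show ?case
    using Suc by (simp add: power_mult [symmetric] mult.commute)
qed simp

text \<open>Both sides have the square \<open>\<nu> (a\<^sup>* (x\<^sup>2 + y\<^sup>2) a)\<close>.\<close>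

lemma norm_conj_mult:
  assumes "adj x = x" "adj y = y" "x * y = y * x"
  shows "\<nu> ((x + sc \<i> * y) * a) = \<nu> ((x - sc \<i> * y) * a)"
proof -
  let ?p = "x + sc \<i> * y" and ?q = "x - sc \<i> * y"
  have adj: "adj ?p = ?q" "adj ?q = ?p"
    using assms by (simp_all add: adj_add adj_diff adj_mult adj_sc sc_minus sc_central[of y])
  have "x * (sc \<i> * y) = sc \<i> * y * x"
    by (simp add: sc_left_commute[of x] assms(3) mult.assoc)
  then have comm: "?q * ?p = ?p * ?q"
    by (simp add: left_diff_distrib right_diff_distrib distrib_left distrib_right)
  have "(\<nu> (?p * a))\<^sup>2 = \<nu> (adj a * (?q * ?p) * a)"
    by (simp add: cstar [symmetric] adj_mult adj mult.assoc)
  also have "\<dots> = (\<nu> (?q * a))\<^sup>2"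
    by (simp add: cstar [symmetric] adj_mult adj comm mult.assoc)
  finally show ?thesis
    by simp
qed

text \<open>\<open>y\<close> is the difference of \<open>x + \<i> y\<close> and
  \<open>x - \<i> y\<close> divided by \<open>2 \<i>\<close>, and these two have equal seminorm on
  every \<open>a\<close>. This is the seminorm form of the estimate of an imaginary part by the
  modulus.\<close>

lemma norm_imag_le:
  assumes "adj x = x" "adj y = y" "x * y = y * x"
  shows "\<nu> (y * a) \<le> \<nu> ((x + sc \<i> * y) * a)"
proof -
  have "sc (2 * \<i>) * (y * a) = (x + sc \<i> * y) * a - (x - sc \<i> * y) * a"
    using sc_add[of 1 1] by (simp add: algebra_simps sc_mult mult_2)
  then have "\<nu> (sc (2 * \<i>) * (y * a)) \<le> \<nu> ((x + sc \<i> * y) * a) + \<nu> ((x - sc \<i> * y) * a)"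
    using triangle_diff by metis
  then show ?thesis
    using norm_conj_mult[OF assms, of a] by (simp add: scale norm_mult)
qed

section \<open>Lower bounds and approximate invertibility\<close>

definition bounded_below :: "real \<Rightarrow> 'a \<Rightarrow> bool" where
  "bounded_below c x \<longleftrightarrow> (\<forall>a. c * \<nu> a \<le> \<nu> (x * a))"

text \<open>Expresses invertibility in the completion inside the ring itself: errors below 1 can be
  improved geometrically by a Neumann series. The equivalence is
  \<open>almost_inv_iff_inverse_seq\<close>.\<close>

definition almost_inv :: "'a \<Rightarrow> bool" where
  "almost_inv x \<longleftrightarrow> (\<exists>q. \<nu> (1 - x * q) < 1 \<and> \<nu> (1 - q * x) < 1)"

lemma almost_inv_minus: "almost_inv (- x) \<longleftrightarrow> almost_inv x"
proof -
  have "almost_inv x \<Longrightarrow> almost_inv (- x)" for x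
    unfolding almost_inv_def by (metis minus_mult_minus)
  from this[of x] this[of "- x"] show ?thesis
    by auto
qed

lemma geometric_sum:
  fixes y :: 'a
  shows "(1 - y) * (\<Sum>j<n. y ^ j) = 1 - y ^ n"
  by (induction n) (simp_all add: distrib_left left_diff_distrib)

lemma geometric_sum':
  fixes y :: 'a
  shows "(\<Sum>j<n. y ^ j) * (1 - y) = 1 - y ^ n"
proof (induction n)
  case (Suc n)
  have "(\<Sum>j<Suc n. y ^ j) * (1 - y) = (\<Sum>j<n. y ^ j) * (1 - y) + (y ^ n - y ^ n * y)"
    by (simp add: algebra_simps)
  then show ?case
    by (simp add: Suc power_commutes)
qed simp

lemma neumann_commute:
  fixes q x :: 'a
  shows "q * (1 - x * q) ^ j = (1 - q * x) ^ j * q"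
proof (induction j)
  case (Suc j)
  have "q * (1 - x * q) ^ Suc j = (1 - q * x) * (q * (1 - x * q) ^ j)"
    by (simp add: algebra_simps)
  then show ?case
    by (simp add: Suc mult.assoc)
qed simp

text \<open>By \<open>neumann_commute\<close>, powers of the right error can be moved through
  \<open>q\<close> into powers of the left error, so one partial sum improves both sides at
  once.\<close>

lemma neumann_series:
  fixes q x :: 'a
  defines "s n \<equiv> q * (\<Sum>j<n. (1 - x * q) ^ j)"
  shows "1 - x * s n = (1 - x * q) ^ n" "1 - s n * x = (1 - q * x) ^ n"
proof -
  show "1 - x * s n = (1 - x * q) ^ n"
    using geometric_sum[of "1 - x * q" n] by (simp add: s_def mult.assoc [symmetric])
  have "s n = (\<Sum>j<n. (1 - q * x) ^ j) * q"
    by (simp add: s_def sum_distrib_left sum_distrib_right neumann_commute)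
  then show "1 - s n * x = (1 - q * x) ^ n"
    using geometric_sum'[of "1 - q * x" n] by (simp add: mult.assoc)
qed

lemma almost_inv_approx:
  assumes "almost_inv x" "e > 0"
  obtains q where "\<nu> (1 - x * q) < e" "\<nu> (1 - q * x) < e"
proof -
  obtain q where q: "\<nu> (1 - x * q) < 1" "\<nu> (1 - q * x) < 1"
    using assms(1) unfolding almost_inv_def by blast
  have "(\<lambda>n. \<nu> (1 - x * q) ^ n) \<longlonglongrightarrow> 0" "(\<lambda>n. \<nu> (1 - q * x) ^ n) \<longlonglongrightarrow> 0"
    using q by (simp_all add: LIMSEQ_power_zero)
  then have "\<forall>\<^sub>F n in sequentially. \<nu> (1 - x * q) ^ n < e"
    "\<forall>\<^sub>F n in sequentially. \<nu> (1 - q * x) ^ n < e"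
    using assms(2) by (auto dest: order_tendstoD(2))
  then have "\<forall>\<^sub>F n in sequentially. \<nu> (1 - x * q) ^ n < e \<and> \<nu> (1 - q * x) ^ n < e"
    by (rule eventually_conj)
  then obtain n where "\<nu> (1 - x * q) ^ n < e" "\<nu> (1 - q * x) ^ n < e"
    by (auto simp: eventually_sequentially)
  then show ?thesis
    by (intro that[of "q * (\<Sum>j<n. (1 - x * q) ^ j)"])
      (auto simp: neumann_series intro: le_less_trans[OF norm_power_le])
qed

lemma bounded_below_mono: "bounded_below c x \<Longrightarrow> d \<le> c \<Longrightarrow> bounded_below d x"
  unfolding bounded_below_def by (meson mult_right_mono norm_ge_0 order_trans)

lemma bounded_below_perturb:
  assumes "bounded_below c x"
  shows "bounded_below (c - \<nu> (x - y)) y"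
  unfolding bounded_below_def
proof
  fix a
  have "c * \<nu> a \<le> \<nu> (x * a)"
    using assms by (simp add: bounded_below_def)
  also have "\<nu> (x * a) \<le> \<nu> (y * a) + \<nu> ((x - y) * a)"
    using triangle[of "y * a" "(x - y) * a"] by (simp add: algebra_simps)
  also have "\<nu> ((x - y) * a) \<le> \<nu> (x - y) * \<nu> a"
    by (rule submult)
  finally show "(c - \<nu> (x - y)) * \<nu> a \<le> \<nu> (y * a)"
    by (simp add: algebra_simps)
qed

lemma bounded_below_mult:
  assumes "bounded_below c x" "bounded_below d y" "c \<ge> 0"
  shows "bounded_below (c * d) (x * y)"
  unfolding bounded_below_def
proof
  fix a
  have "c * (d * \<nu> a) \<le> c * \<nu> (y * a)"
    using assms by (intro mult_left_mono) (auto simp: bounded_below_def)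
  also have "\<dots> \<le> \<nu> (x * (y * a))"
    using assms by (auto simp: bounded_below_def)
  finally show "c * d * \<nu> a \<le> \<nu> (x * y * a)"
    by (simp add: mult.assoc)
qed

text \<open>The lower bound \<open>c\<close> limits any good approximate inverse \<open>q\<close> of
  \<open>x\<close> to seminorm about \<open>1 / c\<close>, so \<open>(x - y) q\<close> has seminorm
  below 1 and \<open>q\<close> still serves for \<open>y\<close>.\<close>

lemma almost_inv_perturb:
  assumes "almost_inv x" "bounded_below c x" "\<nu> (x - y) < c"
  shows "almost_inv y"
proof -
  define d where "d = \<nu> (x - y)"
  have d: "0 \<le> d" "d < c"
    using assms(3) by (auto simp: d_def)
  \<comment> \<open>The goal \<open>e + d (1 + e) / c < 1\<close> amounts to
    \<open>e (c + d) < c - d\<close>; this \<open>e\<close> uses half of that slack.\<close>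
  define e where "e = (c - d) / (2 * (c + d))"
  have e: "e > 0" "e * (2 * (c + d)) = c - d"
    using d by (auto simp: e_def)
  obtain q where q: "\<nu> (1 - x * q) < e" "\<nu> (1 - q * x) < e"
    using almost_inv_approx[OF assms(1) e(1)] .
  have "c * \<nu> q \<le> \<nu> (x * q)"
    using assms(2) by (simp add: bounded_below_def)
  also have "\<dots> \<le> 1 + e"
    using triangle_diff[of 1 "1 - x * q"] norm_1_le q(1) by simp
  finally have cq: "c * \<nu> q \<le> 1 + e" .
  have dq: "e + d * \<nu> q < 1"
  proof -
    have "c * (e + d * \<nu> q) \<le> c * e + d * (1 + e)"
      using mult_left_mono[OF cq d(1)] by (simp add: algebra_simps)
    also have "\<dots> = e * (c + d) + d"
      by (simp add: algebra_simps)
    also have "\<dots> < c * 1"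
      using e d by (simp add: algebra_simps)
    finally show ?thesis
      using d by simp
  qed
  have "1 - y * q = (1 - x * q) + (x - y) * q" "1 - q * y = (1 - q * x) + q * (x - y)"
    by (simp_all add: algebra_simps)
  then have "\<nu> (1 - y * q) \<le> \<nu> (1 - x * q) + \<nu> ((x - y) * q)"
    "\<nu> (1 - q * y) \<le> \<nu> (1 - q * x) + \<nu> (q * (x - y))"
    using triangle by metis+
  moreover have "\<nu> ((x - y) * q) \<le> d * \<nu> q" "\<nu> (q * (x - y)) \<le> d * \<nu> q"
    using submult[of "x - y" q] submult[of q "x - y"] by (simp_all add: d_def mult.commute)
  ultimately have "\<nu> (1 - y * q) < 1" "\<nu> (1 - q * y) < 1"
    using q dq by linarith+
  then show ?thesis
    unfolding almost_inv_def by blast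
qed

lemma almost_inv_imp_bounded_below:
  assumes "almost_inv x"
  shows "\<exists>c>0. bounded_below c x"
proof -
  obtain q where q: "\<nu> (1 - q * x) < 1/2"
    using almost_inv_approx[OF assms, of "1/2"] by (auto simp del: divide_le_0_1_iff)
  \<comment> \<open>Adding 1 to \<open>\<nu> q\<close> keeps the denominator positive, as
    \<open>\<nu> q\<close> may vanish.\<close>
  have "1 / (2 * (\<nu> q + 1)) * \<nu> a \<le> \<nu> (x * a)" for a
  proof -
    have "\<nu> a \<le> \<nu> ((1 - q * x) * a) + \<nu> (q * (x * a))"
      using triangle[of "(1 - q * x) * a" "q * (x * a)"] by (simp add: algebra_simps)
    also have "\<dots> \<le> 1/2 * \<nu> a + \<nu> q * \<nu> (x * a)"
      by (intro add_mono submult order_trans[OF submult] mult_right_mono) (use q in auto)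
    also have "\<dots> \<le> 1/2 * \<nu> a + (\<nu> q + 1) * \<nu> (x * a)"
      by (intro add_left_mono mult_right_mono) auto
    finally have "\<nu> a \<le> 2 * (\<nu> q + 1) * \<nu> (x * a)"
      by (simp add: algebra_simps)
    moreover have "2 * (\<nu> q + 1) > 0"
      by (simp add: add_nonneg_pos)
    ultimately show ?thesis
      by (simp add: divide_simps mult.commute)
  qed
  moreover have "1 / (2 * (\<nu> q + 1)) > 0"
    by (simp add: add_nonneg_pos)
  ultimately show ?thesis
    unfolding bounded_below_def by blast
qed

section \<open>Scalar shifts of selfadjoint elements\<close>

lemma norm_sc_le: "\<nu> (sc c) \<le> cmod c"
  using scale[of c 1] mult_left_mono[OF norm_1_le, of "cmod c"] by simp

lemma almost_inv_sc_diff: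
  assumes "\<nu> x < cmod c"
  shows "almost_inv (sc c - x)"
proof -
  have c: "c \<noteq> 0"
    using assms order.strict_trans1[OF norm_ge_0] by fastforce
  have "1 - (sc c - x) * sc (1 / c) = sc (1 / c) * x" "1 - sc (1 / c) * (sc c - x) = sc (1 / c) * x"
    using c by (simp_all add: left_diff_distrib right_diff_distrib sc_mult [symmetric] sc_central[of x])
  moreover have "\<nu> (sc (1 / c) * x) < 1"
    using assms c by (simp add: scale norm_divide)
  ultimately show ?thesis
    unfolding almost_inv_def by metis
qed

text \<open>The resolvent estimate off the real axis: \<open>norm_imag_le\<close> with the scalar
  \<open>t\<close> as imaginary part.\<close>

lemma bounded_below_imag:
  assumes "adj h = h" "t > 0"
  shows "bounded_below t (h + sc (\<i> * complex_of_real t))"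
  unfolding bounded_below_def
proof
  fix a
  have "\<nu> (sc t * a) \<le> \<nu> ((h + sc \<i> * sc t) * a)"
    by (rule norm_imag_le) (simp_all add: assms adj_sc sc_central[of h])
  then show "t * \<nu> a \<le> \<nu> ((h + sc (\<i> * t)) * a)"
    using assms(2) by (simp add: scale sc_mult)
qed

text \<open>Starting from a large imaginary shift, where the Neumann series applies, the shift can be
  multiplied by \<open>2/3\<close> over and over again, because \<open>h + it\<close> is bounded below by \<open>t\<close>.\<close>

lemma almost_inv_imag_pos:
  assumes "adj h = h" "t > 0"
  shows "almost_inv (h + sc (\<i> * complex_of_real t))"
proof -
  have *: "\<nu> h < t * (3/2) ^ n \<Longrightarrow> t > 0 \<Longrightarrow> almost_inv (h + sc (\<i> * complex_of_real t))" for n t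
  proof (induction n arbitrary: t)
    case 0
    then have "almost_inv (sc (\<i> * complex_of_real t) - (- h))"
      by (intro almost_inv_sc_diff) (simp add: norm_minus norm_mult)
    then show ?case
      by (simp add: add.commute)
  next
    case (Suc n)
    \<comment> \<open>Passing from \<open>s\<close> to \<open>t\<close> costs \<open>s - t\<close>,
      which is less than the lower bound \<open>s\<close>; any factor above 1 has this
      property.\<close>
    define s where "s = 3/2 * t"
    have st: "s > 0" "s - t < s" "\<nu> h < s * (3/2) ^ n" "s - t > 0"
      using Suc.prems by (simp_all add: s_def mult.assoc)
    let ?x = "h + sc (\<i> * complex_of_real s)" and ?y = "h + sc (\<i> * complex_of_real t)"
    have "?x - ?y = sc (\<i> * complex_of_real (s - t))"
      by (simp add: sc_diff [symmetric] algebra_simps)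
    then have "\<nu> (?x - ?y) \<le> s - t"
      using norm_sc_le[of "\<i> * complex_of_real (s - t)"] st(4)
      by (simp add: norm_mult del: of_real_diff)
    then have "\<nu> (?x - ?y) < s"
      using st(2) by linarith
    then show ?case
      by (rule almost_inv_perturb[OF Suc.IH[OF st(3,1)] bounded_below_imag[OF assms(1) st(1)]])
  qed
  obtain n where "\<nu> h / t < (3/2) ^ n"
    using real_arch_pow[of "3/2" "\<nu> h / t"] by auto
  then show ?thesis
    using assms(2) by (intro *[of _ n]) (simp_all add: field_simps)
qed

lemma almost_inv_imag:
  assumes "adj h = h" "t \<noteq> 0"
  shows "almost_inv (h + sc (\<i> * complex_of_real t))"
proof (cases "t > 0")
  case False
  have "almost_inv (- h + sc (\<i> * complex_of_real (- t)))"
    using assms False by (intro almost_inv_imag_pos) (auto simp: adj_minus)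
  then have "almost_inv (- (h + sc (\<i> * complex_of_real t)))"
    by (simp add: sc_minus)
  then show ?thesis
    by (simp only: almost_inv_minus)
qed (use assms in \<open>auto intro: almost_inv_imag_pos\<close>)

text \<open>Moving \<open>h\<close> by \<open>\<i> c / 3\<close> leaves a lower bound of
  \<open>2 c / 3\<close>. The moved element is invertible by the imaginary shift, and moving back
  costs only \<open>c / 3\<close>, which is below that bound.\<close>

lemma almost_inv_if_bounded_below:
  assumes "adj h = h" "bounded_below c h" "c > 0"
  shows "almost_inv h"
proof -
  let ?y = "h + sc (\<i> * complex_of_real (c / 3))"
  have le: "\<nu> (sc (\<i> * complex_of_real (c / 3))) \<le> c / 3"
    using norm_sc_le[of "\<i> * complex_of_real (c / 3)"] assms(3) by (simp add: norm_mult norm_divide)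
  have "bounded_below (c - \<nu> (h - ?y)) ?y"
    by (rule bounded_below_perturb) fact
  then have "bounded_below (2 / 3 * c) ?y"
    by (rule bounded_below_mono) (use le in \<open>simp add: norm_minus\<close>)
  moreover have "\<nu> (?y - h) < 2 / 3 * c"
    using le assms(3) by simp
  moreover have "almost_inv ?y"
    using assms by (intro almost_inv_imag_pos) auto
  ultimately show ?thesis
    using almost_inv_perturb by blast
qed

text \<open>The product of the factors \<open>1 + k\<^bsup>2\<cdot>2\<^sup>i\<^esup>\<close> for \<open>i < m\<close> telescopes against \<open>1 - k\<^sup>2\<close>,
  and each factor \<open>1 + y\<^sup>2\<close> is at least as large as \<open>2 y\<close>.\<close>

lemma norm_one_plus_square_ge:
  assumes "adj y = y"
  shows "2 * \<nu> (y * a) \<le> \<nu> ((1 + y\<^sup>2) * a)"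
proof -
  \<comment> \<open>The identity \<open>(1 - y\<^sup>2)\<^sup>2 + (2 y)\<^sup>2 = (1 +
    y\<^sup>2)\<^sup>2\<close>: the element \<open>?u + \<i> ?v\<close> is the square of
    \<open>1 + \<i> y\<close> and has the same modulus as \<open>?w\<close>, while
    \<open>?v = 2 y\<close> is its imaginary part.\<close>
  let ?u = "1 - y * y" and ?v = "y + y" and ?w = "1 + y * y"
  have sa: "adj ?u = ?u" "adj ?v = ?v" "adj ?w = ?w" "?u * ?v = ?v * ?u"
    using assms by (simp_all add: adj_add adj_diff adj_mult algebra_simps)
  define z where "z = sc \<i> * ?v"
  have "z * z = sc \<i> * sc \<i> * (?v * ?v)"
    by (simp only: z_def mult.assoc sc_left_commute[of ?v])
  also have "\<dots> = - (?v * ?v)"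
    by (simp add: sc_mult [symmetric] sc_minus)
  finally have "z * z = - (?v * ?v)" .
  moreover have "?u * z = z * ?u"
    using sa(4) by (simp only: z_def mult.assoc sc_left_commute[of ?u])
  moreover have adj_z: "adj z = - z"
    using sa(2) by (simp add: z_def adj_mult adj_sc sc_minus sc_central[of ?v])
  ultimately have "(?u - z) * (?u + z) = ?w * ?w"
    by (simp add: left_diff_distrib distrib_left distrib_right right_diff_distrib mult.assoc)
  then have sq: "adj (?u + z) * (?u + z) = adj ?w * ?w"
    using sa(1,3) adj_z by (simp only: adj_add[of ?u]) simp
  have "(\<nu> ((?u + z) * a))\<^sup>2 = \<nu> (adj a * (adj (?u + z) * (?u + z)) * a)"
    by (simp only: cstar [symmetric] adj_mult mult.assoc)
  also have "\<dots> = (\<nu> (?w * a))\<^sup>2"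
    by (simp only: sq) (simp only: cstar [symmetric] adj_mult mult.assoc)
  finally have "\<nu> ((?u + z) * a) = \<nu> (?w * a)"
    by simp
  moreover have "?v * a = sc 2 * (y * a)"
    using sc_add[of 1 1] by (simp add: mult_2 distrib_right)
  ultimately show ?thesis
    using norm_imag_le[OF sa(1,2,4), of a] by (simp add: z_def scale power2_eq_square)
qed

lemma telescoping_product:
  assumes "adj k = k"
  shows "\<exists>A. (1 - k\<^sup>2) * A = 1 - k ^ (2 ^ Suc m) \<and> (\<forall>a. 2 ^ m * \<nu> (k ^ (2 ^ m - 1) * a) \<le> \<nu> (A * a))"
proof (induction m)
  case 0
  then show ?case
    by (intro exI[of _ 1]) simp
next
  case (Suc m)
  then obtain A where A: "(1 - k\<^sup>2) * A = 1 - k ^ (2 ^ Suc m)"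
    "\<And>a. 2 ^ m * \<nu> (k ^ (2 ^ m - 1) * a) \<le> \<nu> (A * a)"
    by blast
  define y where "y = k ^ (2 ^ m)"
  have y2: "y\<^sup>2 = k ^ (2 ^ Suc m)"
    by (simp add: y_def power_mult [symmetric] mult.commute)
  have y4: "y\<^sup>2 * y\<^sup>2 = k ^ (2 ^ Suc (Suc m))"
    by (simp add: y2 power_add [symmetric])
  have "(1 - k\<^sup>2) * (A * (1 + y\<^sup>2)) = (1 - y\<^sup>2) * (1 + y\<^sup>2)"
    by (simp only: mult.assoc [symmetric] A(1) y2)
  also have "\<dots> = 1 - y\<^sup>2 * y\<^sup>2"
    by (simp add: left_diff_distrib distrib_left)
  finally have "(1 - k\<^sup>2) * (A * (1 + y\<^sup>2)) = 1 - k ^ (2 ^ Suc (Suc m))"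
    by (simp only: y4)
  moreover have "2 ^ Suc m * \<nu> (k ^ (2 ^ Suc m - 1) * a) \<le> \<nu> (A * (1 + y\<^sup>2) * a)" for a
  proof -
    let ?z = "k ^ (2 ^ m - 1)"
    \<comment> \<open>The exponent \<open>2 ^ m - 1\<close> is the sum of the powers
      \<open>2 ^ i\<close> with \<open>i < m\<close>, one for each factor; each use of the bound
      \<open>2 y\<close> contributes one such power of \<open>k\<close> and a factor 2.\<close>
    have "(2::nat) ^ Suc m - 1 = 2 ^ m + (2 ^ m - 1)"
      by simp
    then have "2 ^ Suc m * \<nu> (k ^ (2 ^ Suc m - 1) * a) = 2 ^ m * (2 * \<nu> (y * (?z * a)))"
      by (simp only: y_def power_add mult.assoc power_Suc)
    also have "\<dots> \<le> 2 ^ m * \<nu> ((1 + y\<^sup>2) * (?z * a))"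
      by (intro mult_left_mono norm_one_plus_square_ge) (simp_all add: y_def adj_power assms)
    also have "(1 + y\<^sup>2) * (?z * a) = ?z * ((1 + y\<^sup>2) * a)"
      by (simp add: y2 algebra_simps power_add [symmetric] mult.assoc [symmetric])
    also have "2 ^ m * \<nu> (?z * ((1 + y\<^sup>2) * a)) \<le> \<nu> (A * ((1 + y\<^sup>2) * a))"
      by (rule A(2))
    finally show ?thesis
      by (simp add: mult.assoc)
  qed
  ultimately show ?case
    by blast
qed

text \<open>Seminorm form of the fact that a selfadjoint element of norm 1 has 1 or -1 in its
  spectrum. The telescoping product gives an \<open>A\<close> of seminorm at least
  \<open>2 ^ m\<close>, because the powers of \<open>k\<close> do not decay, while
  \<open>(1 - k\<^sup>2) A = 1 - k ^ (2 ^ Suc m)\<close> has seminorm at most 2.\<close>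

lemma unit_norm_almost_kernel:
  assumes "adj k = k" "\<nu> k = 1" "e > 0"
  obtains A where "\<nu> A > 0" "\<nu> ((1 - k\<^sup>2) * A) \<le> e * \<nu> A"
proof -
  obtain m where m: "2 / e < 2 ^ m"
    using real_arch_pow[of 2 "2 / e"] by auto
  obtain A where A: "(1 - k\<^sup>2) * A = 1 - k ^ (2 ^ Suc m)"
    "\<And>a. 2 ^ m * \<nu> (k ^ (2 ^ m - 1) * a) \<le> \<nu> (A * a)"
    using telescoping_product[OF assms(1), of m] by blast
  have "1 = \<nu> (k ^ (2 ^ m))"
    using norm_sa_power[OF assms(1)] assms(2) by simp
  also have "k ^ (2 ^ m) = k * k ^ (2 ^ m - 1)"
    by (metis power_eq_if power_not_zero zero_neq_numeral)
  also have "\<nu> \<dots> \<le> \<nu> (k ^ (2 ^ m - 1))"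
    using submult[of k "k ^ (2 ^ m - 1)"] assms(2) by simp
  finally have "2 ^ m * 1 \<le> 2 ^ m * \<nu> (k ^ (2 ^ m - 1))"
    by (intro mult_left_mono) auto
  also have "\<dots> \<le> \<nu> A"
    using A(2)[of 1] by simp
  finally have ge: "2 ^ m \<le> \<nu> A"
    by simp
  have "\<nu> ((1 - k\<^sup>2) * A) \<le> \<nu> 1 + \<nu> (k ^ (2 ^ Suc m))"
    unfolding A(1) by (rule triangle_diff)
  also have "\<dots> \<le> 2"
    using norm_1_le norm_sa_power[OF assms(1), of "Suc m"] assms(2) by simp
  also have "2 \<le> e * 2 ^ m"
    using m assms(3) by (simp add: field_simps)
  also have "\<dots> \<le> e * \<nu> A"
    using ge assms(3) by simp
  finally show ?thesis
    using ge by (intro that[of A]) (auto intro: less_le_trans[of 0 "2 ^ m"])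
qed

lemma bounded_below_square_diff:
  assumes "bounded_below c (x - sc s)" "bounded_below d (x + sc s)" "c \<ge> 0"
  shows "bounded_below (c * d) (x * x - sc (s * s))"
proof -
  have "(x - sc s) * (x + sc s) = x * x - sc (s * s)"
    by (simp add: left_diff_distrib distrib_left sc_mult sc_central[of x])
  then show ?thesis
    using bounded_below_mult[OF assms] by simp
qed

text \<open>Averages \<open>q\<close> with its adjoint. Since \<open>x\<close> is selfadjoint, the
  left error of \<open>q\<close> is the adjoint of the right error of \<open>adj q\<close>, so the
  averaged error stays below \<open>e\<close>.\<close>

lemma almost_inv_approx_sa:
  assumes "adj x = x" "almost_inv x" "e > 0"
  obtains q where "adj q = q" "\<nu> (1 - x * q) < e" "\<nu> (1 - q * x) < e"
proof -
  obtain q where q: "\<nu> (1 - x * q) < e" "\<nu> (1 - q * x) < e"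
    using almost_inv_approx[OF assms(2,3)] .
  define p where "p = sc (1/2) * (q + adj q)"
  have p: "adj p = p"
    by (simp add: p_def adj_mult adj_sc adj_add sc_central[of "q + adj q"] add.commute[of "adj q"])
  have half: "z = sc (1/2) * (z + z)" for z
    by (simp add: distrib_left distrib_right [symmetric] sc_add [symmetric])
  have "1 - x * p = sc (1/2) * ((1 + 1) - x * (q + adj q))"
    using half[of 1] by (simp add: p_def sc_left_commute[of x] right_diff_distrib)
  also have "(1 + 1) - x * (q + adj q) = (1 - x * q) + adj (1 - q * x)"
    by (simp add: adj_diff adj_mult assms(1) algebra_simps)
  finally have "\<nu> (1 - x * p) \<le> 1/2 * (\<nu> (1 - x * q) + \<nu> (1 - q * x))"
    using triangle[of "1 - x * q" "adj (1 - q * x)"] by (simp add: scale norm_adj norm_divide)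
  then have e: "\<nu> (1 - x * p) < e"
    using q by simp
  moreover have "1 - p * x = adj (1 - x * p)"
    by (simp add: adj_diff adj_mult assms(1) p)
  ultimately show ?thesis
    using that[OF p] by (simp add: norm_adj)
qed

text \<open>Put \<open>s = 1 / \<nu> q\<close> and \<open>k = s q\<close>, an element of seminorm 1.
  If \<open>q\<close> were the exact inverse of \<open>x\<close>, then
  \<open>x\<^sup>2 (1 - k\<^sup>2)\<close> would be \<open>x\<^sup>2 - s\<^sup>2\<close>, so an
  almost kernel of \<open>1 - k\<^sup>2\<close> is one of \<open>x\<^sup>2 - s\<^sup>2\<close>. In
  the bound, the square of \<open>\<nu> x\<close> comes from the almost kernel, the other two terms
  from the defect of \<open>q\<close>.\<close>

lemma approx_inverse_almost_kernel:
  assumes "adj x = x" "adj q = q" "\<nu> (1 - x * q) \<le> e" "\<nu> q > 0" "e > 0"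
  obtains A where "\<nu> A > 0"
    "\<nu> ((x * x - sc (complex_of_real (1 / \<nu> q) ^ 2)) * A) \<le> e * ((\<nu> x)\<^sup>2 + (1 / \<nu> q)\<^sup>2 + \<nu> x * (1 / \<nu> q)) * \<nu> A"
proof -
  define s where "s = 1 / \<nu> q"
  define r where "r = complex_of_real s"
  have s: "s > 0" "s * \<nu> q = 1"
    using assms(4) by (auto simp: s_def)
  define k where "k = sc r * q"
  have k: "adj k = k" "\<nu> k = 1"
    using s assms(2) by (simp_all add: k_def r_def adj_mult adj_sc sc_central[of q] scale)
  obtain A where A: "\<nu> A > 0" "\<nu> ((1 - k\<^sup>2) * A) \<le> e * \<nu> A"
    using unit_norm_almost_kernel[OF k assms(5)] .
  \<comment> \<open>The defect \<open>1 - x\<^sup>2 q\<^sup>2\<close>, arranged so that every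
    summand contains the small factor \<open>1 - x q\<close>.\<close>
  define w where "w = (1 - x * q) + x * (1 - x * q) * q"
  have w: "w = 1 - x * x * (q * q)"
    by (simp add: w_def algebra_simps)
  have "k * k = sc (r * r) * (q * q)"
    by (simp only: k_def sc_mult mult.assoc sc_left_commute[of q])
  then have "x * x * (k * k) = sc (r * r) * (x * x * (q * q))"
    by (simp only: sc_left_commute[of "x * x"])
  then have "x * x * (1 - k\<^sup>2) - sc (r * r) * w = x * x - sc (r * r)"
    by (simp only: w power2_eq_square right_diff_distrib) simp
  then have eq: "(x * x - sc (r * r)) * A = x * x * ((1 - k\<^sup>2) * A) - sc (r * r) * (w * A)"
    by (metis left_diff_distrib mult.assoc)
  have "\<nu> (x * (1 - x * q) * q) \<le> \<nu> x * \<nu> (1 - x * q) * \<nu> q"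
    by (rule order_trans[OF submult]) (intro mult_right_mono submult norm_ge_0)
  also have "\<dots> \<le> \<nu> x * e * \<nu> q"
    using assms(3) by (intro mult_right_mono mult_left_mono) auto
  finally have nw: "\<nu> w \<le> e + \<nu> x * e * \<nu> q"
    unfolding w_def using triangle[of "1 - x * q" "x * (1 - x * q) * q"] assms(3) by linarith
  have "\<nu> (x * x * ((1 - k\<^sup>2) * A)) \<le> \<nu> (x * x) * \<nu> ((1 - k\<^sup>2) * A)"
    by (rule submult)
  also have "\<dots> \<le> \<nu> (x * x) * (e * \<nu> A)"
    by (intro mult_left_mono A) simp
  also have "\<nu> (x * x) = (\<nu> x)\<^sup>2"
    by (rule norm_sa_square) fact
  finally have 1: "\<nu> (x * x * ((1 - k\<^sup>2) * A)) \<le> e * (\<nu> x)\<^sup>2 * \<nu> A"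
    by (simp add: mult_ac)
  have "\<nu> (sc (r * r) * (w * A)) = s\<^sup>2 * \<nu> (w * A)"
    by (simp add: scale r_def norm_mult power2_eq_square)
  also have "\<dots> \<le> s\<^sup>2 * ((e + \<nu> x * e * \<nu> q) * \<nu> A)"
    by (intro mult_left_mono order_trans[OF submult] mult_right_mono nw) auto
  also have "\<dots> = e * s\<^sup>2 * \<nu> A + e * \<nu> x * s * (s * \<nu> q) * \<nu> A"
    by (simp add: algebra_simps power2_eq_square)
  also have "\<dots> = e * (s\<^sup>2 + \<nu> x * s) * \<nu> A"
    by (simp only: s(2)) (simp add: algebra_simps)
  finally have 2: "\<nu> (sc (r * r) * (w * A)) \<le> e * (s\<^sup>2 + \<nu> x * s) * \<nu> A" .
  have "\<nu> ((x * x - sc (r * r)) * A) \<le> e * ((\<nu> x)\<^sup>2 + s\<^sup>2 + \<nu> x * s) * \<nu> A"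
    unfolding eq using triangle_diff[of "x * x * ((1 - k\<^sup>2) * A)" "sc (r * r) * (w * A)"] 1 2
    by (simp add: algebra_simps)
  then show ?thesis
    using that[OF A(1)] by (simp add: s_def r_def power2_eq_square)
qed

text \<open>For approximate inverses \<open>q\<close> of \<open>x\<close>, the element \<open>x\<^sup>2 - \<nu>(q)\<^bsup>-2\<^esup>\<close> almost annihilates something, and a
  limit point of the numbers \<open>\<nu>(q)\<^bsup>-1\<^esup>\<close> is, up to sign, in the spectrum.\<close>

lemma bounded_below_if_gap:
  assumes "adj x = x" "r > 0"
    and gap: "\<And>t. \<bar>t\<bar> \<le> r \<Longrightarrow> \<exists>c>0. bounded_below c (x - sc (complex_of_real t))"
  shows "bounded_below r x"
proof (rule ccontr)
  assume "\<not> bounded_below r x"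
  then obtain b where b: "\<nu> (x * b) < r * \<nu> b"
    by (auto simp: bounded_below_def not_le)
  have "0 < r * \<nu> b"
    using b norm_ge_0 by (rule order.strict_trans1[rotated])
  then have nb: "\<nu> b > 0"
    using assms(2) by (simp add: zero_less_mult_iff)
  have inv: "almost_inv x"
    using gap[of 0] assms by (auto intro: almost_inv_if_bounded_below)
  define M where "M = (\<nu> x)\<^sup>2 + r\<^sup>2 + \<nu> x * r"
  have "\<exists>s A. 0 \<le> s \<and> s \<le> r \<and> \<nu> A > 0 \<and> \<nu> ((x * x - sc (complex_of_real (s * s))) * A) \<le> e * M * \<nu> A"
    if "e > 0" for e
  proof -
    \<comment> \<open>The second bound exploits the counterexample \<open>b\<close>: it forces
      \<open>1 / r < \<nu> q\<close>, so the candidate \<open>1 / \<nu> q\<close> for a spectral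
      value falls below \<open>r\<close>.\<close>
    define d where "d = min e (1 - \<nu> (x * b) / (r * \<nu> b))"
    have d: "d > 0" "d \<le> e" "d \<le> 1 - \<nu> (x * b) / (r * \<nu> b)"
      using b nb assms(2) that by (auto simp: d_def)
    obtain q where q: "adj q = q" "\<nu> (1 - x * q) < d" "\<nu> (1 - q * x) < d"
      using almost_inv_approx_sa[OF assms(1) inv d(1)] .
    have "\<nu> b \<le> \<nu> ((1 - q * x) * b) + \<nu> (q * (x * b))"
      using triangle[of "(1 - q * x) * b" "q * (x * b)"] by (simp add: algebra_simps)
    also have "\<dots> < d * \<nu> b + \<nu> q * \<nu> (x * b)"
      using submult[of "1 - q * x" b] submult[of q "x * b"] mult_strict_right_mono[OF q(3) nb] by linarith
    also have "d * \<nu> b \<le> \<nu> b - \<nu> (x * b) / r"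
      using mult_right_mono[OF d(3), of "\<nu> b"] nb assms(2) by (simp add: left_diff_distrib)
    finally have less: "\<nu> (x * b) / r < \<nu> q * \<nu> (x * b)"
      by linarith
    then have "\<nu> (x * b) > 0"
      by (metis div_0 mult_zero_right norm_ge_0 order_le_less order_less_irrefl)
    with less have q1: "1 / r < \<nu> q"
      using mult_less_cancel_right_pos[of "\<nu> (x * b)" "1 / r" "\<nu> q"] by simp
    then have nq: "\<nu> q > 0"
      using assms(2) by (meson less_trans zero_less_divide_1_iff)
    obtain A where A: "\<nu> A > 0"
      "\<nu> ((x * x - sc (complex_of_real (1 / \<nu> q) ^ 2)) * A) \<le> d * ((\<nu> x)\<^sup>2 + (1 / \<nu> q)\<^sup>2 + \<nu> x * (1 / \<nu> q)) * \<nu> A"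
      using approx_inverse_almost_kernel[OF assms(1) q(1) less_imp_le[OF q(2)] nq d(1)] .
    have le: "1 / \<nu> q \<le> r"
      using q1 nq assms(2) by (simp add: field_simps)
    have le2: "d * ((\<nu> x)\<^sup>2 + (1 / \<nu> q)\<^sup>2 + \<nu> x * (1 / \<nu> q)) * \<nu> A \<le> e * M * \<nu> A"
      unfolding M_def using d le nq that
      by (intro mult_right_mono mult_mono add_mono power_mono mult_left_mono order_refl) auto
    have "\<nu> ((x * x - sc (complex_of_real (1 / \<nu> q * (1 / \<nu> q)))) * A) \<le> e * M * \<nu> A"
      using order_trans[OF A(2) le2] by (simp add: power2_eq_square)
    with A(1) le nq show ?thesis
      by (intro exI[of _ "1 / \<nu> q"] exI[of _ A]) auto
  qed
  then have "\<exists>s A. 0 \<le> s \<and> s \<le> r \<and> \<nu> A > 0 \<and>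
      \<nu> ((x * x - sc (complex_of_real (s * s))) * A) \<le> inverse (real (Suc n)) * M * \<nu> A" for n
    by simp
  then obtain s A where sA: "\<And>n. 0 \<le> s n" "\<And>n. s n \<le> r" "\<And>n. \<nu> (A n) > 0"
    "\<And>n. \<nu> ((x * x - sc (complex_of_real (s n * s n))) * A n) \<le> inverse (real (Suc n)) * M * \<nu> (A n)"
    by metis
  have "\<forall>n. s n \<in> {0..r}"
    using sA by auto
  then obtain l \<sigma> where l: "l \<in> {0..r}" and \<sigma>: "strict_mono \<sigma>" "(s \<circ> \<sigma>) \<longlonglongrightarrow> l"
    using compact_Icc[of 0 r] unfolding compact_def by metis
  \<comment> \<open>The almost kernels concern squares and do not reveal the sign of the spectral
    value, so the gaps at \<open>l\<close> and at \<open>- l\<close> are multiplied into a lower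
    bound for \<open>x\<^sup>2 - l\<^sup>2\<close>.\<close>
  obtain c d where "c > 0" "bounded_below c (x - sc (complex_of_real l))"
    "d > 0" "bounded_below d (x - sc (complex_of_real (- l)))"
    using gap[of l] gap[of "- l"] l by auto
  then have cd: "c * d > 0" "bounded_below (c * d) (x * x - sc (complex_of_real (l * l)))"
    using bounded_below_square_diff[of c x "complex_of_real l" d] by (auto simp: sc_minus)
  have "(\<lambda>n. inverse (real (Suc (\<sigma> n))) * M + \<bar>s (\<sigma> n) * s (\<sigma> n) - l * l\<bar>) \<longlonglongrightarrow> 0 * M + \<bar>l * l - l * l\<bar>"
    using \<sigma> LIMSEQ_subseq_LIMSEQ[OF LIMSEQ_inverse_real_of_nat \<sigma>(1)]
    by (intro tendsto_intros) (auto simp: o_def)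
  then have "\<forall>\<^sub>F n in sequentially. inverse (real (Suc (\<sigma> n))) * M + \<bar>s (\<sigma> n) * s (\<sigma> n) - l * l\<bar> < c * d"
    using cd(1) by (auto dest: order_tendstoD(2))
  then obtain n where n: "inverse (real (Suc (\<sigma> n))) * M + \<bar>s (\<sigma> n) * s (\<sigma> n) - l * l\<bar> < c * d"
    by (auto simp: eventually_sequentially)
  let ?u = "x * x - sc (complex_of_real (l * l))" and ?v = "x * x - sc (complex_of_real (s (\<sigma> n) * s (\<sigma> n)))"
  have "?u - ?v = sc (complex_of_real (s (\<sigma> n) * s (\<sigma> n) - l * l))"
    by (simp add: sc_diff)
  then have "\<nu> (?u - ?v) \<le> \<bar>s (\<sigma> n) * s (\<sigma> n) - l * l\<bar>"
    using norm_sc_le[of "complex_of_real (s (\<sigma> n) * s (\<sigma> n) - l * l)"] by (simp only: norm_of_real)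
  moreover have "(c * d - \<nu> (?u - ?v)) * \<nu> (A (\<sigma> n)) \<le> inverse (real (Suc (\<sigma> n))) * M * \<nu> (A (\<sigma> n))"
    using bounded_below_perturb[OF cd(2), of ?v] sA(4)[of "\<sigma> n"] order_trans
    unfolding bounded_below_def by blast
  then have "c * d - \<nu> (?u - ?v) \<le> inverse (real (Suc (\<sigma> n))) * M"
    using sA(3)[of "\<sigma> n"] by (rule mult_right_le_imp_le)
  ultimately show False
    using n by linarith
qed

section \<open>The spectrum of a selfadjoint element\<close>

definition spec :: "'a \<Rightarrow> complex set" where
  "spec h = {c. \<not> almost_inv (sc c - h)}"

lemma spec_real:
  assumes "adj h = h" "c \<in> spec h"
  shows "c = complex_of_real (Re c)"
proof (rule ccontr)
  assume "c \<noteq> complex_of_real (Re c)"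
  then have "Im c \<noteq> 0"
    by (simp add: complex_eq_iff)
  then have "almost_inv ((sc (complex_of_real (Re c)) - h) + sc (\<i> * complex_of_real (Im c)))"
    by (intro almost_inv_imag) (simp_all add: adj_diff adj_sc assms(1))
  moreover have "(sc (complex_of_real (Re c)) - h) + sc (\<i> * complex_of_real (Im c)) = sc c - h"
    by (simp add: sc_add [symmetric] complex_eq [symmetric] diff_add_eq)
  ultimately show False
    using assms(2) by (simp add: spec_def)
qed

lemma spec_norm_le: "c \<in> spec h \<Longrightarrow> cmod c \<le> \<nu> h"
  using almost_inv_sc_diff[of h c] by (force simp: spec_def)

lemma not_in_spec_iff:
  assumes "adj h = h"
  shows "complex_of_real t \<notin> spec h \<longleftrightarrow> (\<exists>c>0. bounded_below c (sc (complex_of_real t) - h))"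
  using almost_inv_imp_bounded_below almost_inv_if_bounded_below[of "sc (complex_of_real t) - h"] assms
  by (auto simp: spec_def adj_diff adj_sc)

lemma closed_spec: "closed (spec h)"
proof -
  have "open (- spec h)"
    unfolding open_dist
  proof
    fix c assume "c \<in> - spec h"
    then have inv: "almost_inv (sc c - h)"
      by (simp add: spec_def)
    obtain e where e: "e > 0" "bounded_below e (sc c - h)"
      using almost_inv_imp_bounded_below[OF inv] by blast
    have "d \<in> - spec h" if "dist d c < e" for d
    proof -
      have "(sc c - h) - (sc d - h) = sc (c - d)"
        by (simp add: sc_diff)
      then have "\<nu> ((sc c - h) - (sc d - h)) < e"
        using norm_sc_le[of "c - d"] that by (simp add: dist_norm norm_minus_commute[of d])
      then show ?thesis
        using almost_inv_perturb[OF inv e(2)] by (simp add: spec_def)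
    qed
    with e(1) show "\<exists>e>0. \<forall>d. dist d c < e \<longrightarrow> d \<in> - spec h"
      by blast
  qed
  then show ?thesis
    by (simp add: closed_def)
qed

lemma compact_spec: "compact (spec h)"
  unfolding compact_eq_bounded_closed
  using closed_spec spec_norm_le by (auto simp: bounded_iff)

text \<open>Substitute for the identity between the norm of the resolvent and the inverse distance
  to the spectrum. The strict inequality keeps the whole closed interval of radius \<open>r\<close>
  free of spectrum, as \<open>bounded_below_if_gap\<close> asks.\<close>

lemma bounded_below_if_spec_gap:
  assumes "adj h = h" "r > 0" "\<And>c. c \<in> spec h \<Longrightarrow> dist c (complex_of_real t) > r"
  shows "bounded_below r (sc (complex_of_real t) - h)"
proof (rule bounded_below_if_gap)
  fix u :: real assume u: "\<bar>u\<bar> \<le> r"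
  have "complex_of_real (t - u) \<notin> spec h"
    using assms(3)[of "complex_of_real (t - u)"] u by (auto simp: dist_norm)
  then show "\<exists>c>0. bounded_below c (sc (complex_of_real t) - h - sc (complex_of_real u))"
    unfolding not_in_spec_iff[OF assms(1)] by (simp add: sc_diff algebra_simps)
qed (use assms in \<open>simp_all add: adj_diff adj_sc\<close>)

text \<open>An empty spectrum would permit every radius; the radius \<open>\<nu> h + 1\<close>
  around 0 contradicts the action of \<open>h\<close> on the element 1.\<close>

lemma spec_nonempty:
  assumes "adj h = h" "\<nu> 1 \<noteq> 0"
  shows "spec h \<noteq> {}"
proof
  assume "spec h = {}"
  then have "bounded_below (\<nu> h + 1) (sc (complex_of_real 0) - h)"
    by (intro bounded_below_if_spec_gap assms) (auto simp: add_nonneg_pos)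
  then have "(\<nu> h + 1) * \<nu> 1 \<le> \<nu> h"
    by (auto simp: bounded_below_def norm_minus dest: spec[of _ 1])
  moreover have "\<nu> 1 = 1"
    using cstar[of 1] assms(2) by (simp add: power2_eq_square)
  ultimately show False
    by simp
qed

end

section \<open>The rotation seminorm\<close>

text \<open>For the C*-identity, squaring is monotone on nonnegative reals and so passes through the
  supremum, with \<open>sqrt\<close> giving the reverse estimate. Equality in the scaling law
  follows from the inequality applied to \<open>1 / c\<close>.\<close>

lemma star_seminorm_SUP:
  assumes "N \<noteq> {}" and N: "\<And>\<nu>. \<nu> \<in> N \<Longrightarrow> star_seminorm sc adj \<nu>"
    and bdd: "\<And>x. bdd_above ((\<lambda>\<nu>. \<nu> x) ` N)"
  shows "star_seminorm sc adj (\<lambda>x. SUP \<nu>\<in>N. \<nu> x)"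
proof -
  define R where "R x = (SUP \<nu>\<in>N. \<nu> x)" for x
  have ub: "\<nu> x \<le> R x" if "\<nu> \<in> N" for \<nu> x
    unfolding R_def by (rule cSUP_upper[OF that bdd])
  have least: "R x \<le> b" if "\<And>\<nu>. \<nu> \<in> N \<Longrightarrow> \<nu> x \<le> b" for x b
    unfolding R_def by (rule cSUP_least[OF assms(1) that])
  have ge0: "R x \<ge> 0" for x
    using assms(1) ub N star_seminorm.norm_ge_0 by (metis ex_in_conv order_trans)
  obtain \<nu>0 where "\<nu>0 \<in> N"
    using assms(1) by blast
  then interpret n0: star_seminorm sc adj \<nu>0
    by (rule N)
  have scale_le: "R (sc c * x) \<le> cmod c * R x" for c x
    by (rule least) (simp add: star_seminorm.scale[OF N] mult_left_mono ub)
  show ?thesis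
    unfolding R_def [symmetric]
  proof
    show "R (x + y) \<le> R x + R y" for x y
      by (rule least) (meson N add_mono order_trans star_seminorm.triangle ub)
    show "R (x * y) \<le> R x * R y" for x y
      by (rule least) (meson N ge0 mult_mono order_trans star_seminorm.norm_ge_0 star_seminorm.submult ub)
    show "R (sc c * x) = cmod c * R x" for c x
    proof (cases "c = 0")
      case True
      have "R 0 \<le> 0"
        by (rule least) (simp add: star_seminorm.norm_0[OF N])
      with True show ?thesis
        using ge0[of 0] by simp
    next
      case False
      have "R (sc (1 / c) * (sc c * x)) \<le> cmod (1 / c) * R (sc c * x)"
        by (rule scale_le)
      then have "cmod c * R x \<le> R (sc c * x)"
        using False by (simp add: mult.assoc [symmetric] n0.sc_mult [symmetric] norm_divide field_simps)
      with scale_le[of c x] show ?thesis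
        by simp
    qed
    show "R (adj x * x) = (R x)\<^sup>2" for x
    proof (rule antisym)
      show "R (adj x * x) \<le> (R x)\<^sup>2"
        by (rule least) (simp add: star_seminorm.cstar[OF N] power_mono ub star_seminorm.norm_ge_0[OF N])
      have "R x \<le> sqrt (R (adj x * x))"
        by (rule least) (metis N real_le_rsqrt star_seminorm.cstar ub)
      then have "(R x)\<^sup>2 \<le> (sqrt (R (adj x * x)))\<^sup>2"
        by (intro power_mono ge0)
      then show "(R x)\<^sup>2 \<le> R (adj x * x)"
        using ge0 by simp
    qed
  qed
qed

section \<open>The involution on *-polynomials\<close>

lemma poly_mapping_single_add_induct [case_names single add]:
  fixes p :: "'a \<Rightarrow>\<^sub>0 'b::monoid_add"
  assumes single: "\<And>w c. P (Poly_Mapping.single w c)"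
    and add: "\<And>p q. P p \<Longrightarrow> P q \<Longrightarrow> P (p + q)"
  shows "P p"
proof (induction p rule: update_induct)
  case const
  then show ?case
    using single[of undefined 0] by simp
next
  case (update p a b)
  have "Poly_Mapping.update a b p = Poly_Mapping.single a b + p"
    using update by (intro poly_mapping_eqI) (auto simp: lookup_update lookup_add lookup_single in_keys_iff when_def)
  with update single add show ?case
    by simp
qed

text \<open>Cancellation may remove keys from \<open>p + q\<close>, so additivity is checked over a
  common larger index set.\<close>

lemma formal_adj_superset:
  assumes "finite A" "Poly_Mapping.keys p \<subseteq> A"
  shows "formal_adj p = (\<Sum>w\<in>A. Poly_Mapping.single (word_adj w) (cnj (Poly_Mapping.lookup p w)))"
  unfolding formal_adj_def using assms
  by (intro sum.mono_neutral_left) (auto simp: in_keys_iff)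

lemma formal_adj_add: "formal_adj (p + q) = formal_adj p + formal_adj q"
proof -
  let ?A = "Poly_Mapping.keys p \<union> Poly_Mapping.keys q"
  have "Poly_Mapping.keys (p + q) \<subseteq> ?A"
    by (rule keys_add)
  then show ?thesis
    by (subst (1 2 3) formal_adj_superset[of ?A]) (auto simp: lookup_add single_add sum.distrib)
qed

lemma formal_adj_single: "formal_adj (Poly_Mapping.single w c) = Poly_Mapping.single (word_adj w) (cnj c)"
  by (subst formal_adj_superset[of "{w}"]) auto

lemma letter_adj_letter_adj [simp]: "letter_adj (letter_adj l) = l"
  by (cases l) auto

lemma word_adj_add: "word_adj (v + w) = word_adj w + word_adj v"
  by (simp add: word_adj_def plus_word_def)

lemma word_adj_word_adj [simp]: "word_adj (word_adj w) = w"
  by (simp add: word_adj_def rev_map o_def)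

lemma word_adj_0 [simp]: "word_adj 0 = 0"
  by (simp add: word_adj_def zero_word_def)

interpretation star_poly: complex_star_ring const formal_adj
proof
  show "const (c + d) = const c + const d" for c d
    by (simp add: const_def single_add)
  show "const (c * d) = const c * const d" for c d
    by (simp add: const_def mult_single)
  show "const 1 = 1"
    by (simp add: const_def)
  show "p * const c = const c * p" for p c
    by (induction p rule: poly_mapping_single_add_induct) (simp_all add: const_def mult_single mult.commute algebra_simps)
  show "formal_adj (p + q) = formal_adj p + formal_adj q" for p q
    by (rule formal_adj_add)
  show "formal_adj (p * q) = formal_adj q * formal_adj p" for p q
  proof (induction p rule: poly_mapping_single_add_induct)
    case (single v c)
    then show ?case
      by (induction q rule: poly_mapping_single_add_induct)
        (simp_all add: mult_single formal_adj_single word_adj_add mult.commute formal_adj_add distrib_left distrib_right)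
  qed (simp add: formal_adj_add algebra_simps)
  show "formal_adj (formal_adj p) = p" for p
    by (induction p rule: poly_mapping_single_add_induct) (simp_all add: formal_adj_single formal_adj_add)
  show "formal_adj (const c) = const (cnj c)" for c
    by (simp add: const_def formal_adj_single)
qed

lemma cstar_seminorm_iff: "cstar_seminorm \<nu> \<longleftrightarrow> star_seminorm const formal_adj \<nu>"
  unfolding cstar_seminorm_def star_seminorm_def star_seminorm_axioms_def
  using star_poly.complex_star_ring_axioms by blast

lemma formal_adj_var: "formal_adj (var l) = var (letter_adj l)"
  by (simp add: var_def formal_adj_single word_adj_def)

lemma single_Cons: "Poly_Mapping.single (Word (l # ls)) 1 = var l * Poly_Mapping.single (Word ls) 1"
  by (simp add: var_def mult_single plus_word_def)

lemma single_eq_const_mult: "Poly_Mapping.single w c = const c * Poly_Mapping.single w 1"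
  by (simp add: const_def mult_single)

lemma star_poly_eq_sum:
  fixes p :: star_poly
  shows "p = (\<Sum>w\<in>Poly_Mapping.keys p. const (Poly_Mapping.lookup p w) * Poly_Mapping.single w 1)"
proof -
  let ?s = "\<Sum>w\<in>Poly_Mapping.keys p. Poly_Mapping.single w (Poly_Mapping.lookup p w)"
  have "Poly_Mapping.lookup ?s v = Poly_Mapping.lookup p v" for v
    by (simp add: lookup_sum lookup_single when_def sum.delta in_keys_iff)
  then have "p = ?s"
    by (intro poly_mapping_eqI) simp
  then show ?thesis
    by (subst (asm) single_eq_const_mult)
qed

section \<open>The largest seminorm satisfying the rotation relations\<close>

definition rotation_admissible :: "real \<Rightarrow> (star_poly \<Rightarrow> real) set" where
  "rotation_admissible \<theta> = {\<nu>. cstar_seminorm \<nu> \<and> (\<forall>r\<in>rotation_relations \<theta>. \<nu> r = 0)}"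

lemma rotation_seminorm_eq: "rotation_seminorm \<theta> p = (SUP \<nu>\<in>rotation_admissible \<theta>. \<nu> p)"
  unfolding rotation_seminorm_def rotation_admissible_def by (rule arg_cong[of _ _ Sup]) auto

definition coeff_norm :: "star_poly \<Rightarrow> real" where
  "coeff_norm p = (\<Sum>w\<in>Poly_Mapping.keys p. cmod (Poly_Mapping.lookup p w))"

lemma admissible_word_le:
  assumes "\<nu> \<in> rotation_admissible \<theta>"
  shows "\<nu> (Poly_Mapping.single w 1) \<le> 1"
proof -
  interpret star_seminorm const formal_adj \<nu>
    using assms by (simp add: rotation_admissible_def cstar_seminorm_iff)
  have letter: "\<nu> (var l) \<le> 1" for l
  proof -
    have "\<nu> (var (letter_adj l) * var l - 1) = 0"
      using assms by (cases l) (auto simp: rotation_admissible_def rotation_relations_def)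
    then have "\<nu> (var (letter_adj l) * var l) \<le> 1"
      using norm_diff_ge[of "var (letter_adj l) * var l" 1] norm_1_le by simp
    then have "(\<nu> (var l))\<^sup>2 \<le> 1\<^sup>2"
      using cstar[of "var l"] by (simp add: formal_adj_var)
    then show ?thesis
      by (rule power2_le_imp_le) simp
  qed
  have "\<nu> (Poly_Mapping.single (Word ls) 1) \<le> 1" for ls
  proof (induction ls)
    case Nil
    then show ?case
      using norm_1_le by (simp add: zero_word_def [symmetric])
  next
    case (Cons l ls)
    have "\<nu> (var l * Poly_Mapping.single (Word ls) 1) \<le> 1 * 1"
      by (rule order_trans[OF submult]) (intro mult_mono Cons letter norm_ge_0 zero_le_one)
    then show ?case
      by (simp add: single_Cons)
  qed
  then show ?thesis
    by (cases w) auto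
qed

text \<open>Words have seminorm at most 1 because the letters are unitary up to the seminorm. The
  bound does not depend on \<open>\<nu>\<close>, which makes the supremum in
  \<open>rotation_seminorm\<close> a genuine one; it also bounds the spectra uniformly in the
  angle.\<close>

lemma admissible_le_coeff_norm:
  assumes "\<nu> \<in> rotation_admissible \<theta>"
  shows "\<nu> p \<le> coeff_norm p"
proof -
  interpret star_seminorm const formal_adj \<nu>
    using assms by (simp add: rotation_admissible_def cstar_seminorm_iff)
  have "\<nu> p \<le> (\<Sum>w\<in>Poly_Mapping.keys p. \<nu> (const (Poly_Mapping.lookup p w) * Poly_Mapping.single w 1))"
    by (subst star_poly_eq_sum) (rule norm_sum_le)
  also have "\<dots> \<le> (\<Sum>w\<in>Poly_Mapping.keys p. cmod (Poly_Mapping.lookup p w) * 1)"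
    unfolding scale by (intro sum_mono mult_left_mono admissible_word_le[OF assms]) simp
  finally show ?thesis
    by (simp add: coeff_norm_def)
qed

lemma zero_admissible: "(\<lambda>_. 0) \<in> rotation_admissible \<theta>"
  by (simp add: rotation_admissible_def cstar_seminorm_def)

lemma admissible_bdd: "bdd_above ((\<lambda>\<nu>. \<nu> p) ` rotation_admissible \<theta>)"
  using admissible_le_coeff_norm by (intro bdd_aboveI2)

lemma admissible_le_rotation_seminorm:
  "\<nu> \<in> rotation_admissible \<theta> \<Longrightarrow> \<nu> p \<le> rotation_seminorm \<theta> p"
  unfolding rotation_seminorm_eq by (rule cSUP_upper[OF _ admissible_bdd])

interpretation rot: star_seminorm const formal_adj "rotation_seminorm \<theta>" for \<theta>
proof -
  have "star_seminorm const formal_adj (\<lambda>p. SUP \<nu>\<in>rotation_admissible \<theta>. \<nu> p)"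
    using zero_admissible admissible_bdd
    by (intro star_seminorm_SUP) (auto simp: rotation_admissible_def cstar_seminorm_iff)
  then show "star_seminorm const formal_adj (rotation_seminorm \<theta>)"
    by (simp add: rotation_seminorm_eq [abs_def])
qed

lemma rotation_seminorm_relation:
  assumes "r \<in> rotation_relations \<theta>"
  shows "rotation_seminorm \<theta> r = 0"
proof (rule antisym)
  show "rotation_seminorm \<theta> r \<le> 0"
    unfolding rotation_seminorm_eq using zero_admissible assms
    by (intro cSUP_least) (auto simp: rotation_admissible_def)
qed simp

lemma rotation_seminorm_admissible: "rotation_seminorm \<theta> \<in> rotation_admissible \<theta>"
  by (simp add: rotation_admissible_def cstar_seminorm_iff rot.star_seminorm_axioms rotation_seminorm_relation)

section \<open>Spectra in the completion\<close>

context star_seminorm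
begin

definition cauchy_seq :: "(nat \<Rightarrow> 'a) \<Rightarrow> bool" where
  "cauchy_seq X \<longleftrightarrow> (\<forall>e>0. \<exists>N. \<forall>m\<ge>N. \<forall>n\<ge>N. \<nu> (X m - X n) < e)"

definition null_seq :: "(nat \<Rightarrow> 'a) \<Rightarrow> bool" where
  "null_seq X \<longleftrightarrow> (\<lambda>n. \<nu> (X n)) \<longlonglongrightarrow> 0"

lemma null_seqI:
  assumes "Y \<longlonglongrightarrow> 0" "\<And>n. \<nu> (X n) \<le> Y n"
  shows "null_seq X"
  unfolding null_seq_def by (rule tendsto_sandwich[OF _ _ tendsto_const assms(1)]) (auto simp: assms(2))

lemma cauchy_seq_const: "cauchy_seq (\<lambda>_. x)"
  by (simp add: cauchy_seq_def)

lemma cauchy_seq_add: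
  assumes "cauchy_seq X" "cauchy_seq Y"
  shows "cauchy_seq (\<lambda>n. X n + Y n)"
  unfolding cauchy_seq_def
proof (intro allI impI)
  fix e :: real assume "e > 0"
  then have "e / 2 > 0"
    by simp
  then obtain M N where MN: "\<And>m n. m \<ge> M \<Longrightarrow> n \<ge> M \<Longrightarrow> \<nu> (X m - X n) < e / 2"
    "\<And>m n. m \<ge> N \<Longrightarrow> n \<ge> N \<Longrightarrow> \<nu> (Y m - Y n) < e / 2"
    using assms unfolding cauchy_seq_def by meson
  have "\<nu> (X m + Y m - (X n + Y n)) < e" if "m \<ge> max M N" "n \<ge> max M N" for m n
    using MN(1)[of m n] MN(2)[of m n] that triangle[of "X m - X n" "Y m - Y n"]
    by (simp add: add_diff_add)
  then show "\<exists>N. \<forall>m\<ge>N. \<forall>n\<ge>N. \<nu> (X m + Y m - (X n + Y n)) < e"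
    by blast
qed

lemma cauchy_seq_minus: "cauchy_seq X \<Longrightarrow> cauchy_seq (\<lambda>n. - X n)"
  unfolding cauchy_seq_def by (simp add: norm_diff_commute)

lemma cauchy_seq_bounded:
  assumes "cauchy_seq X"
  obtains B where "B > 0" "\<And>n. \<nu> (X n) \<le> B"
proof -
  obtain N where N: "\<And>m n. m \<ge> N \<Longrightarrow> n \<ge> N \<Longrightarrow> \<nu> (X m - X n) < 1"
    using assms unfolding cauchy_seq_def by (meson zero_less_one)
  define B where "B = (\<Sum>n\<le>N. \<nu> (X n)) + 1"
  have le: "\<nu> (X n) \<le> (\<Sum>n\<le>N. \<nu> (X n))" if "n \<le> N" for n
    using that by (intro member_le_sum) auto
  have "\<nu> (X n) \<le> B" for n
  proof (cases "n \<le> N")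
    case False
    then have "\<nu> (X n) \<le> \<nu> (X N) + 1"
      using N[of n N] norm_diff_ge[of "X n" "X N"] by simp
    then show ?thesis
      using le[of N] by (simp add: B_def)
  qed (use le in \<open>force simp: B_def\<close>)
  moreover have "B > 0"
    unfolding B_def by (intro add_nonneg_pos sum_nonneg) auto
  ultimately show ?thesis
    using that by blast
qed

lemma cauchy_seq_mult:
  assumes "cauchy_seq X" "cauchy_seq Y"
  shows "cauchy_seq (\<lambda>n. X n * Y n)"
  unfolding cauchy_seq_def
proof (intro allI impI)
  fix e :: real assume e: "e > 0"
  obtain B C where B: "B > 0" "\<And>n. \<nu> (X n) \<le> B" and C: "C > 0" "\<And>n. \<nu> (Y n) \<le> C"
    using cauchy_seq_bounded[OF assms(1)] cauchy_seq_bounded[OF assms(2)] by metis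
  have "e / (2 * C) > 0" "e / (2 * B) > 0"
    using e B C by auto
  then obtain M N where MN: "\<And>m n. m \<ge> M \<Longrightarrow> n \<ge> M \<Longrightarrow> \<nu> (X m - X n) < e / (2 * C)"
    "\<And>m n. m \<ge> N \<Longrightarrow> n \<ge> N \<Longrightarrow> \<nu> (Y m - Y n) < e / (2 * B)"
    using assms unfolding cauchy_seq_def by meson
  have "\<nu> (X m * Y m - X n * Y n) < e" if "m \<ge> max M N" "n \<ge> max M N" for m n
  proof -
    have "X m * Y m - X n * Y n = (X m - X n) * Y m + X n * (Y m - Y n)"
      by (simp add: algebra_simps)
    then have "\<nu> (X m * Y m - X n * Y n) \<le> \<nu> (X m - X n) * \<nu> (Y m) + \<nu> (X n) * \<nu> (Y m - Y n)"
      using triangle[of "(X m - X n) * Y m" "X n * (Y m - Y n)"] submult[of "X m - X n" "Y m"]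
        submult[of "X n" "Y m - Y n"] by simp
    also have "\<dots> \<le> \<nu> (X m - X n) * C + B * \<nu> (Y m - Y n)"
      by (intro add_mono mult_left_mono mult_right_mono B C) auto
    also have "\<dots> < e / (2 * C) * C + B * (e / (2 * B))"
      using MN that B C by (intro add_strict_mono mult_strict_left_mono mult_strict_right_mono) auto
    also have "\<dots> = e"
      using B C by simp
    finally show ?thesis .
  qed
  then show "\<exists>N. \<forall>m\<ge>N. \<forall>n\<ge>N. \<nu> (X m * Y m - X n * Y n) < e"
    by blast
qed

lemma null_seq_imp_cauchy_seq:
  assumes "null_seq X"
  shows "cauchy_seq X"
  unfolding cauchy_seq_def
proof (intro allI impI)
  fix e :: real assume "e > 0"
  then have "\<forall>\<^sub>F n in sequentially. \<nu> (X n) < e / 2"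
    using assms unfolding null_seq_def by (intro order_tendstoD(2)) auto
  then obtain N where N: "\<And>n. n \<ge> N \<Longrightarrow> \<nu> (X n) < e / 2"
    by (auto simp: eventually_sequentially)
  have "\<nu> (X m - X n) < e" if "m \<ge> N" "n \<ge> N" for m n
    using N[of m] N[of n] that triangle_diff[of "X m" "X n"] by simp
  then show "\<exists>N. \<forall>m\<ge>N. \<forall>n\<ge>N. \<nu> (X m - X n) < e"
    by blast
qed

lemma null_seq_0: "null_seq (\<lambda>_. 0)"
  by (simp add: null_seq_def)

lemma null_seq_add: "null_seq X \<Longrightarrow> null_seq Y \<Longrightarrow> null_seq (\<lambda>n. X n + Y n)"
  unfolding null_seq_def[of X] null_seq_def[of Y]
  by (drule (1) tendsto_add, rule null_seqI[where Y = "\<lambda>n. \<nu> (X n) + \<nu> (Y n)"]) (auto simp: triangle)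

lemma null_seq_minus: "null_seq X \<Longrightarrow> null_seq (\<lambda>n. - X n)"
  by (simp add: null_seq_def norm_minus)

lemma null_seq_mult:
  assumes "cauchy_seq X" "null_seq Y"
  shows "null_seq (\<lambda>n. X n * Y n)" "null_seq (\<lambda>n. Y n * X n)"
proof -
  obtain B where B: "\<And>n. \<nu> (X n) \<le> B"
    using cauchy_seq_bounded[OF assms(1)] by metis
  have lim: "(\<lambda>n. B * \<nu> (Y n)) \<longlonglongrightarrow> 0"
    using assms(2) unfolding null_seq_def by (rule tendsto_mult_right_zero)
  show "null_seq (\<lambda>n. X n * Y n)"
    by (rule null_seqI[OF lim]) (metis B mult_right_mono norm_ge_0 order_trans submult)
  show "null_seq (\<lambda>n. Y n * X n)"
    by (rule null_seqI[OF lim]) (metis B mult.commute mult_right_mono norm_ge_0 order_trans submult)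
qed

lemma null_seq_power:
  assumes "\<nu> y < 1"
  shows "null_seq (\<lambda>n. y ^ n)"
  by (rule null_seqI[OF LIMSEQ_power_zero[of "\<nu> y"]]) (auto simp: assms norm_power_le)

lemma almost_inv_iff_inverse_seq:
  "almost_inv x \<longleftrightarrow> (\<exists>Y. cauchy_seq Y \<and> null_seq (\<lambda>n. 1 - x * Y n) \<and> null_seq (\<lambda>n. 1 - Y n * x))"
proof
  assume inv: "almost_inv x"
  then obtain q where q: "\<nu> (1 - x * q) < 1" "\<nu> (1 - q * x) < 1"
    unfolding almost_inv_def by blast
  define Y where "Y n = q * (\<Sum>j<n. (1 - x * q) ^ j)" for n
  have Y: "1 - x * Y n = (1 - x * q) ^ n" "1 - Y n * x = (1 - q * x) ^ n" for n
    unfolding Y_def by (rule neumann_series)+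
  have null: "null_seq (\<lambda>n. 1 - x * Y n)" "null_seq (\<lambda>n. 1 - Y n * x)"
    unfolding Y by (rule null_seq_power[OF q(1)], rule null_seq_power[OF q(2)])
  obtain c where c: "c > 0" "bounded_below c x"
    using almost_inv_imp_bounded_below[OF inv] by blast
  \<comment> \<open>The lower bound for \<open>x\<close> transfers the Cauchy property from the null
    sequence \<open>1 - x Y\<close> to \<open>Y\<close>, in place of an estimate of the tail of the
    Neumann series.\<close>
  have "cauchy_seq Y"
    unfolding cauchy_seq_def
  proof (intro allI impI)
    fix e :: real assume "e > 0"
    then have "c * e > 0"
      using c by simp
    then obtain N where N: "\<And>m n. m \<ge> N \<Longrightarrow> n \<ge> N \<Longrightarrow> \<nu> ((1 - x * Y m) - (1 - x * Y n)) < c * e"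
      using null_seq_imp_cauchy_seq[OF null(1)] unfolding cauchy_seq_def by meson
    have "\<nu> (Y m - Y n) < e" if "m \<ge> N" "n \<ge> N" for m n
    proof -
      have "c * \<nu> (Y m - Y n) \<le> \<nu> (x * (Y m - Y n))"
        using c(2) by (simp add: bounded_below_def)
      also have "\<dots> = \<nu> ((1 - x * Y m) - (1 - x * Y n))"
        by (simp add: right_diff_distrib norm_diff_commute)
      also have "\<dots> < c * e"
        using N that by blast
      finally show ?thesis
        using c by simp
    qed
    then show "\<exists>N. \<forall>m\<ge>N. \<forall>n\<ge>N. \<nu> (Y m - Y n) < e"
      by blast
  qed
  with null show "\<exists>Y. cauchy_seq Y \<and> null_seq (\<lambda>n. 1 - x * Y n) \<and> null_seq (\<lambda>n. 1 - Y n * x)"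
    by blast
next
  assume "\<exists>Y. cauchy_seq Y \<and> null_seq (\<lambda>n. 1 - x * Y n) \<and> null_seq (\<lambda>n. 1 - Y n * x)"
  then obtain Y where "null_seq (\<lambda>n. 1 - x * Y n)" "null_seq (\<lambda>n. 1 - Y n * x)"
    by blast
  then have "\<forall>\<^sub>F n in sequentially. \<nu> (1 - x * Y n) < 1" "\<forall>\<^sub>F n in sequentially. \<nu> (1 - Y n * x) < 1"
    unfolding null_seq_def by (simp_all add: order_tendstoD(2))
  then have "\<forall>\<^sub>F n in sequentially. \<nu> (1 - x * Y n) < 1 \<and> \<nu> (1 - Y n * x) < 1"
    by (rule eventually_conj)
  then show "almost_inv x"
    unfolding almost_inv_def by (auto simp: eventually_sequentially)
qed

end

section \<open>The quotient of Cauchy sequences by null sequences\<close>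

lemma carrier_cauchy_ring: "X \<in> carrier (cauchy_ring \<theta>) \<longleftrightarrow> rot.cauchy_seq \<theta> X"
  by (simp add: cauchy_ring_def rot.cauchy_seq_def)

lemma cauchy_ring_simps:
  "X \<otimes>\<^bsub>cauchy_ring \<theta>\<^esub> Y = (\<lambda>n. X n * Y n)" "X \<oplus>\<^bsub>cauchy_ring \<theta>\<^esub> Y = (\<lambda>n. X n + Y n)"
  "\<one>\<^bsub>cauchy_ring \<theta>\<^esub> = (\<lambda>_. 1)" "\<zero>\<^bsub>cauchy_ring \<theta>\<^esub> = (\<lambda>_. 0)"
  by (simp_all add: cauchy_ring_def)

lemma mem_null_ideal: "X \<in> null_ideal \<theta> \<longleftrightarrow> rot.null_seq \<theta> X"
  by (simp add: null_ideal_def rot.null_seq_def)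

interpretation CR: ring "cauchy_ring \<theta>" for \<theta>
proof (rule ringI)
  show "abelian_group (cauchy_ring \<theta>)"
  proof (rule abelian_groupI)
    fix X assume "X \<in> carrier (cauchy_ring \<theta>)"
    then show "\<exists>Y\<in>carrier (cauchy_ring \<theta>). Y \<oplus>\<^bsub>cauchy_ring \<theta>\<^esub> X = \<zero>\<^bsub>cauchy_ring \<theta>\<^esub>"
      by (intro bexI[of _ "\<lambda>n. - X n"]) (auto simp: cauchy_ring_simps carrier_cauchy_ring rot.cauchy_seq_minus)
  qed (auto simp: cauchy_ring_simps carrier_cauchy_ring rot.cauchy_seq_add rot.cauchy_seq_const add_ac)
  show "monoid (cauchy_ring \<theta>)"
    by (rule monoidI)
      (auto simp: cauchy_ring_simps carrier_cauchy_ring rot.cauchy_seq_mult rot.cauchy_seq_const mult.assoc)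
qed (auto simp: cauchy_ring_simps distrib_left distrib_right)

lemma cauchy_ring_a_inv:
  assumes "X \<in> carrier (cauchy_ring \<theta>)"
  shows "\<ominus>\<^bsub>cauchy_ring \<theta>\<^esub> X = (\<lambda>n. - X n)"
  using assms
  by (intro CR.minus_equality) (auto simp: cauchy_ring_simps carrier_cauchy_ring rot.cauchy_seq_minus)

lemma ideal_null_ideal: "ideal (null_ideal \<theta>) (cauchy_ring \<theta>)"
proof (rule idealI)
  show "ring (cauchy_ring \<theta>)" ..
  show "subgroup (null_ideal \<theta>) (add_monoid (cauchy_ring \<theta>))"
  proof (rule CR.add.subgroupI)
    show "null_ideal \<theta> \<subseteq> carrier (cauchy_ring \<theta>)"
      by (auto simp: mem_null_ideal carrier_cauchy_ring rot.null_seq_imp_cauchy_seq)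
    show "null_ideal \<theta> \<noteq> {}"
      using rot.null_seq_0 by (auto simp: mem_null_ideal [symmetric])
    fix X assume X: "X \<in> null_ideal \<theta>"
    then have "X \<in> carrier (cauchy_ring \<theta>)"
      by (auto simp: mem_null_ideal carrier_cauchy_ring rot.null_seq_imp_cauchy_seq)
    with X show "\<ominus>\<^bsub>cauchy_ring \<theta>\<^esub> X \<in> null_ideal \<theta>"
      by (simp add: cauchy_ring_a_inv mem_null_ideal rot.null_seq_minus)
    fix Y assume "Y \<in> null_ideal \<theta>"
    with X show "X \<oplus>\<^bsub>cauchy_ring \<theta>\<^esub> Y \<in> null_ideal \<theta>"
      by (simp add: cauchy_ring_simps mem_null_ideal rot.null_seq_add)
  qed
qed (auto simp: cauchy_ring_simps mem_null_ideal carrier_cauchy_ring rot.null_seq_mult)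

lemma rotation_algebra_simps:
  "carrier (rotation_algebra \<theta>) = carrier (cauchy_ring \<theta> Quot null_ideal \<theta>)"
  "mult (rotation_algebra \<theta>) = mult (cauchy_ring \<theta> Quot null_ideal \<theta>)"
  "one (rotation_algebra \<theta>) = one (cauchy_ring \<theta> Quot null_ideal \<theta>)"
  "zero (rotation_algebra \<theta>) = zero (cauchy_ring \<theta> Quot null_ideal \<theta>)"
  "add (rotation_algebra \<theta>) = add (cauchy_ring \<theta> Quot null_ideal \<theta>)"
  by (simp_all add: rotation_algebra_def Let_def)

lemma carrier_rotation_algebra:
  "carrier (rotation_algebra \<theta>) = cauchy_class \<theta> ` carrier (cauchy_ring \<theta>)"
  unfolding rotation_algebra_simps FactRing_def A_RCOSETS_def'
  by (simp add: cauchy_class_def [abs_def] UNION_singleton_eq_range)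

lemma cauchy_class_hom: "cauchy_class \<theta> \<in> ring_hom (cauchy_ring \<theta>) (rotation_algebra \<theta>)"
  using ideal.rcos_ring_hom[OF ideal_null_ideal, of \<theta>]
  by (simp add: ring_hom_def rotation_algebra_simps cauchy_class_def [abs_def])

text \<open>The record copies the ring operations of the quotient but is of a larger type, so the
  ring axioms are transferred field by field.\<close>

interpretation RA: ring "rotation_algebra \<theta>" for \<theta>
proof -
  have "ring (cauchy_ring \<theta> Quot null_ideal \<theta>)"
    by (rule ideal.quotient_is_ring[OF ideal_null_ideal])
  then interpret Q: ring "cauchy_ring \<theta> Quot null_ideal \<theta>" .
  show "ring (rotation_algebra \<theta>)"
  proof (rule ringI)
    show "abelian_group (rotation_algebra \<theta>)"
      by (rule abelian_groupI)
        (simp_all add: rotation_algebra_simps Q.a_assoc Q.add.l_inv_ex, rule Q.a_comm)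
    show "monoid (rotation_algebra \<theta>)"
      by (rule monoidI) (auto simp: rotation_algebra_simps Q.m_assoc)
  qed (auto simp: rotation_algebra_simps Q.l_distr Q.r_distr)
qed

lemmas cauchy_class_closed = ring_hom_closed[OF cauchy_class_hom]

lemma cauchy_class_mult:
  "rot.cauchy_seq \<theta> X \<Longrightarrow> rot.cauchy_seq \<theta> Y \<Longrightarrow>
    cauchy_class \<theta> X \<otimes>\<^bsub>rotation_algebra \<theta>\<^esub> cauchy_class \<theta> Y = cauchy_class \<theta> (\<lambda>n. X n * Y n)"
  using ring_hom_mult[OF cauchy_class_hom, of X \<theta> Y] by (simp add: carrier_cauchy_ring cauchy_ring_simps)

lemma cauchy_class_add:
  "rot.cauchy_seq \<theta> X \<Longrightarrow> rot.cauchy_seq \<theta> Y \<Longrightarrow>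
    cauchy_class \<theta> X \<oplus>\<^bsub>rotation_algebra \<theta>\<^esub> cauchy_class \<theta> Y = cauchy_class \<theta> (\<lambda>n. X n + Y n)"
  using ring_hom_add[OF cauchy_class_hom, of X \<theta> Y] by (simp add: carrier_cauchy_ring cauchy_ring_simps)

lemma cauchy_class_one: "\<one>\<^bsub>rotation_algebra \<theta>\<^esub> = cauchy_class \<theta> (\<lambda>_. 1)"
  using ring_hom_one[OF cauchy_class_hom, of \<theta>] by (simp add: cauchy_ring_simps)

lemma cauchy_class_eq_iff:
  assumes "rot.cauchy_seq \<theta> X" "rot.cauchy_seq \<theta> Y"
  shows "cauchy_class \<theta> X = cauchy_class \<theta> Y \<longleftrightarrow> rot.null_seq \<theta> (\<lambda>n. X n - Y n)"
proof -
  have "X \<ominus>\<^bsub>cauchy_ring \<theta>\<^esub> Y = (\<lambda>n. X n - Y n)"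
    using assms by (simp add: a_minus_def cauchy_ring_a_inv carrier_cauchy_ring cauchy_ring_simps)
  moreover have "cauchy_class \<theta> X = cauchy_class \<theta> Y \<longleftrightarrow> X \<ominus>\<^bsub>cauchy_ring \<theta>\<^esub> Y \<in> null_ideal \<theta>"
    unfolding cauchy_class_def using assms
    by (intro CR.quotient_eq_iff_same_a_r_cos[OF ideal_null_ideal, symmetric]) (auto simp: carrier_cauchy_ring)
  ultimately show ?thesis
    by (simp add: mem_null_ideal)
qed

lemma mem_cauchy_class:
  assumes "rot.cauchy_seq \<theta> X"
  shows "Y \<in> cauchy_class \<theta> X \<longleftrightarrow> rot.cauchy_seq \<theta> Y \<and> rot.null_seq \<theta> (\<lambda>n. Y n - X n)"
proof
  assume Y: "Y \<in> cauchy_class \<theta> X"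
  then obtain Z where Z: "rot.null_seq \<theta> Z" "Y = (\<lambda>n. Z n + X n)"
    by (auto simp: cauchy_class_def a_r_coset_def' cauchy_ring_simps mem_null_ideal)
  then show "rot.cauchy_seq \<theta> Y \<and> rot.null_seq \<theta> (\<lambda>n. Y n - X n)"
    using assms by (auto intro: rot.cauchy_seq_add rot.null_seq_imp_cauchy_seq)
next
  assume Y: "rot.cauchy_seq \<theta> Y \<and> rot.null_seq \<theta> (\<lambda>n. Y n - X n)"
  then show "Y \<in> cauchy_class \<theta> X"
    by (auto simp: cauchy_class_def a_r_coset_def' cauchy_ring_simps mem_null_ideal intro!: bexI[of _ "\<lambda>n. Y n - X n"])
qed

lemma cauchy_class_self: "rot.cauchy_seq \<theta> X \<Longrightarrow> X \<in> cauchy_class \<theta> X"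
  by (simp add: mem_cauchy_class rot.null_seq_0)

text \<open>The scalar multiple is defined as a union over all representatives. The classes in this
  union coincide, because multiplication by \<open>const c\<close> preserves null sequences.\<close>

lemma cauchy_class_smult:
  assumes "rot.cauchy_seq \<theta> X"
  shows "c \<odot>\<^bsub>rotation_algebra \<theta>\<^esub> cauchy_class \<theta> X = cauchy_class \<theta> (\<lambda>n. const c * X n)"
proof -
  have "cauchy_class \<theta> (\<lambda>n. const c * Y n) = cauchy_class \<theta> (\<lambda>n. const c * X n)"
    if "Y \<in> cauchy_class \<theta> X" for Y
  proof -
    have Y: "rot.cauchy_seq \<theta> Y" "rot.null_seq \<theta> (\<lambda>n. Y n - X n)"
      using that assms by (auto simp: mem_cauchy_class)
    have "rot.null_seq \<theta> (\<lambda>n. const c * (Y n - X n))"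
      by (intro rot.null_seq_mult rot.cauchy_seq_const Y)
    then show ?thesis
      using Y(1) assms by (subst cauchy_class_eq_iff)
        (auto simp: right_diff_distrib intro!: rot.cauchy_seq_mult rot.cauchy_seq_const)
  qed
  then have "(\<Union>Y\<in>cauchy_class \<theta> X. cauchy_class \<theta> (\<lambda>n. const c * Y n)) = cauchy_class \<theta> (\<lambda>n. const c * X n)"
    using cauchy_class_self[OF assms] by (intro SUP_eq_const) blast+
  then show ?thesis
    by (simp add: rotation_algebra_def Let_def)
qed

lemma cauchy_class_star:
  "star (rotation_algebra \<theta>) (cauchy_class \<theta> (\<lambda>_. p)) = cauchy_class \<theta> (\<lambda>_. formal_adj p)"
proof -
  have "cauchy_class \<theta> (\<lambda>n. formal_adj (Y n)) = cauchy_class \<theta> (\<lambda>_. formal_adj p)"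
    if "Y \<in> cauchy_class \<theta> (\<lambda>_. p)" for Y
  proof -
    have Y: "rot.cauchy_seq \<theta> Y" "rot.null_seq \<theta> (\<lambda>n. Y n - p)"
      using that by (auto simp: mem_cauchy_class rot.cauchy_seq_const)
    have "rot.null_seq \<theta> (\<lambda>n. formal_adj (Y n) - formal_adj p)"
      using Y(2) by (simp add: rot.null_seq_def star_poly.adj_diff [symmetric] rot.norm_adj)
    moreover have "rot.cauchy_seq \<theta> (\<lambda>n. formal_adj (Y n))"
      using Y(1) by (simp add: rot.cauchy_seq_def star_poly.adj_diff [symmetric] rot.norm_adj)
    ultimately show ?thesis
      by (simp add: cauchy_class_eq_iff rot.cauchy_seq_const)
  qed
  then have "(\<Union>Y\<in>cauchy_class \<theta> (\<lambda>_. p). cauchy_class \<theta> (\<lambda>n. formal_adj (Y n))) = cauchy_class \<theta> (\<lambda>_. formal_adj p)"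
    using cauchy_class_self[OF rot.cauchy_seq_const, of p \<theta>] by (intro SUP_eq_const) blast+
  then show ?thesis
    by (simp add: rotation_algebra_def Let_def)
qed

section \<open>The image of the *-polynomials in the completion\<close>

abbreviation embed :: "real \<Rightarrow> star_poly \<Rightarrow> (nat \<Rightarrow> star_poly) set" where
  "embed \<theta> p \<equiv> cauchy_class \<theta> (\<lambda>_. p)"

lemma embed_closed: "embed \<theta> p \<in> carrier (rotation_algebra \<theta>)"
  by (rule cauchy_class_closed) (simp add: carrier_cauchy_ring rot.cauchy_seq_const)

lemma word_eval_generators:
  "word_eval (rotation_algebra \<theta>) (u_gen \<theta>) (v_gen \<theta>) w = embed \<theta> (Poly_Mapping.single w 1)"
proof -
  have letter: "letter_eval (rotation_algebra \<theta>) (u_gen \<theta>) (v_gen \<theta>) l = embed \<theta> (var l)" for l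
    by (cases l) (simp_all add: u_gen_def v_gen_def cauchy_class_star formal_adj_var)
  have "foldr (\<lambda>l x. embed \<theta> (var l) \<otimes>\<^bsub>rotation_algebra \<theta>\<^esub> x) ls (embed \<theta> 1) =
      embed \<theta> (Poly_Mapping.single (Word ls) 1)" for ls
    by (induction ls)
      (simp_all add: zero_word_def [symmetric] single_Cons cauchy_class_mult rot.cauchy_seq_const)
  then show ?thesis
    by (cases w) (simp add: word_eval_def letter cauchy_class_one)
qed

lemma star_poly_eval_generators:
  "star_poly_eval (rotation_algebra \<theta>) p (u_gen \<theta>) (v_gen \<theta>) = embed \<theta> p"
proof -
  let ?A = "rotation_algebra \<theta>"
  have *: "(\<Oplus>\<^bsub>?A\<^esub>w\<in>F. embed \<theta> (f w)) = embed \<theta> (\<Sum>w\<in>F. f w)" if "finite F" for F :: "word set" and f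
    using that
  proof (induction F rule: finite_induct)
    case empty
    have "\<zero>\<^bsub>?A\<^esub> = embed \<theta> 0"
      using ring_hom_zero[OF cauchy_class_hom CR.ring_axioms RA.ring_axioms, of \<theta>]
      by (simp add: cauchy_ring_simps)
    then show ?case
      by simp
  next
    case (insert w F)
    then show ?case
      by (simp add: RA.finsum_insert embed_closed cauchy_class_add rot.cauchy_seq_const Pi_iff)
  qed
  show ?thesis
    unfolding star_poly_eval_def word_eval_generators
    by (simp add: cauchy_class_smult rot.cauchy_seq_const * flip: star_poly_eq_sum)
qed

lemma embed_Units_iff: "embed \<theta> p \<in> Units (rotation_algebra \<theta>) \<longleftrightarrow> rot.almost_inv \<theta> p"
proof -
  have "embed \<theta> p \<in> Units (rotation_algebra \<theta>) \<longleftrightarrow>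
      (\<exists>Y. rot.cauchy_seq \<theta> Y \<and> embed \<theta> 1 = embed \<theta> p \<otimes>\<^bsub>rotation_algebra \<theta>\<^esub> cauchy_class \<theta> Y \<and>
        embed \<theta> 1 = cauchy_class \<theta> Y \<otimes>\<^bsub>rotation_algebra \<theta>\<^esub> embed \<theta> p)"
    unfolding Units_def
    by (auto simp: embed_closed carrier_rotation_algebra carrier_cauchy_ring cauchy_class_one rot.cauchy_seq_const)
  also have "\<dots> \<longleftrightarrow> rot.almost_inv \<theta> p"
    unfolding rot.almost_inv_iff_inverse_seq
    by (intro ex_cong1 conj_cong refl)
      (auto simp: cauchy_class_mult cauchy_class_eq_iff rot.cauchy_seq_const rot.cauchy_seq_mult)
  finally show ?thesis .
qed

lemma rotation_spectrum_eq_spec: "rotation_spectrum p \<theta> = rot.spec \<theta> p"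
proof -
  have "c \<odot>\<^bsub>rotation_algebra \<theta>\<^esub> \<one>\<^bsub>rotation_algebra \<theta>\<^esub> \<ominus>\<^bsub>rotation_algebra \<theta>\<^esub> embed \<theta> p = embed \<theta> (const c - p)" for c
  proof -
    have "embed \<theta> (- p) \<oplus>\<^bsub>rotation_algebra \<theta>\<^esub> embed \<theta> p = \<zero>\<^bsub>rotation_algebra \<theta>\<^esub>"
      using ring_hom_zero[OF cauchy_class_hom CR.ring_axioms RA.ring_axioms, of \<theta>]
      by (simp add: cauchy_class_add rot.cauchy_seq_const cauchy_ring_simps)
    then have "\<ominus>\<^bsub>rotation_algebra \<theta>\<^esub> embed \<theta> p = embed \<theta> (- p)"
      by (intro RA.minus_equality embed_closed)
    then show ?thesis
      by (simp add: a_minus_def cauchy_class_one cauchy_class_smult cauchy_class_add rot.cauchy_seq_const)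
  qed
  then show ?thesis
    by (simp add: rotation_spectrum_def spectrum_def star_poly_eval_generators embed_Units_iff rot.spec_def)
qed

section \<open>Unitary representations\<close>

text \<open>A complex inner product is represented by its real part. The last axiom makes
  multiplication by \<open>c\<close> adjoint to multiplication by \<open>cnj c\<close>, which
  provides the norms and adjoints used for operators.\<close>

locale complex_inner_space =
  fixes cs :: "complex \<Rightarrow> 'v::real_inner \<Rightarrow> 'v"
  assumes cs_add_left: "cs (c + d) x = cs c x + cs d x"
    and cs_add_right: "cs c (x + y) = cs c x + cs c y"
    and cs_mult: "cs (c * d) x = cs c (cs d x)"
    and cs_of_real: "cs (complex_of_real r) x = r *\<^sub>R x"
    and inner_cs: "inner (cs c x) y = inner x (cs (cnj c) y)"
begin

lemma cs_1 [simp]: "cs 1 x = x"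
  using cs_of_real[of 1] by simp

lemma cs_0 [simp]: "cs 0 x = 0"
  using cs_of_real[of 0] by simp

lemma cs_zero_right [simp]: "cs c 0 = 0"
  using cs_add_right[of c 0 0] by simp

lemma cs_minus_right: "cs c (- x) = - cs c x"
  using cs_add_right[of c x "- x"] by (simp add: eq_neg_iff_add_eq_0 add.commute)

lemma cs_diff_right: "cs c (x - y) = cs c x - cs c y"
  using cs_add_right[of c x "- y"] by (simp add: cs_minus_right)

lemma cs_sum_right: "cs c (sum f A) = (\<Sum>i\<in>A. cs c (f i))"
  by (induction A rule: infinite_finite_induct) (simp_all add: cs_add_right)

lemma norm_cs: "norm (cs c x) = cmod c * norm x"
proof -
  have "(norm (cs c x))\<^sup>2 = inner x (cs (complex_of_real ((cmod c)\<^sup>2)) x)"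
    by (simp only: power2_norm_eq_inner[of "cs c x"] inner_cs cs_mult [symmetric] complex_norm_square mult.commute)
  also have "\<dots> = (cmod c * norm x)\<^sup>2"
    by (simp only: cs_of_real inner_scaleR_right power2_norm_eq_inner power_mult_distrib)
  finally show ?thesis
    by simp
qed

end

locale unitary_rep = complex_inner_space cs
  for cs :: "complex \<Rightarrow> 'v::real_inner \<Rightarrow> 'v" +
  fixes \<rho> :: "letter \<Rightarrow> 'v \<Rightarrow> 'v"
  assumes rep_add: "\<rho> l (x + y) = \<rho> l x + \<rho> l y"
    and rep_cs: "\<rho> l (cs c x) = cs c (\<rho> l x)"
    and rep_adj: "inner (\<rho> l x) y = inner x (\<rho> (letter_adj l) y)"
    and rep_inverse: "\<rho> (letter_adj l) (\<rho> l x) = x"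
begin

lemma rep_minus: "\<rho> l (- x) = - \<rho> l x"
  using rep_cs[of l "complex_of_real (- 1)" x] by (simp only: cs_of_real) simp

lemma rep_diff: "\<rho> l (x - y) = \<rho> l x - \<rho> l y"
  using rep_add[of l x "- y"] by (simp add: rep_minus)

lemma norm_rep: "norm (\<rho> l x) = norm x"
  by (simp add: norm_eq_sqrt_inner rep_adj rep_inverse)

definition word_act :: "word \<Rightarrow> 'v \<Rightarrow> 'v" where
  "word_act w = foldr \<rho> (letters w)"

lemma word_act_Cons: "word_act (Word (l # ls)) x = \<rho> l (word_act (Word ls) x)"
  by (simp add: word_act_def)

lemma word_act_Nil [simp]: "word_act (Word []) x = x"
  by (simp add: word_act_def)

lemma word_act_0 [simp]: "word_act 0 x = x"
  by (simp add: zero_word_def)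

lemma word_act_plus: "word_act (v + w) x = word_act v (word_act w x)"
  by (simp add: word_act_def plus_word_def)

lemma word_act_add: "word_act w (x + y) = word_act w x + word_act w y"
proof -
  have "foldr \<rho> ls (x + y) = foldr \<rho> ls x + foldr \<rho> ls y" for ls
    by (induction ls) (simp_all add: rep_add)
  then show ?thesis
    by (simp add: word_act_def)
qed

lemma word_act_cs: "word_act w (cs c x) = cs c (word_act w x)"
proof -
  have "foldr \<rho> ls (cs c x) = cs c (foldr \<rho> ls x)" for ls
    by (induction ls) (simp_all add: rep_cs)
  then show ?thesis
    by (simp add: word_act_def)
qed

lemma norm_word_act: "norm (word_act w x) = norm x"
proof -
  have "norm (foldr \<rho> ls x) = norm x" for ls
    by (induction ls) (simp_all add: norm_rep)
  then show ?thesis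
    by (simp add: word_act_def)
qed

lemma inner_word_act: "inner (word_act w x) y = inner x (word_act (word_adj w) y)"
proof -
  have "inner (foldr \<rho> ls x) y = inner x (foldr \<rho> (rev (map letter_adj ls)) y)" for ls
    by (induction ls arbitrary: y) (simp_all add: rep_adj)
  then show ?thesis
    by (simp add: word_act_def word_adj_def)
qed

definition act :: "star_poly \<Rightarrow> 'v \<Rightarrow> 'v" where
  "act p x = (\<Sum>w\<in>Poly_Mapping.keys p. cs (Poly_Mapping.lookup p w) (word_act w x))"

lemma act_superset:
  assumes "finite A" "Poly_Mapping.keys p \<subseteq> A"
  shows "act p x = (\<Sum>w\<in>A. cs (Poly_Mapping.lookup p w) (word_act w x))"
  unfolding act_def using assms
  by (intro sum.mono_neutral_left) (auto simp: in_keys_iff)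

lemma act_add: "act (p + q) x = act p x + act q x"
proof -
  let ?A = "Poly_Mapping.keys p \<union> Poly_Mapping.keys q"
  have "Poly_Mapping.keys (p + q) \<subseteq> ?A"
    by (rule keys_add)
  then show ?thesis
    by (subst (1 2 3) act_superset[of ?A]) (auto simp: lookup_add cs_add_left sum.distrib)
qed

lemma act_single: "act (Poly_Mapping.single w c) x = cs c (word_act w x)"
  by (subst act_superset[of "{w}"]) auto

lemma act_0 [simp]: "act 0 x = 0"
  by (simp add: act_def)

lemma act_1 [simp]: "act 1 x = x"
  using act_single[of 0 1] by simp

lemma act_const: "act (const c) x = cs c x"
  by (simp add: const_def act_single)

lemma act_var: "act (var l) x = \<rho> l x"
  by (simp add: var_def act_single word_act_def)

lemma act_minus: "act (- p) x = - act p x"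
  using act_add[of p "- p" x] by (simp add: eq_neg_iff_add_eq_0 add.commute)

lemma act_diff: "act (p - q) x = act p x - act q x"
  using act_add[of p "- q" x] by (simp add: act_minus)

lemma act_add_right: "act p (x + y) = act p x + act p y"
  by (simp add: act_def word_act_add cs_add_right sum.distrib)

lemma act_cs: "act p (cs c x) = cs c (act p x)"
  by (simp add: act_def word_act_cs cs_mult [symmetric] mult.commute cs_sum_right)

lemma act_mult: "act (p * q) x = act p (act q x)"
proof (induction p rule: poly_mapping_single_add_induct)
  case (single v c)
  then show ?case
    by (induction q rule: poly_mapping_single_add_induct)
      (simp_all add: mult_single act_single act_add distrib_left word_act_plus word_act_cs cs_mult
        word_act_add cs_add_right)
qed (simp add: act_add distrib_right)

lemma inner_act: "inner (act p x) y = inner x (act (formal_adj p) y)"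
  by (induction p rule: poly_mapping_single_add_induct)
    (simp_all add: act_single act_add formal_adj_single formal_adj_add inner_cs inner_word_act
      word_act_cs inner_add_left inner_add_right)

lemma norm_act_le: "norm (act p x) \<le> coeff_norm p * norm x"
proof -
  have "norm (act p x) \<le> (\<Sum>w\<in>Poly_Mapping.keys p. norm (cs (Poly_Mapping.lookup p w) (word_act w x)))"
    unfolding act_def by (rule norm_sum)
  then show ?thesis
    by (simp add: norm_cs norm_word_act coeff_norm_def sum_distrib_right)
qed

lemma bounded_linear_act: "bounded_linear (act p)"
proof (rule bounded_linear_intro)
  show "act p (r *\<^sub>R x) = r *\<^sub>R act p x" for r x
    using act_cs[of p "complex_of_real r" x] by (simp only: cs_of_real)
  show "norm (act p x) \<le> norm x * coeff_norm p" for x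
    using norm_act_le[of p x] by (simp add: mult.commute)
qed (rule act_add_right)

definition op_norm :: "star_poly \<Rightarrow> real" where
  "op_norm p = onorm (act p)"

lemma norm_act_le_op_norm: "norm (act p x) \<le> op_norm p * norm x"
  unfolding op_norm_def by (rule onorm[OF bounded_linear_act])

lemma op_norm_ge_0: "op_norm p \<ge> 0"
  unfolding op_norm_def by (rule onorm_pos_le[OF bounded_linear_act])

lemma op_norm_le: "0 \<le> b \<Longrightarrow> (\<And>x. norm (act p x) \<le> b * norm x) \<Longrightarrow> op_norm p \<le> b"
  unfolding op_norm_def by (rule onorm_bound)

text \<open>Cauchy-Schwarz gives one half of the C*-identity. Cancelling in it shows that
  \<open>formal_adj\<close> preserves the operator norm, and submultiplicativity then gives the
  other half.\<close>

lemma star_seminorm_op_norm: "star_seminorm const formal_adj op_norm"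
proof
  show "op_norm (p + q) \<le> op_norm p + op_norm q" for p q
    unfolding op_norm_def act_add [abs_def]
    by (rule onorm_triangle[OF bounded_linear_act bounded_linear_act])
  show submult: "op_norm (p * q) \<le> op_norm p * op_norm q" for p q
    using onorm_compose[OF bounded_linear_act bounded_linear_act, of p q]
    by (simp add: op_norm_def act_mult [abs_def] o_def)
  show "op_norm (const c * p) = cmod c * op_norm p" for c p
  proof -
    have "onorm (\<lambda>x. act (const c * p) x) = onorm (\<lambda>x. cmod c *\<^sub>R act p x)"
      unfolding onorm_def by (simp add: act_mult act_const norm_cs)
    then show ?thesis
      unfolding op_norm_def by (simp add: onorm_scaleR bounded_linear_act)
  qed
  show "op_norm (formal_adj p * p) = (op_norm p)\<^sup>2" for p
  proof (rule antisym)
    have le: "op_norm q \<le> sqrt (op_norm (formal_adj q * q))" for q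
    proof (rule op_norm_le)
      fix x
      have "(norm (act q x))\<^sup>2 = inner x (act (formal_adj q * q) x)"
        by (simp add: power2_norm_eq_inner inner_act act_mult)
      also have "\<dots> \<le> norm x * norm (act (formal_adj q * q) x)"
        by (rule norm_cauchy_schwarz)
      also have "\<dots> \<le> norm x * (op_norm (formal_adj q * q) * norm x)"
        by (intro mult_left_mono norm_act_le_op_norm) simp
      also have "\<dots> = (sqrt (op_norm (formal_adj q * q)) * norm x)\<^sup>2"
        using op_norm_ge_0 by (simp add: power_mult_distrib power2_eq_square)
      finally show "norm (act q x) \<le> sqrt (op_norm (formal_adj q * q)) * norm x"
        by (rule power2_le_imp_le) (simp add: op_norm_ge_0)
    qed (simp add: op_norm_ge_0)
    have sq: "(op_norm q)\<^sup>2 \<le> op_norm (formal_adj q * q)" for q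
      using power_mono[OF le op_norm_ge_0, of q 2] op_norm_ge_0 by simp
    then show "(op_norm p)\<^sup>2 \<le> op_norm (formal_adj p * p)" .
    have adj_le: "op_norm q \<le> op_norm (formal_adj q)" for q
    proof (cases "op_norm q = 0")
      case False
      then have "op_norm q > 0"
        using op_norm_ge_0[of q] by simp
      then show ?thesis
        using order_trans[OF sq[of q] submult[of "formal_adj q" q]] by (simp add: power2_eq_square)
    qed (simp add: op_norm_ge_0)
    then have "op_norm (formal_adj p) = op_norm p"
      by (metis antisym star_poly.adj_adj)
    then show "op_norm (formal_adj p * p) \<le> (op_norm p)\<^sup>2"
      using submult[of "formal_adj p" p] by (simp add: power2_eq_square)
  qed
qed

lemma op_norm_admissible:
  assumes "\<And>x. \<rho> X2 (\<rho> X1 x) = cs (cis \<theta>) (\<rho> X1 (\<rho> X2 x))"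
  shows "op_norm \<in> rotation_admissible \<theta>"
proof -
  have "op_norm r = 0" if "r \<in> rotation_relations \<theta>" for r
  proof -
    have "act r x = 0" for x
      using that assms rep_inverse[of X1 x] rep_inverse[of X1s x] rep_inverse[of X2 x] rep_inverse[of X2s x]
      by (auto simp: rotation_relations_def act_diff act_mult act_var act_const)
    then show ?thesis
      using op_norm_le[of 0 r] op_norm_ge_0[of r] by simp
  qed
  then show ?thesis
    by (simp add: rotation_admissible_def cstar_seminorm_iff star_seminorm_op_norm)
qed

end

section \<open>Spaces of finitely supported functions\<close>

text \<open>A dense subspace of the square summable functions. Monomial operators and tensor
  products stay inside it, so all inner products are finite sums.\<close>

typedef 'x finsupp = "{f :: 'x \<Rightarrow> complex. finite {x. f x \<noteq> 0}}"
  morphisms app Abs_finsupp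
  by (rule exI[of _ "\<lambda>_. 0"]) simp

setup_lifting type_definition_finsupp

lemma finite_support [simp]: "finite {x. app f x \<noteq> 0}"
  using app[of f] by simp

instantiation finsupp :: (type) real_vector
begin

lift_definition zero_finsupp :: "'x finsupp" is "\<lambda>_. 0"
  by simp

lift_definition plus_finsupp :: "'x finsupp \<Rightarrow> 'x finsupp \<Rightarrow> 'x finsupp" is "\<lambda>f g x. f x + g x"
proof -
  fix f g :: "'x \<Rightarrow> complex"
  assume "finite {x. f x \<noteq> 0}" "finite {x. g x \<noteq> 0}"
  then have "finite ({x. f x \<noteq> 0} \<union> {x. g x \<noteq> 0})"
    by simp
  then show "finite {x. f x + g x \<noteq> 0}"
    by (rule finite_subset[rotated]) auto
qed

lift_definition minus_finsupp :: "'x finsupp \<Rightarrow> 'x finsupp \<Rightarrow> 'x finsupp" is "\<lambda>f g x. f x - g x"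
proof -
  fix f g :: "'x \<Rightarrow> complex"
  assume "finite {x. f x \<noteq> 0}" "finite {x. g x \<noteq> 0}"
  then have "finite ({x. f x \<noteq> 0} \<union> {x. g x \<noteq> 0})"
    by simp
  then show "finite {x. f x - g x \<noteq> 0}"
    by (rule finite_subset[rotated]) auto
qed

lift_definition uminus_finsupp :: "'x finsupp \<Rightarrow> 'x finsupp" is "\<lambda>f x. - f x"
  by simp

lift_definition scaleR_finsupp :: "real \<Rightarrow> 'x finsupp \<Rightarrow> 'x finsupp" is "\<lambda>r f x. r *\<^sub>R f x"
  by (rule finite_subset) auto

instance
  by standard
    (simp_all add: app_inject [symmetric] fun_eq_iff zero_finsupp.rep_eq plus_finsupp.rep_eq
      minus_finsupp.rep_eq uminus_finsupp.rep_eq scaleR_finsupp.rep_eq algebra_simps)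

end

lemmas app_simps = zero_finsupp.rep_eq plus_finsupp.rep_eq minus_finsupp.rep_eq uminus_finsupp.rep_eq
  scaleR_finsupp.rep_eq

lemma app_sum: "app (sum f A) x = (\<Sum>i\<in>A. app (f i) x)"
  by (induction A rule: infinite_finite_induct) (simp_all add: app_simps)

lemma finsupp_eqI: "(\<And>x. app f x = app g x) \<Longrightarrow> f = g"
  by (simp add: app_inject [symmetric] fun_eq_iff)

instantiation finsupp :: (type) real_inner
begin

definition inner_finsupp :: "'a finsupp \<Rightarrow> 'a finsupp \<Rightarrow> real" where
  "inner_finsupp f g = (\<Sum>x\<in>{x. app f x \<noteq> 0}. inner (app f x) (app g x))"

definition norm_finsupp :: "'a finsupp \<Rightarrow> real" where
  "norm_finsupp f = sqrt (inner f f)"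

definition sgn_finsupp :: "'a finsupp \<Rightarrow> 'a finsupp" where
  "sgn_finsupp f = f /\<^sub>R norm f"

definition dist_finsupp :: "'a finsupp \<Rightarrow> 'a finsupp \<Rightarrow> real" where
  "dist_finsupp f g = norm (f - g)"

definition uniformity_finsupp :: "('a finsupp \<times> 'a finsupp) filter" where
  "uniformity_finsupp = (INF e\<in>{0<..}. principal {(f, g). dist f g < e})"

definition open_finsupp :: "'a finsupp set \<Rightarrow> bool" where
  "open_finsupp U \<longleftrightarrow> (\<forall>f\<in>U. \<forall>\<^sub>F (f', g) in uniformity. f' = f \<longrightarrow> g \<in> U)"

lemma inner_finsupp_superset:
  assumes "finite A" "{x. app f x \<noteq> 0} \<subseteq> A"
  shows "inner f g = (\<Sum>x\<in>A. inner (app f x) (app g x))"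
  unfolding inner_finsupp_def using assms by (intro sum.mono_neutral_left) auto

instance
proof
  fix f g h :: "'a finsupp" and r :: real
  let ?A = "{x. app f x \<noteq> 0} \<union> {x. app g x \<noteq> 0}"
  have A: "finite ?A"
    by simp
  show "inner f g = inner g f"
    by (subst (1 2) inner_finsupp_superset[OF A]) (auto simp: inner_commute)
  show "inner (f + g) h = inner f h + inner g h"
    by (subst (1 2 3) inner_finsupp_superset[OF A]) (auto simp: app_simps inner_add_left sum.distrib)
  show "inner (r *\<^sub>R f) g = r * inner f g"
    by (subst (1 2) inner_finsupp_superset[OF A]) (auto simp: app_simps sum_distrib_left)
  show "0 \<le> inner f f"
    by (simp add: inner_finsupp_def sum_nonneg)
  show "inner f f = 0 \<longleftrightarrow> f = 0"
  proof
    assume "inner f f = 0"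
    then have "\<forall>x\<in>{x. app f x \<noteq> 0}. inner (app f x) (app f x) = 0"
      unfolding inner_finsupp_def by (subst (asm) sum_nonneg_eq_0_iff) auto
    then show "f = 0"
      by (intro finsupp_eqI) (auto simp: app_simps)
  qed (simp add: inner_finsupp_def app_simps)
qed (simp_all add: norm_finsupp_def sgn_finsupp_def dist_finsupp_def uniformity_finsupp_def open_finsupp_def)

end

lemma norm_square_finsupp:
  assumes "finite A" "{x. app f x \<noteq> 0} \<subseteq> A"
  shows "(norm f)\<^sup>2 = (\<Sum>x\<in>A. (cmod (app f x))\<^sup>2)"
  by (simp add: power2_norm_eq_inner inner_finsupp_superset[OF assms])

lemma norm_app_le: "cmod (app f x) \<le> norm f"
proof (rule power2_le_imp_le)
  have "(cmod (app f x))\<^sup>2 \<le> (\<Sum>x\<in>insert x {x. app f x \<noteq> 0}. (cmod (app f x))\<^sup>2)"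
    by (rule member_le_sum) auto
  then show "(cmod (app f x))\<^sup>2 \<le> (norm f)\<^sup>2"
    by (subst norm_square_finsupp[of "insert x {x. app f x \<noteq> 0}"]) auto
qed simp

lift_definition cscale :: "complex \<Rightarrow> 'x finsupp \<Rightarrow> 'x finsupp" is "\<lambda>c f x. c * f x"
  by (rule finite_subset) auto

interpretation finsupp: complex_inner_space cscale
proof
  fix c :: complex and f g :: "'x finsupp"
  have "inner (c * z) w = inner z (cnj c * w)" for z w :: complex
    by (simp add: inner_complex_def algebra_simps)
  then show "inner (cscale c f) g = inner f (cscale (cnj c) g)"
    by (subst (1 2) inner_finsupp_superset[of "{x. app f x \<noteq> 0}"]) (auto simp: cscale.rep_eq)
qed (auto intro!: finsupp_eqI simp: cscale.rep_eq app_simps algebra_simps scaleR_conv_of_real)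

section \<open>Monomial representations\<close>

definition basis_vec :: "'x \<Rightarrow> 'x finsupp" where
  "basis_vec x = Abs_finsupp (\<lambda>y. if y = x then 1 else 0)"

lemma app_basis_vec: "app (basis_vec x) y = (if y = x then 1 else 0)"
  unfolding basis_vec_def by (subst Abs_finsupp_inverse) auto

lemma norm_basis_vec [simp]: "norm (basis_vec x) = 1"
proof -
  have "(norm (basis_vec x))\<^sup>2 = 1\<^sup>2"
    by (subst norm_square_finsupp[of "{x}"]) (auto simp: app_basis_vec)
  then show ?thesis
    by (rule power2_eq_imp_eq) auto
qed

definition monomial_op :: "('x \<Rightarrow> complex) \<Rightarrow> ('x \<Rightarrow> 'x) \<Rightarrow> 'x finsupp \<Rightarrow> 'x finsupp" where
  "monomial_op \<alpha> \<sigma> f = Abs_finsupp (\<lambda>x. \<alpha> x * app f (\<sigma> x))"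

lemma app_monomial_op:
  assumes "inj \<sigma>"
  shows "app (monomial_op \<alpha> \<sigma> f) x = \<alpha> x * app f (\<sigma> x)"
proof -
  have "finite (\<sigma> -` {x. app f x \<noteq> 0})"
    by (rule finite_vimageI[OF _ assms]) simp
  then have "finite {x. \<alpha> x * app f (\<sigma> x) \<noteq> 0}"
    by (rule finite_subset[rotated]) auto
  then show ?thesis
    by (simp add: monomial_op_def Abs_finsupp_inverse)
qed

text \<open>The map \<open>\<sigma> l\<close> acts on arguments, so the basis vector at
  \<open>x\<close> goes to a multiple of the one at the point that \<open>\<sigma> l\<close> sends
  to \<open>x\<close>: shifts appear here with the opposite sign.\<close>

locale monomial_rep =
  fixes \<alpha> :: "letter \<Rightarrow> 'x \<Rightarrow> complex" and \<sigma> :: "letter \<Rightarrow> 'x \<Rightarrow> 'x"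
  assumes shift_inverse: "\<sigma> l (\<sigma> (letter_adj l) x) = x"
    and phase_adj: "\<alpha> (letter_adj l) x = cnj (\<alpha> l (\<sigma> (letter_adj l) x))"
    and norm_phase: "cmod (\<alpha> l x) = 1"
begin

definition rep :: "letter \<Rightarrow> 'x finsupp \<Rightarrow> 'x finsupp" where
  "rep l = monomial_op (\<alpha> l) (\<sigma> l)"

lemma shift_inverse': "\<sigma> (letter_adj l) (\<sigma> l x) = x"
  using shift_inverse[of "letter_adj l" x] by simp

lemma inj_shift: "inj (\<sigma> l)"
  by (rule inj_on_inverseI[of _ "\<sigma> (letter_adj l)"]) (rule shift_inverse')

lemma app_rep: "app (rep l f) x = \<alpha> l x * app f (\<sigma> l x)"
  unfolding rep_def by (rule app_monomial_op[OF inj_shift])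

sublocale unitary_rep cscale rep
proof
  fix l c and f g :: "'x finsupp"
  show "rep l (f + g) = rep l f + rep l g" "rep l (cscale c f) = cscale c (rep l f)"
    by (auto intro!: finsupp_eqI simp: app_rep app_simps cscale.rep_eq algebra_simps)
  show "rep (letter_adj l) (rep l f) = f"
  proof (rule finsupp_eqI)
    fix x
    have "cnj (\<alpha> l (\<sigma> (letter_adj l) x)) * \<alpha> l (\<sigma> (letter_adj l) x) = 1"
      using norm_phase[of l "\<sigma> (letter_adj l) x"] complex_norm_square[of "\<alpha> l (\<sigma> (letter_adj l) x)"]
      by (simp add: mult.commute)
    then show "app (rep (letter_adj l) (rep l f)) x = app f x"
      by (simp add: app_rep phase_adj shift_inverse mult.assoc [symmetric])
  qed
  let ?A = "{x. app f x \<noteq> 0}" and ?s = "\<sigma> (letter_adj l)"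
  have "inner (c * z) w = inner z (cnj c * w)" for c z w :: complex
    by (simp add: inner_complex_def algebra_simps)
  then have eq: "inner (\<alpha> l (?s y) * app f y) (app g (?s y)) = inner (app f y) (\<alpha> (letter_adj l) y * app g (?s y))" for y
    by (simp add: phase_adj)
  have "inner (rep l f) g = (\<Sum>x\<in>?s ` ?A. inner (app (rep l f) x) (app g x))"
  proof (rule inner_finsupp_superset)
    show "{x. app (rep l f) x \<noteq> 0} \<subseteq> ?s ` ?A"
      using shift_inverse' by (auto simp: app_rep intro!: image_eqI[of _ _ "\<sigma> l _"])
  qed simp
  also have "\<dots> = (\<Sum>y\<in>?A. inner (app (rep l f) (?s y)) (app g (?s y)))"
    by (rule sum.reindex_cong[of ?s]) (auto intro: inj_on_subset[OF inj_shift])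
  also have "\<dots> = (\<Sum>y\<in>?A. inner (app f y) (app (rep (letter_adj l) g) y))"
    by (simp add: app_rep shift_inverse eq)
  also have "\<dots> = inner f (rep (letter_adj l) g)"
    by (simp add: inner_finsupp_def)
  finally show "inner (rep l f) g = inner f (rep (letter_adj l) g)" .
qed

definition rotation :: "real \<Rightarrow> bool" where
  "rotation \<theta> \<longleftrightarrow> (\<forall>x. \<sigma> X1 (\<sigma> X2 x) = \<sigma> X2 (\<sigma> X1 x) \<and>
    \<alpha> X2 x * \<alpha> X1 (\<sigma> X2 x) = cis \<theta> * (\<alpha> X1 x * \<alpha> X2 (\<sigma> X1 x)))"

lemma rotation_admissible_op_norm:
  assumes "rotation \<theta>"
  shows "op_norm \<in> rotation_admissible \<theta>"
proof (rule op_norm_admissible, rule finsupp_eqI)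
  fix f x
  have *: "\<sigma> X1 (\<sigma> X2 x) = \<sigma> X2 (\<sigma> X1 x)"
    "\<alpha> X2 x * \<alpha> X1 (\<sigma> X2 x) = cis \<theta> * (\<alpha> X1 x * \<alpha> X2 (\<sigma> X1 x))"
    using assms by (auto simp: rotation_def)
  show "app (rep X2 (rep X1 f)) x = app (cscale (cis \<theta>) (rep X1 (rep X2 f))) x"
    by (simp add: app_rep cscale.rep_eq *(1) mult.assoc [symmetric] *(2))
qed

end

section \<open>Tensor products\<close>

definition tensor :: "'x finsupp \<Rightarrow> 'y finsupp \<Rightarrow> ('x \<times> 'y) finsupp" where
  "tensor f g = Abs_finsupp (\<lambda>(x, y). app f x * app g y)"

lemma tensor_support: "{z. (case z of (x, y) \<Rightarrow> app f x * app g y) \<noteq> 0} = {x. app f x \<noteq> 0} \<times> {y. app g y \<noteq> 0}"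
  by auto

lemma app_tensor: "app (tensor f g) (x, y) = app f x * app g y"
  unfolding tensor_def by (subst Abs_finsupp_inverse) (simp_all add: tensor_support)

lemma tensor_add_left: "tensor (f + g) h = tensor f h + tensor g h"
  by (rule finsupp_eqI) (auto simp: app_tensor app_simps distrib_right)

lemma tensor_diff_right: "tensor f (g - h) = tensor f g - tensor f h"
  by (rule finsupp_eqI) (auto simp: app_tensor app_simps right_diff_distrib)

lemma tensor_cscale_left: "tensor (cscale c f) g = cscale c (tensor f g)"
  by (rule finsupp_eqI) (auto simp: app_tensor cscale.rep_eq)

lemma tensor_zero_left: "tensor 0 g = 0"
  by (rule finsupp_eqI) (auto simp: app_tensor app_simps)

lemma tensor_sum_left: "tensor (sum f A) g = (\<Sum>i\<in>A. tensor (f i) g)"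
  by (induction A rule: infinite_finite_induct) (simp_all add: tensor_zero_left tensor_add_left)

lemma norm_tensor: "norm (tensor f g) = norm f * norm g"
proof -
  let ?A = "{x. app f x \<noteq> 0}" and ?B = "{y. app g y \<noteq> 0}"
  have "(norm (tensor f g))\<^sup>2 = (\<Sum>z\<in>?A \<times> ?B. (cmod (app (tensor f g) z))\<^sup>2)"
    by (rule norm_square_finsupp) (auto simp: app_tensor)
  also have "\<dots> = (\<Sum>(x, y)\<in>?A \<times> ?B. (cmod (app f x))\<^sup>2 * (cmod (app g y))\<^sup>2)"
    by (rule sum.cong) (auto simp: app_tensor norm_mult power_mult_distrib)
  also have "\<dots> = (norm f)\<^sup>2 * (norm g)\<^sup>2"
    by (simp add: sum.cartesian_product [symmetric] sum_product norm_square_finsupp[of ?A f] norm_square_finsupp[of ?B g])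
  finally show ?thesis
    by (simp add: power_mult_distrib [symmetric])
qed

locale monomial_rep_pair =
  R1: monomial_rep \<alpha>1 \<sigma>1 + R2: monomial_rep \<alpha>2 \<sigma>2
  for \<alpha>1 :: "letter \<Rightarrow> 'x \<Rightarrow> complex" and \<sigma>1 and \<alpha>2 :: "letter \<Rightarrow> 'y \<Rightarrow> complex" and \<sigma>2
begin

sublocale T: monomial_rep "\<lambda>l (x, y). \<alpha>1 l x * \<alpha>2 l y" "\<lambda>l. map_prod (\<sigma>1 l) (\<sigma>2 l)"
  by standard
    (auto simp: R1.shift_inverse R2.shift_inverse R1.phase_adj R2.phase_adj norm_mult R1.norm_phase R2.norm_phase)

lemma rep_tensor: "T.rep l (tensor f g) = tensor (R1.rep l f) (R2.rep l g)"
  by (rule finsupp_eqI) (auto simp: T.app_rep R1.app_rep R2.app_rep app_tensor)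

lemma word_act_tensor: "T.word_act w (tensor f g) = tensor (R1.word_act w f) (R2.word_act w g)"
proof -
  have "foldr T.rep ls (tensor f g) = tensor (foldr R1.rep ls f) (foldr R2.rep ls g)" for ls
    by (induction ls) (simp_all add: rep_tensor)
  then show ?thesis
    by (simp add: T.word_act_def R1.word_act_def R2.word_act_def)
qed

text \<open>Phases multiply and shifts act on separate coordinates, so the factors
  \<open>cis \<theta>\<close> and \<open>cis \<delta>\<close> multiply and the angles add.\<close>

lemma rotation_tensor:
  assumes "R1.rotation \<theta>" "R2.rotation \<delta>"
  shows "T.rotation (\<theta> + \<delta>)"
  unfolding T.rotation_def
proof (intro allI)
  fix z :: "'x \<times> 'y"
  obtain x y where [simp]: "z = (x, y)"
    by (cases z)
  have "\<alpha>1 X2 x * \<alpha>1 X1 (\<sigma>1 X2 x) * (\<alpha>2 X2 y * \<alpha>2 X1 (\<sigma>2 X2 y)) =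
      (cis \<theta> * (\<alpha>1 X1 x * \<alpha>1 X2 (\<sigma>1 X1 x))) * (cis \<delta> * (\<alpha>2 X1 y * \<alpha>2 X2 (\<sigma>2 X1 y)))"
    using assms by (simp add: R1.rotation_def R2.rotation_def)
  then show "map_prod (\<sigma>1 X1) (\<sigma>2 X1) (map_prod (\<sigma>1 X2) (\<sigma>2 X2) z) = map_prod (\<sigma>1 X2) (\<sigma>2 X2) (map_prod (\<sigma>1 X1) (\<sigma>2 X1) z) \<and>
    (case z of (x, y) \<Rightarrow> \<alpha>1 X2 x * \<alpha>2 X2 y) * (case map_prod (\<sigma>1 X2) (\<sigma>2 X2) z of (x, y) \<Rightarrow> \<alpha>1 X1 x * \<alpha>2 X1 y) =
    cis (\<theta> + \<delta>) * ((case z of (x, y) \<Rightarrow> \<alpha>1 X1 x * \<alpha>2 X1 y) * (case map_prod (\<sigma>1 X1) (\<sigma>2 X1) z of (x, y) \<Rightarrow> \<alpha>1 X2 x * \<alpha>2 X2 y))"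
    using assms by (simp add: R1.rotation_def R2.rotation_def cis_mult [symmetric] mult_ac)
qed

end

section \<open>The lattice representation is isometric\<close>

context star_seminorm
begin

text \<open>Equality of images in the completion. It permits computing with the relations inside the
  ring of *-polynomials.\<close>

definition equiv :: "'a \<Rightarrow> 'a \<Rightarrow> bool" where
  "equiv x y \<longleftrightarrow> \<nu> (x - y) = 0"

lemma equiv_refl [simp]: "equiv x x"
  by (simp add: equiv_def)

lemma equiv_sym: "equiv x y \<Longrightarrow> equiv y x"
  by (simp add: equiv_def norm_diff_commute)

lemma equiv_trans [trans]: "equiv x y \<Longrightarrow> equiv y z \<Longrightarrow> equiv x z"
  using norm_diff_le[of x z y] norm_ge_0[of "x - z"] by (simp add: equiv_def)

lemma equiv_mult_left: "equiv x y \<Longrightarrow> equiv (z * x) (z * y)"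
  using submult[of z "x - y"] norm_ge_0[of "z * x - z * y"] by (simp add: equiv_def right_diff_distrib)

lemma equiv_mult_right: "equiv x y \<Longrightarrow> equiv (x * z) (y * z)"
  using submult[of "x - y" z] norm_ge_0[of "x * z - y * z"] by (simp add: equiv_def left_diff_distrib)

lemma equiv_add: "equiv x y \<Longrightarrow> equiv x' y' \<Longrightarrow> equiv (x + x') (y + y')"
  using triangle[of "x - y" "x' - y'"] norm_ge_0[of "x - y + (x' - y')"]
  unfolding equiv_def add_diff_add by linarith

lemma equiv_sum: "(\<And>i. i \<in> A \<Longrightarrow> equiv (f i) (g i)) \<Longrightarrow> equiv (sum f A) (sum g A)"
  by (induction A rule: infinite_finite_induct) (auto intro: equiv_add)

lemma equiv_norm_eq: "equiv x y \<Longrightarrow> \<nu> x = \<nu> y"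
  using norm_diff_ge[of x y] norm_diff_ge[of y x] by (simp add: equiv_def norm_diff_commute)

lemma equiv_commute_power:
  assumes "equiv (v * x) (sc c * (x * v))"
  shows "equiv (v * x ^ n) (sc (c ^ n) * (x ^ n * v))"
proof (induction n)
  case (Suc n)
  have "equiv (v * x ^ Suc n) (sc c * (x * v) * x ^ n)"
    using equiv_mult_right[OF assms, of "x ^ n"] by (simp add: mult.assoc)
  also have "sc c * (x * v) * x ^ n = sc c * x * (v * x ^ n)"
    by (simp add: mult.assoc)
  also have "equiv \<dots> (sc c * x * (sc (c ^ n) * (x ^ n * v)))"
    by (rule equiv_mult_left[OF Suc])
  also have "sc c * x * (sc (c ^ n) * (x ^ n * v)) = sc (c ^ Suc n) * (x ^ Suc n * v)"
    by (simp add: sc_mult mult.assoc sc_left_commute[of x])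
  finally show ?case .
qed simp

text \<open>Multiplying the relation by the inverse \<open>w\<close> of \<open>v\<close> on both
  sides inverts the scalar. \<open>equiv_commute_inverse_right\<close> does the same with an inverse
  of \<open>x\<close>.\<close>

lemma equiv_commute_inverse_left:
  assumes "equiv (v * x) (sc c * (x * v))" "equiv (w * v) 1" "equiv (v * w) 1" "c \<noteq> 0"
  shows "equiv (w * x) (sc (1 / c) * (x * w))"
proof -
  have "equiv (x * w) (w * v * (x * w))"
    using equiv_mult_right[OF assms(2), of "x * w"] by (simp add: equiv_sym)
  also have "w * v * (x * w) = w * (v * x) * w"
    by (simp add: mult.assoc)
  also have "equiv \<dots> (w * (sc c * (x * v)) * w)"
    by (intro equiv_mult_left equiv_mult_right assms)
  also have "w * (sc c * (x * v)) * w = sc c * (w * x) * (v * w)"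
    by (simp add: mult.assoc sc_left_commute[of w])
  also have "equiv \<dots> (sc c * (w * x) * 1)"
    by (intro equiv_mult_left assms)
  finally have "equiv (x * w) (sc c * (w * x))"
    by simp
  then have "equiv (sc (1 / c) * (x * w)) (sc (1 / c) * (sc c * (w * x)))"
    by (rule equiv_mult_left)
  then show ?thesis
    using assms(4) by (simp add: mult.assoc [symmetric] sc_mult [symmetric] equiv_sym)
qed

lemma equiv_commute_inverse_right:
  assumes "equiv (v * x) (sc c * (x * v))" "equiv (y * x) 1" "equiv (x * y) 1" "c \<noteq> 0"
  shows "equiv (v * y) (sc (1 / c) * (y * v))"
proof -
  have "equiv (sc (1 / c) * (v * x)) (x * v)"
    using equiv_mult_left[OF assms(1), of "sc (1 / c)"] assms(4)
    by (simp add: mult.assoc [symmetric] sc_mult [symmetric])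
  then have "equiv (y * (x * v) * y) (y * (sc (1 / c) * (v * x)) * y)"
    by (intro equiv_mult_left equiv_mult_right) (rule equiv_sym)
  also have "y * (sc (1 / c) * (v * x)) * y = sc (1 / c) * (y * v) * (x * y)"
    by (simp add: mult.assoc sc_left_commute[of y])
  also have "equiv \<dots> (sc (1 / c) * (y * v) * 1)"
    by (intro equiv_mult_left assms)
  finally have "equiv (y * (x * v) * y) (sc (1 / c) * (y * v))"
    by simp
  moreover have "equiv (v * y) (y * x * (v * y))"
    using equiv_mult_right[OF assms(2), of "v * y"] by (simp add: equiv_sym)
  moreover have "y * x * (v * y) = y * (x * v) * y"
    by (simp add: mult.assoc)
  ultimately show ?thesis
    using equiv_trans by metis
qed

end

section \<open>Normal forms and the lattice representation\<close>

text \<open>Left multiplication on the monomials \<open>u\<^sup>i v\<^sup>j\<close>, with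
  \<open>(i, j)\<close> as index of the basis vector: moving \<open>v\<close> past
  \<open>u\<^sup>i\<close> produces the phase. This is the representation of the canonical
  trace.\<close>

fun lattice_phase :: "real \<Rightarrow> letter \<Rightarrow> int \<times> int \<Rightarrow> complex" where
  "lattice_phase \<theta> X1 (m, n) = 1"
| "lattice_phase \<theta> X1s (m, n) = 1"
| "lattice_phase \<theta> X2 (m, n) = cis (\<theta> * of_int m)"
| "lattice_phase \<theta> X2s (m, n) = cis (- \<theta> * of_int m)"

fun lattice_shift :: "letter \<Rightarrow> int \<times> int \<Rightarrow> int \<times> int" where
  "lattice_shift X1 (m, n) = (m - 1, n)"
| "lattice_shift X1s (m, n) = (m + 1, n)"
| "lattice_shift X2 (m, n) = (m, n - 1)"
| "lattice_shift X2s (m, n) = (m, n + 1)"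

interpretation lattice: monomial_rep "lattice_phase \<theta>" lattice_shift for \<theta>
proof
  fix l and x :: "int \<times> int"
  show "lattice_shift l (lattice_shift (letter_adj l) x) = x"
    by (cases l; cases x) auto
  show "lattice_phase \<theta> (letter_adj l) x = cnj (lattice_phase \<theta> l (lattice_shift (letter_adj l) x))"
    by (cases l; cases x) (auto simp: cis_cnj)
  show "cmod (lattice_phase \<theta> l x) = 1"
    by (cases l; cases x) auto
qed

lemma lattice_rotation: "lattice.rotation \<theta> \<theta>"
  by (auto simp: lattice.rotation_def cis_mult algebra_simps)

lemma lattice_rep_basis:
  "lattice.rep \<theta> X1 (basis_vec (i, j)) = basis_vec (i + 1, j)"
  "lattice.rep \<theta> X1s (basis_vec (i, j)) = basis_vec (i - 1, j)"
  "lattice.rep \<theta> X2 (basis_vec (i, j)) = cscale (cis (\<theta> * of_int i)) (basis_vec (i, j + 1))"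
  "lattice.rep \<theta> X2s (basis_vec (i, j)) = cscale (cis (- \<theta> * of_int i)) (basis_vec (i, j - 1))"
  by (rule finsupp_eqI; force simp: lattice.app_rep app_basis_vec cscale.rep_eq)+

definition var_power :: "letter \<Rightarrow> int \<Rightarrow> star_poly" where
  "var_power l i = (if i \<ge> 0 then var l ^ nat i else var (letter_adj l) ^ nat (- i))"

lemma var_power_minus: "var_power (letter_adj l) (- i) = var_power l i"
  by (auto simp: var_power_def)

lemma var_power_0 [simp]: "var_power l 0 = 1"
  by (simp add: var_power_def)

lemma rot_equiv_inverse: "rot.equiv \<theta> (var l * var (letter_adj l)) 1"
  unfolding rot.equiv_def
  by (rule rotation_seminorm_relation) (cases l; simp add: rotation_relations_def)

lemma rot_equiv_commute: "rot.equiv \<theta> (var X2 * var X1) (const (cis \<theta>) * (var X1 * var X2))"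
  unfolding rot.equiv_def
  by (rule rotation_seminorm_relation) (simp add: rotation_relations_def)

lemma var_mult_var_power: "rot.equiv \<theta> (var l * var_power l i) (var_power l (i + 1))"
proof (cases "i \<ge> 0")
  case True
  then show ?thesis
    by (simp add: var_power_def nat_add_distrib)
next
  case False
  then obtain k where k: "nat (- i) = Suc k" "nat (- (i + 1)) = k"
    by (intro that[of "nat (- i - 1)"]) auto
  then have "var_power l (i + 1) = var (letter_adj l) ^ k"
    using False by (cases "i = - 1") (auto simp: var_power_def)
  moreover have "var l * var_power l i = var l * var (letter_adj l) * var (letter_adj l) ^ k"
    using False k by (simp add: var_power_def mult.assoc)
  ultimately show ?thesis
    using rot.equiv_mult_right[OF rot_equiv_inverse, of \<theta> l "var (letter_adj l) ^ k"] by simp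
qed

lemma var_adj_mult_var_power: "rot.equiv \<theta> (var (letter_adj l) * var_power l i) (var_power l (i - 1))"
  using var_mult_var_power[of \<theta> "letter_adj l" "- i"] var_power_minus[of l i] var_power_minus[of l "i - 1"]
  by simp

lemma X2_commute_power:
  "rot.equiv \<theta> (var X2 * var_power X1 i) (const (cis (\<theta> * of_int i)) * (var_power X1 i * var X2))"
proof (cases "i \<ge> 0")
  case True
  then have "cis \<theta> ^ nat i = cis (\<theta> * of_int i)"
    by (simp add: Complex.DeMoivre mult.commute)
  then show ?thesis
    using rot.equiv_commute_power[OF rot_equiv_commute, of \<theta> "nat i"] True by (simp add: var_power_def)
next
  case False
  then have "(1 / cis \<theta>) ^ nat (- i) = cis (\<theta> * of_int i)"
    by (simp add: cis_divide [symmetric] Complex.DeMoivre power_divide field_simps cis_mult)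
  moreover have "rot.equiv \<theta> (var X2 * var X1s) (const (1 / cis \<theta>) * (var X1s * var X2))"
    using rot_equiv_inverse[of \<theta> X1] rot_equiv_inverse[of \<theta> X1s]
    by (intro rot.equiv_commute_inverse_right[OF rot_equiv_commute]) auto
  ultimately show ?thesis
    using rot.equiv_commute_power[of \<theta> "var X2" "var X1s" "1 / cis \<theta>" "nat (- i)"] False
    by (simp add: var_power_def)
qed

lemma X2s_commute_power:
  "rot.equiv \<theta> (var X2s * var_power X1 i) (const (cis (- \<theta> * of_int i)) * (var_power X1 i * var X2s))"
proof -
  have "1 / cis (\<theta> * of_int i) = cis (- \<theta> * of_int i)"
    using cis_divide[of 0 "\<theta> * of_int i"] by simp
  then show ?thesis
    using rot.equiv_commute_inverse_left[of \<theta> "var X2" "var_power X1 i" "cis (\<theta> * of_int i)" "var X2s"] X2_commute_power[of \<theta> i]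
      rot_equiv_inverse[of \<theta> X2] rot_equiv_inverse[of \<theta> X2s] by simp
qed

text \<open>The word is normalised in the algebra and on the basis vector at the origin in parallel.
  The same scalar and exponents occur in both, so the image of that vector records the normal
  form.\<close>

lemma word_normal_form:
  "\<exists>c i j. \<bar>i\<bar> \<le> int (length ls) \<and> \<bar>j\<bar> \<le> int (length ls) \<and>
    rot.equiv \<theta> (Poly_Mapping.single (Word ls) 1) (const c * (var_power X1 i * var_power X2 j)) \<and>
    lattice.word_act \<theta> (Word ls) (basis_vec (0, 0)) = cscale c (basis_vec (i, j))"
proof (induction ls)
  case Nil
  show ?case
    by (intro exI[of _ 1] exI[of _ 0]) (simp add: zero_word_def [symmetric])
next
  case (Cons l ls)
  then obtain c i j where IH: "\<bar>i\<bar> \<le> int (length ls)" "\<bar>j\<bar> \<le> int (length ls)"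
    "rot.equiv \<theta> (Poly_Mapping.single (Word ls) 1) (const c * (var_power X1 i * var_power X2 j))"
    "lattice.word_act \<theta> (Word ls) (basis_vec (0, 0)) = cscale c (basis_vec (i, j))"
    by blast
  have "\<exists>d i' j'. \<bar>i' - i\<bar> \<le> 1 \<and> \<bar>j' - j\<bar> \<le> 1 \<and>
      rot.equiv \<theta> (var l * (var_power X1 i * var_power X2 j)) (const d * (var_power X1 i' * var_power X2 j')) \<and>
      lattice.rep \<theta> l (basis_vec (i, j)) = cscale d (basis_vec (i', j'))"
  proof (cases l)
    case X1
    have "rot.equiv \<theta> (var X1 * (var_power X1 i * var_power X2 j)) (var_power X1 (i + 1) * var_power X2 j)"
      using rot.equiv_mult_right[OF var_mult_var_power, of \<theta> X1 i "var_power X2 j"] by (simp add: mult.assoc)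
    then show ?thesis
      unfolding X1 lattice_rep_basis by (intro exI[of _ 1] exI[of _ "i + 1"] exI[of _ j]) simp
  next
    case X1s
    have "rot.equiv \<theta> (var X1s * (var_power X1 i * var_power X2 j)) (var_power X1 (i - 1) * var_power X2 j)"
      using rot.equiv_mult_right[OF var_adj_mult_var_power, of \<theta> X1 i "var_power X2 j"] by (simp add: mult.assoc)
    then show ?thesis
      unfolding X1s lattice_rep_basis by (intro exI[of _ 1] exI[of _ "i - 1"] exI[of _ j]) simp
  next
    case X2
    let ?d = "cis (\<theta> * of_int i)"
    have "rot.equiv \<theta> (var X2 * (var_power X1 i * var_power X2 j)) (const ?d * var_power X1 i * (var X2 * var_power X2 j))"
      using rot.equiv_mult_right[OF X2_commute_power, of \<theta> i "var_power X2 j"] by (simp add: mult.assoc)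
    also have "rot.equiv \<theta> \<dots> (const ?d * var_power X1 i * var_power X2 (j + 1))"
      by (intro rot.equiv_mult_left var_mult_var_power)
    finally show ?thesis
      unfolding X2 lattice_rep_basis
      by (intro exI[of _ ?d] exI[of _ i] exI[of _ "j + 1"]) (simp add: mult.assoc)
  next
    case X2s
    let ?d = "cis (- \<theta> * of_int i)"
    have "rot.equiv \<theta> (var X2s * (var_power X1 i * var_power X2 j)) (const ?d * var_power X1 i * (var X2s * var_power X2 j))"
      using rot.equiv_mult_right[OF X2s_commute_power, of \<theta> i "var_power X2 j"] by (simp add: mult.assoc)
    also have "rot.equiv \<theta> \<dots> (const ?d * var_power X1 i * var_power X2 (j - 1))"
      using var_adj_mult_var_power[of \<theta> X2 j] by (intro rot.equiv_mult_left) simp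
    finally show ?thesis
      unfolding X2s lattice_rep_basis
      by (intro exI[of _ ?d] exI[of _ i] exI[of _ "j - 1"]) (simp add: mult.assoc)
  qed
  then obtain d i' j' where d: "\<bar>i' - i\<bar> \<le> 1" "\<bar>j' - j\<bar> \<le> 1"
    "rot.equiv \<theta> (var l * (var_power X1 i * var_power X2 j)) (const d * (var_power X1 i' * var_power X2 j'))"
    "lattice.rep \<theta> l (basis_vec (i, j)) = cscale d (basis_vec (i', j'))"
    by blast
  have "rot.equiv \<theta> (Poly_Mapping.single (Word (l # ls)) 1) (var l * (const c * (var_power X1 i * var_power X2 j)))"
    unfolding single_Cons by (rule rot.equiv_mult_left[OF IH(3)])
  also have "var l * (const c * (var_power X1 i * var_power X2 j)) = const c * (var l * (var_power X1 i * var_power X2 j))"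
    by (rule star_poly.sc_left_commute)
  also have "rot.equiv \<theta> \<dots> (const c * (const d * (var_power X1 i' * var_power X2 j')))"
    by (rule rot.equiv_mult_left[OF d(3)])
  finally have "rot.equiv \<theta> (Poly_Mapping.single (Word (l # ls)) 1) (const (c * d) * (var_power X1 i' * var_power X2 j'))"
    by (simp add: star_poly.sc_mult mult.assoc)
  moreover have "lattice.word_act \<theta> (Word (l # ls)) (basis_vec (0, 0)) = cscale (c * d) (basis_vec (i', j'))"
    by (simp add: lattice.word_act_Cons IH(4) lattice.rep_cs d(4) finsupp.cs_mult)
  ultimately show ?case
    using IH(1,2) d(1,2) by (intro exI[of _ "c * d"] exI[of _ i'] exI[of _ j']) auto
qed

section \<open>Polynomial growth and isometry\<close>

definition word_bound :: "star_poly \<Rightarrow> nat \<Rightarrow> bool" where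
  "word_bound p D \<longleftrightarrow> (\<forall>w\<in>Poly_Mapping.keys p. length (letters w) \<le> D)"

lemma word_bound_exists: "\<exists>D. word_bound p D"
proof
  show "word_bound p (\<Sum>w\<in>Poly_Mapping.keys p. length (letters w))"
    by (auto simp: word_bound_def intro: member_le_sum)
qed

lemma word_bound_mult:
  assumes "word_bound p C" "word_bound q D"
  shows "word_bound (p * q) (C + D)"
  unfolding word_bound_def
proof
  fix w assume "w \<in> Poly_Mapping.keys (p * q)"
  then obtain a b where "a \<in> Poly_Mapping.keys p" "b \<in> Poly_Mapping.keys q" "w = a + b"
    using keys_mult[of p q] by blast
  with assms show "length (letters w) \<le> C + D"
    by (auto simp: word_bound_def plus_word_def intro: add_mono)
qed

lemma word_bound_power:
  assumes "word_bound p D"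
  shows "word_bound (p ^ n) (n * D)"
proof (induction n)
  case 0
  show ?case
    by (simp add: word_bound_def zero_word_def flip: single_one)
next
  case (Suc n)
  then show ?case
    using word_bound_mult[OF assms] by simp
qed

lemma rot_var_power_le: "rotation_seminorm \<theta> (var_power l i) \<le> 1"
proof -
  have "rotation_seminorm \<theta> (var l ^ n) \<le> 1" for l n
  proof -
    have "rotation_seminorm \<theta> (var l) \<le> 1"
      using admissible_word_le[OF rotation_seminorm_admissible] by (simp add: var_def)
    then show ?thesis
      using rot.norm_power_le[of \<theta> "var l" n] power_le_one[of "rotation_seminorm \<theta> (var l)" n] by simp
  qed
  then show ?thesis
    by (simp add: var_power_def)
qed

text \<open>The coefficients of the normal form of \<open>p\<close> are the coordinates of the image
  of one unit vector, so each is at most the operator norm. There are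
  \<open>(2 D + 1)\<^sup>2\<close> pairs of exponents, and each monomial has seminorm at most
  1.\<close>

lemma rotation_seminorm_le_polynomial:
  assumes "word_bound p D"
  shows "rotation_seminorm \<theta> p \<le> (2 * real D + 1)\<^sup>2 * lattice.op_norm \<theta> p"
proof -
  let ?K = "Poly_Mapping.keys p" and ?I = "{- int D..int D}"
  let ?N = "\<lambda>(i, j). var_power X1 i * var_power X2 j"
  let ?e = "basis_vec (0, 0)" and ?x = "Poly_Mapping.lookup p"
  have "\<exists>c z. w \<in> ?K \<longrightarrow> z \<in> ?I \<times> ?I \<and> rot.equiv \<theta> (Poly_Mapping.single w 1) (const c * ?N z) \<and>
      lattice.word_act \<theta> w ?e = cscale c (basis_vec z)" for w
  proof (cases "w \<in> ?K")
    case True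
    then have "length (letters w) \<le> D"
      using assms by (simp add: word_bound_def)
    moreover obtain c i j where "\<bar>i\<bar> \<le> int (length (letters w))" "\<bar>j\<bar> \<le> int (length (letters w))"
      "rot.equiv \<theta> (Poly_Mapping.single w 1) (const c * (var_power X1 i * var_power X2 j))"
      "lattice.word_act \<theta> w ?e = cscale c (basis_vec (i, j))"
      using word_normal_form[of "letters w" \<theta>] by auto
    ultimately show ?thesis
      by (intro exI[of _ c] exI[of _ "(i, j)"]) auto
  qed auto
  then obtain c z where cz: "\<And>w. w \<in> ?K \<Longrightarrow> z w \<in> ?I \<times> ?I"
    "\<And>w. w \<in> ?K \<Longrightarrow> rot.equiv \<theta> (Poly_Mapping.single w 1) (const (c w) * ?N (z w))"
    "\<And>w. w \<in> ?K \<Longrightarrow> lattice.word_act \<theta> w ?e = cscale (c w) (basis_vec (z w))"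
    by metis
  let ?y = "lattice.act \<theta> p ?e"
  have y: "app ?y b = (\<Sum>w\<in>?K. if b = z w then ?x w * c w else 0)" for b
    unfolding lattice.act_def app_sum
    by (intro sum.cong refl) (simp add: cz(3) cscale.rep_eq app_basis_vec)
  have "rot.equiv \<theta> p (\<Sum>w\<in>?K. const (?x w) * (const (c w) * ?N (z w)))"
    by (subst (1) star_poly_eq_sum) (intro rot.equiv_sum rot.equiv_mult_left cz)
  \<comment> \<open>Distributing each term over all pairs of exponents with an indicator regroups
    the words that share a normal form; exchanging the sums turns the coefficients into coordinates
    of \<open>?y\<close>.\<close>
  also have "(\<Sum>w\<in>?K. const (?x w) * (const (c w) * ?N (z w))) =
      (\<Sum>w\<in>?K. \<Sum>b\<in>?I \<times> ?I. const (if b = z w then ?x w * c w else 0) * ?N b)"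
  proof (rule sum.cong)
    fix w assume "w \<in> ?K"
    then have "z w \<in> ?I \<times> ?I"
      by (rule cz)
    moreover have "(\<Sum>b\<in>?I \<times> ?I. const (if b = z w then ?x w * c w else 0) * ?N b) =
        (\<Sum>b\<in>?I \<times> ?I. if b = z w then const (?x w * c w) * ?N (z w) else 0)"
      by (intro sum.cong) auto
    ultimately show "const (?x w) * (const (c w) * ?N (z w)) =
        (\<Sum>b\<in>?I \<times> ?I. const (if b = z w then ?x w * c w else 0) * ?N b)"
      by (simp only: sum.delta finite_cartesian_product finite_atLeastAtMost_int if_True star_poly.sc_mult mult.assoc)
  qed simp
  also have "\<dots> = (\<Sum>b\<in>?I \<times> ?I. const (app ?y b) * ?N b)"
  proof -
    have "const (sum f A) = (\<Sum>w\<in>A. const (f w))" for f and A :: "word set"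
      by (induction A rule: infinite_finite_induct) (simp_all add: star_poly.sc_add)
    then show ?thesis
      by (subst sum.swap) (simp add: y sum_distrib_right)
  qed
  finally have "rotation_seminorm \<theta> p = rotation_seminorm \<theta> (\<Sum>b\<in>?I \<times> ?I. const (app ?y b) * ?N b)"
    by (rule rot.equiv_norm_eq)
  also have "\<dots> \<le> (\<Sum>b\<in>?I \<times> ?I. rotation_seminorm \<theta> (const (app ?y b) * ?N b))"
    by (rule rot.norm_sum_le)
  also have "\<dots> \<le> (\<Sum>b\<in>?I \<times> ?I. lattice.op_norm \<theta> p)"
  proof (rule sum_mono)
    fix b assume "b \<in> ?I \<times> ?I"
    obtain i j where b: "b = (i, j)"
      by (cases b)
    have "rotation_seminorm \<theta> (?N b) \<le> 1 * 1"
      unfolding b prod.case by (rule order_trans[OF rot.submult]) (intro mult_mono rot_var_power_le; simp)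
    then have "rotation_seminorm \<theta> (const (app ?y b) * ?N b) \<le> cmod (app ?y b) * 1"
      unfolding rot.scale by (intro mult_left_mono) auto
    also have "\<dots> \<le> lattice.op_norm \<theta> p"
      using norm_app_le[of ?y b] lattice.norm_act_le_op_norm[of \<theta> p ?e] by simp
    finally show "rotation_seminorm \<theta> (const (app ?y b) * ?N b) \<le> lattice.op_norm \<theta> p" .
  qed
  also have "\<dots> = (2 * real D + 1)\<^sup>2 * lattice.op_norm \<theta> p"
    by (simp add: card_cartesian_product power2_eq_square)
  finally show ?thesis .
qed

lemma le_if_powers_le_polynomial:
  fixes a b K :: real
  assumes "0 \<le> b" "0 \<le> K" and le: "\<And>m. a ^ (2 ^ m) \<le> (K * 2 ^ m + 1)\<^sup>2 * b ^ (2 ^ m)"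
  shows "a \<le> b"
proof (rule ccontr)
  assume "\<not> a \<le> b"
  \<comment> \<open>The midpoint is positive even when \<open>b = 0\<close>, so it may be divided
    by, and the ratio \<open>r\<close> still exceeds 1: exponential growth against a
    polynomial.\<close>
  define c where "c = (a + b) / 2"
  define r where "r = a / c"
  have c: "c > 0" "b \<le> c" and r: "r > 1" and a: "a = c * r"
    using \<open>\<not> a \<le> b\<close> assms(1) by (auto simp: c_def r_def field_simps)
  have "r ^ (2 ^ m) \<le> (K * 2 ^ m + 1)\<^sup>2" for m
  proof -
    have "c ^ (2 ^ m) * r ^ (2 ^ m) \<le> (K * 2 ^ m + 1)\<^sup>2 * c ^ (2 ^ m)"
      using le[of m] mult_left_mono[OF power_mono[OF c(2) assms(1), of "2 ^ m"], of "(K * 2 ^ m + 1)\<^sup>2"]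
      by (simp add: a power_mult_distrib)
    then show ?thesis
      using c(1) by (simp add: mult.commute)
  qed
  moreover have "(\<lambda>n. (K * real n + 1)\<^sup>2 / r ^ n) \<longlonglongrightarrow> 0"
  proof (cases "K = 0")
    case False
    with assms(2) have "K > 0"
      by simp
    with r show ?thesis
      by real_asymp
  next
    case True
    with r show ?thesis
      by real_asymp
  qed
  then have "\<forall>\<^sub>F n in sequentially. (K * real n + 1)\<^sup>2 / r ^ n < 1"
    by (rule order_tendstoD(2)) simp
  then obtain n0 where "\<And>n. n \<ge> n0 \<Longrightarrow> (K * real n + 1)\<^sup>2 / r ^ n < 1"
    by (auto simp: eventually_sequentially)
  from this[of "2 ^ n0"] have "(K * 2 ^ n0 + 1)\<^sup>2 < r ^ (2 ^ n0)"
    using r by (simp add: less_imp_le)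
  ultimately show False
    by (meson not_le)
qed

lemma rotation_seminorm_eq_op_norm: "rotation_seminorm \<theta> p = lattice.op_norm \<theta> p"
proof (rule antisym)
  show "lattice.op_norm \<theta> p \<le> rotation_seminorm \<theta> p"
    by (intro admissible_le_rotation_seminorm lattice.rotation_admissible_op_norm lattice_rotation)
next
  interpret L: star_seminorm const formal_adj "lattice.op_norm \<theta>"
    by (rule lattice.star_seminorm_op_norm)
  \<comment> \<open>Powers are exact only for selfadjoint elements; the C*-identity brings the
    result for \<open>y\<close> back to \<open>p\<close>.\<close>
  define y where "y = formal_adj p * p"
  have sa: "formal_adj y = y"
    by (simp add: y_def star_poly.adj_mult)
  obtain D where D: "word_bound y D"
    using word_bound_exists by blast
  have "rotation_seminorm \<theta> y \<le> lattice.op_norm \<theta> y"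
  proof (rule le_if_powers_le_polynomial)
    fix m :: nat
    have "rotation_seminorm \<theta> (y ^ (2 ^ m)) \<le> (2 * real (2 ^ m * D) + 1)\<^sup>2 * lattice.op_norm \<theta> (y ^ (2 ^ m))"
      by (intro rotation_seminorm_le_polynomial word_bound_power D)
    then show "rotation_seminorm \<theta> y ^ (2 ^ m) \<le> (2 * real D * 2 ^ m + 1)\<^sup>2 * lattice.op_norm \<theta> y ^ (2 ^ m)"
      by (simp add: rot.norm_sa_power[OF sa] L.norm_sa_power[OF sa] mult_ac)
  qed auto
  then have "(rotation_seminorm \<theta> p)\<^sup>2 \<le> (lattice.op_norm \<theta> p)\<^sup>2"
    by (simp add: y_def rot.cstar L.cstar)
  then show "rotation_seminorm \<theta> p \<le> lattice.op_norm \<theta> p"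
    by (rule power2_le_imp_le) simp
qed

section \<open>Comparison of two angles\<close>

text \<open>Here \<open>X1\<close> carries the phase, in the lattice representation
  \<open>X2\<close> does. The opposite direction of the shift compensates for this, so that the
  angle is \<open>\<delta>\<close> and not \<open>- \<delta>\<close>.\<close>

fun line_phase :: "real \<Rightarrow> letter \<Rightarrow> int \<Rightarrow> complex" where
  "line_phase \<delta> X1 k = cis (\<delta> * of_int k)"
| "line_phase \<delta> X1s k = cis (- \<delta> * of_int k)"
| "line_phase \<delta> X2 k = 1"
| "line_phase \<delta> X2s k = 1"

fun line_shift :: "letter \<Rightarrow> int \<Rightarrow> int" where
  "line_shift X1 k = k"
| "line_shift X1s k = k"
| "line_shift X2 k = k + 1"
| "line_shift X2s k = k - 1"

interpretation line: monomial_rep "line_phase \<delta>" line_shift for \<delta>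
proof
  fix l k
  show "line_shift l (line_shift (letter_adj l) k) = k"
    by (cases l) auto
  show "line_phase \<delta> (letter_adj l) k = cnj (line_phase \<delta> l (line_shift (letter_adj l) k))"
    by (cases l) (auto simp: cis_cnj)
  show "cmod (line_phase \<delta> l k) = 1"
    by (cases l) auto
qed

lemma line_rotation: "line.rotation \<delta> \<delta>"
  by (auto simp: line.rotation_def cis_mult algebra_simps)

interpretation pair: monomial_rep_pair "lattice_phase \<theta>" lattice_shift "line_phase \<delta>" line_shift
  for \<theta> \<delta> ..

section \<open>Almost invariant vectors\<close>

context unitary_rep
begin

lemma rep_adj_almost_invariant: "norm (\<rho> (letter_adj l) x - x) = norm (\<rho> l x - x)"
proof -
  have "\<rho> (letter_adj l) x - x = - \<rho> (letter_adj l) (\<rho> l x - x)"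
    by (simp add: rep_diff rep_inverse)
  then show ?thesis
    by (simp only: norm_minus_cancel norm_rep)
qed

lemma word_almost_invariant:
  assumes "\<And>l. norm (\<rho> l x - x) \<le> e"
  shows "norm (word_act w x - x) \<le> real (length (letters w)) * e"
proof -
  have "norm (foldr \<rho> ls x - x) \<le> real (length ls) * e" for ls
  proof (induction ls)
    case (Cons l ls)
    have "foldr \<rho> (l # ls) x - x = \<rho> l (foldr \<rho> ls x - x) + (\<rho> l x - x)"
      by (simp add: rep_diff)
    then have "norm (foldr \<rho> (l # ls) x - x) \<le> norm (foldr \<rho> ls x - x) + norm (\<rho> l x - x)"
      using norm_triangle_ineq norm_rep by metis
    also have "\<dots> \<le> real (length ls) * e + e"
      by (intro add_mono Cons assms)
    finally show ?case
      by (simp add: algebra_simps)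
  qed simp
  then show ?thesis
    by (simp add: word_act_def)
qed

text \<open>The hypothesis concerns products of ring elements. Approximate inverses carry it to
  vectors: their seminorm is at most \<open>(1 + e) / r\<close>, and the seminorm dominates their
  action in any representation of this angle.\<close>

lemma act_bounded_below:
  assumes "op_norm \<in> rotation_admissible \<theta>" "rot.bounded_below \<theta> r x" "rot.almost_inv \<theta> x" "r > 0"
  shows "r * norm \<xi> \<le> norm (act x \<xi>)"
proof (rule ccontr)
  let ?Y = "norm (act x \<xi>)" and ?\<nu> = "rotation_seminorm \<theta>"
  have le: "norm (act z \<eta>) \<le> ?\<nu> z * norm \<eta>" for z \<eta>
    using norm_act_le_op_norm[of z \<eta>] mult_right_mono[OF admissible_le_rotation_seminorm[OF assms(1)], of "norm \<eta>" z]
    by simp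
  assume "\<not> r * norm \<xi> \<le> ?Y"
  then have less: "?Y < r * norm \<xi>"
    by simp
  \<comment> \<open>Makes the total error \<open>e (r * norm \<xi> + ?Y)\<close> half of the
    supposed deficit, a contradiction.\<close>
  define e where "e = (r * norm \<xi> - ?Y) / (2 * (r * norm \<xi> + ?Y))"
  have pos: "r * norm \<xi> + ?Y > 0"
    using less norm_ge_zero[of "act x \<xi>"] by linarith
  then have e: "e > 0" "e * (2 * (r * norm \<xi> + ?Y)) = r * norm \<xi> - ?Y"
    using less by (auto simp: e_def)
  obtain q where q: "?\<nu> (1 - x * q) < e" "?\<nu> (1 - q * x) < e"
    using rot.almost_inv_approx[OF assms(3) e(1)] .
  have "r * ?\<nu> q \<le> ?\<nu> (x * q)"
    using assms(2) by (simp add: rot.bounded_below_def)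
  also have "\<dots> \<le> 1 + e"
    using rot.triangle_diff[of \<theta> 1 "1 - x * q"] rot.norm_1_le[of \<theta>] q(1) by simp
  finally have rq: "r * ?\<nu> q \<le> 1 + e" .
  have "norm \<xi> = norm (act (1 - q * x) \<xi> + act q (act x \<xi>))"
    by (simp add: act_diff act_mult)
  also have "\<dots> \<le> norm (act (1 - q * x) \<xi>) + norm (act q (act x \<xi>))"
    by (rule norm_triangle_ineq)
  also have "\<dots> \<le> e * norm \<xi> + ?\<nu> q * ?Y"
    by (intro add_mono le order_trans[OF le] mult_right_mono) (use q in auto)
  finally have "r * norm \<xi> \<le> r * (e * norm \<xi> + ?\<nu> q * ?Y)"
    using assms(4) by (intro mult_left_mono) auto
  also have "\<dots> = e * (r * norm \<xi>) + r * ?\<nu> q * ?Y"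
    by (simp add: algebra_simps)
  also have "\<dots> \<le> e * (r * norm \<xi>) + (1 + e) * ?Y"
    by (intro add_left_mono mult_right_mono rq) simp
  finally have "r * norm \<xi> - ?Y \<le> e * (r * norm \<xi> + ?Y)"
    by (simp add: algebra_simps)
  moreover have "e * (r * norm \<xi> + ?Y) > 0"
    using e(1) pos by simp
  ultimately show False
    using e(2) by (simp add: algebra_simps)
qed

end

text \<open>The Lipschitz constant of \<open>p\<close> in its letters: a word moves an almost
  invariant vector by at most its length times the error of a single letter.\<close>

definition length_norm :: "star_poly \<Rightarrow> real" where
  "length_norm p = (\<Sum>w\<in>Poly_Mapping.keys p. cmod (Poly_Mapping.lookup p w) * real (length (letters w)))"

lemma length_norm_ge_0: "length_norm p \<ge> 0"
  unfolding length_norm_def by (intro sum_nonneg) simp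

lemma (in monomial_rep_pair) act_tensor_almost:
  assumes "\<And>l. norm (R2.rep l f - f) \<le> e"
  shows "norm (T.act p (tensor \<psi> f) - tensor (R1.act p \<psi>) f) \<le> length_norm p * e * norm \<psi>"
proof -
  let ?K = "Poly_Mapping.keys p" and ?x = "Poly_Mapping.lookup p"
  have "T.act p (tensor \<psi> f) - tensor (R1.act p \<psi>) f =
      (\<Sum>w\<in>?K. cscale (?x w) (tensor (R1.word_act w \<psi>) (R2.word_act w f - f)))"
    by (simp add: T.act_def R1.act_def word_act_tensor tensor_sum_left tensor_cscale_left
        sum_subtractf [symmetric] finsupp.cs_diff_right [symmetric] tensor_diff_right [symmetric])
  also have "norm \<dots> \<le> (\<Sum>w\<in>?K. norm (cscale (?x w) (tensor (R1.word_act w \<psi>) (R2.word_act w f - f))))"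
    by (rule norm_sum)
  also have "\<dots> \<le> (\<Sum>w\<in>?K. cmod (?x w) * (norm \<psi> * (real (length (letters w)) * e)))"
    unfolding finsupp.norm_cs norm_tensor R1.norm_word_act
    by (intro sum_mono mult_left_mono R2.word_almost_invariant assms) auto
  also have "\<dots> = length_norm p * e * norm \<psi>"
    by (simp add: length_norm_def sum_distrib_left sum_distrib_right mult_ac)
  finally show ?thesis .
qed

section \<open>Tent functions\<close>

text \<open>Slope 1 on about \<open>4 M\<close> points makes the squared change under the shift of
  order \<open>M\<close>, whereas values of at least \<open>M\<close> on the middle half make the
  squared norm of order \<open>M\<^sup>3\<close>. The quotient of the norms is of order
  \<open>1 / M\<close>.\<close>

definition tent :: "nat \<Rightarrow> int finsupp" where
  "tent M = Abs_finsupp (\<lambda>k. complex_of_real (max 0 (2 * real M - \<bar>real_of_int k\<bar>)))"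

lemma app_tent: "app (tent M) k = complex_of_real (max 0 (2 * real M - \<bar>real_of_int k\<bar>))"
proof -
  have "finite {k. complex_of_real (max 0 (2 * real M - \<bar>real_of_int k\<bar>)) \<noteq> 0}"
    by (rule finite_subset[of _ "{- 2 * int M..2 * int M}"]) (auto simp: max_def split: if_splits)
  then show ?thesis
    by (simp add: tent_def Abs_finsupp_inverse)
qed

lemma norm_tent_square:
  "(norm (tent M))\<^sup>2 = (\<Sum>k\<in>{- 2 * int M..2 * int M}. (max 0 (2 * real M - \<bar>real_of_int k\<bar>))\<^sup>2)"
  by (subst norm_square_finsupp[of "{- 2 * int M..2 * int M}"]) (auto simp: app_tent max_def split: if_splits)

lemma norm_tent_ge: "(2 * real M + 1) * (real M)\<^sup>2 \<le> (norm (tent M))\<^sup>2"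
proof -
  have "(2 * real M + 1) * (real M)\<^sup>2 = (\<Sum>k\<in>{- int M..int M}. (real M)\<^sup>2)"
    by simp
  also have "\<dots> \<le> (\<Sum>k\<in>{- int M..int M}. (max 0 (2 * real M - \<bar>real_of_int k\<bar>))\<^sup>2)"
    by (intro sum_mono power_mono) auto
  also have "\<dots> \<le> (norm (tent M))\<^sup>2"
    unfolding norm_tent_square by (intro sum_mono2) auto
  finally show ?thesis .
qed

lemma norm_cis_minus_1_le: "cmod (cis t - 1) \<le> \<bar>t\<bar>"
  using dist_exp_i_1[of t] abs_sin_x_le_abs_x[of "t / 2"] by (simp add: cis_conv_exp)

lemma tent_phase_le: "norm (line.rep \<delta> X1 (tent M) - tent M) \<le> 2 * real M * \<bar>\<delta>\<bar> * norm (tent M)"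
proof (rule power2_le_imp_le)
  let ?A = "{- 2 * int M..2 * int M}" and ?t = "\<lambda>k. max 0 (2 * real M - \<bar>real_of_int k\<bar>)"
  have at: "app (line.rep \<delta> X1 (tent M) - tent M) k = (cis (\<delta> * of_int k) - 1) * complex_of_real (?t k)" for k
    by (simp add: app_simps line.app_rep app_tent algebra_simps)
  have "(norm (line.rep \<delta> X1 (tent M) - tent M))\<^sup>2 = (\<Sum>k\<in>?A. (cmod (cis (\<delta> * of_int k) - 1))\<^sup>2 * (?t k)\<^sup>2)"
    by (subst norm_square_finsupp[of ?A]) (auto simp: at norm_mult power_mult_distrib max_def split: if_splits)
  also have "\<dots> \<le> (\<Sum>k\<in>?A. (2 * real M * \<bar>\<delta>\<bar>)\<^sup>2 * (?t k)\<^sup>2)"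
  proof (intro sum_mono mult_right_mono power_mono)
    fix k assume "k \<in> ?A"
    then have "\<bar>real_of_int k\<bar> \<le> 2 * real M"
      by auto
    then have "\<bar>\<delta> * real_of_int k\<bar> \<le> 2 * real M * \<bar>\<delta>\<bar>"
      by (simp add: abs_mult mult.commute mult_left_mono)
    then show "cmod (cis (\<delta> * of_int k) - 1) \<le> 2 * real M * \<bar>\<delta>\<bar>"
      using norm_cis_minus_1_le order_trans by blast
  qed auto
  also have "\<dots> = (2 * real M * \<bar>\<delta>\<bar> * norm (tent M))\<^sup>2"
    by (simp add: norm_tent_square power_mult_distrib sum_distrib_left)
  finally show "(norm (line.rep \<delta> X1 (tent M) - tent M))\<^sup>2 \<le> (2 * real M * \<bar>\<delta>\<bar> * norm (tent M))\<^sup>2" .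
qed simp

lemma tent_shift_le:
  assumes "M > 0"
  shows "norm (line.rep \<delta> X2 (tent M) - tent M) \<le> 2 / real M * norm (tent M)"
proof (rule power2_le_imp_le)
  \<comment> \<open>This interval has \<open>2 (2 M + 1)\<close> points, which matches the factor
    \<open>2 M + 1\<close> in \<open>norm_tent_ge\<close>.\<close>
  let ?A = "{- 2 * int M - 1..2 * int M}" and ?t = "\<lambda>k. max 0 (2 * real M - \<bar>real_of_int k\<bar>)"
  have at: "app (line.rep \<delta> X2 (tent M) - tent M) k = complex_of_real (?t (k + 1) - ?t k)" for k
    by (simp add: app_simps line.app_rep app_tent)
  have "(norm (line.rep \<delta> X2 (tent M) - tent M))\<^sup>2 =
      (\<Sum>k\<in>?A. (cmod (app (line.rep \<delta> X2 (tent M) - tent M) k))\<^sup>2)"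
    by (rule norm_square_finsupp) (auto simp: at max_def split: if_splits)
  also have "\<dots> = (\<Sum>k\<in>?A. \<bar>?t (k + 1) - ?t k\<bar>\<^sup>2)"
    by (simp only: at norm_of_real)
  also have "\<dots> \<le> (\<Sum>k\<in>?A. 1\<^sup>2)"
    by (intro sum_mono power_mono) (auto simp: max_def abs_if split: if_splits)
  also have "\<dots> = 2 * (2 * real M + 1)"
    by simp
  \<comment> \<open>Rounding 2 up to the square 4 yields the constant \<open>2 / M\<close>.\<close>
  also have "\<dots> \<le> 4 * (2 * real M + 1)"
    by simp
  also have "\<dots> = (2 / real M)\<^sup>2 * ((2 * real M + 1) * (real M)\<^sup>2)"
    using assms by (simp add: power2_eq_square)
  also have "\<dots> \<le> (2 / real M)\<^sup>2 * (norm (tent M))\<^sup>2"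
    by (intro mult_left_mono norm_tent_ge) simp
  finally show "(norm (line.rep \<delta> X2 (tent M) - tent M))\<^sup>2 \<le> (2 / real M * norm (tent M))\<^sup>2"
    by (simp only: power_mult_distrib)
qed simp

lemma tent_almost_invariant:
  assumes "M > 0"
  shows "norm (line.rep \<delta> l (tent M) - tent M) \<le> (2 / real M + 2 * real M * \<bar>\<delta>\<bar>) * norm (tent M)"
proof -
  have "norm (line.rep \<delta> X1 (tent M) - tent M) \<le> (2 / real M + 2 * real M * \<bar>\<delta>\<bar>) * norm (tent M)"
    by (rule order_trans[OF tent_phase_le]) (simp add: mult_right_mono)
  moreover have "norm (line.rep \<delta> X2 (tent M) - tent M) \<le> (2 / real M + 2 * real M * \<bar>\<delta>\<bar>) * norm (tent M)"
    by (rule order_trans[OF tent_shift_le[OF assms]]) (intro mult_right_mono; simp)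
  ultimately show ?thesis
    using line.rep_adj_almost_invariant[of \<delta> X1] line.rep_adj_almost_invariant[of \<delta> X2] by (cases l) auto
qed

section \<open>Transfer of spectral gaps\<close>

lemma lattice_bounded_below:
  assumes gap: "rot.bounded_below (\<theta> + \<delta>) r (const t - p)" "rot.almost_inv (\<theta> + \<delta>) (const t - p)"
    and "r > 0" "M > 0"
  shows "(r - length_norm p * (2 / real M + 2 * real M * \<bar>\<delta>\<bar>)) * norm \<psi> \<le> norm (lattice.act \<theta> (const t - p) \<psi>)"
proof -
  define e where "e = 2 / real M + 2 * real M * \<bar>\<delta>\<bar>"
  let ?f = "tent M" and ?x = "const t - p"
  let ?T = "pair.T.act \<theta> \<delta>" and ?L = "lattice.act \<theta>"
  have "(2 * real M + 1) * (real M)\<^sup>2 > 0"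
    using assms(4) by simp
  then have "(norm ?f)\<^sup>2 > 0"
    using norm_tent_ge[of M] by linarith
  then have f: "norm ?f > 0"
    by simp
  have "pair.T.rotation \<theta> \<delta> (\<theta> + \<delta>)"
    by (intro pair.rotation_tensor lattice_rotation line_rotation)
  then have "r * norm (tensor \<psi> ?f) \<le> norm (?T ?x (tensor \<psi> ?f))"
    by (intro pair.T.act_bounded_below[OF pair.T.rotation_admissible_op_norm gap assms(3)])
  \<comment> \<open>The scalar \<open>t\<close> acts in the same way on both sides, so only
    \<open>p\<close> contributes an error and the estimate is uniform in \<open>t\<close>.\<close>
  also have "?T ?x (tensor \<psi> ?f) = tensor (?L ?x \<psi>) ?f - (?T p (tensor \<psi> ?f) - tensor (?L p \<psi>) ?f)"
  proof -
    have "tensor (?L ?x \<psi> + ?L p \<psi>) ?f = ?T ?x (tensor \<psi> ?f) + ?T p (tensor \<psi> ?f)"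
      by (simp add: pair.T.act_diff pair.T.act_const lattice.act_diff lattice.act_const tensor_cscale_left)
    then show ?thesis
      by (simp add: tensor_add_left algebra_simps)
  qed
  also have "norm \<dots> \<le> norm (?L ?x \<psi>) * norm ?f + norm (?T p (tensor \<psi> ?f) - tensor (?L p \<psi>) ?f)"
    unfolding norm_tensor [symmetric] by (rule norm_triangle_ineq4)
  also have "\<dots> \<le> norm (?L ?x \<psi>) * norm ?f + length_norm p * (e * norm ?f) * norm \<psi>"
    using assms(4) by (intro add_left_mono pair.act_tensor_almost) (simp add: e_def tent_almost_invariant)
  finally have "(r - length_norm p * e) * norm \<psi> * norm ?f \<le> norm (?L ?x \<psi>) * norm ?f"
    by (simp add: norm_tensor algebra_simps)
  then show ?thesis
    using f by (simp add: e_def)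
qed

text \<open>Returns from vectors to the seminorm: the estimate is applied to the vectors
  \<open>a \<psi>\<close>, and isometry of the lattice representation identifies the resulting
  operator norms with seminorms.\<close>

lemma rot_bounded_below_if_lattice:
  assumes "c > 0" "\<And>\<psi>. c * norm \<psi> \<le> norm (lattice.act \<theta> x \<psi>)"
  shows "rot.bounded_below \<theta> c x"
  unfolding rot.bounded_below_def
proof
  fix a
  have "lattice.op_norm \<theta> a \<le> lattice.op_norm \<theta> (x * a) / c"
  proof (rule lattice.op_norm_le)
    fix \<psi>
    have "c * norm (lattice.act \<theta> a \<psi>) \<le> norm (lattice.act \<theta> (x * a) \<psi>)"
      unfolding lattice.act_mult by (rule assms)
    also have "\<dots> \<le> lattice.op_norm \<theta> (x * a) * norm \<psi>"
      by (rule lattice.norm_act_le_op_norm)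
    finally show "norm (lattice.act \<theta> a \<psi>) \<le> lattice.op_norm \<theta> (x * a) / c * norm \<psi>"
      using assms(1) by (simp add: field_simps)
  qed (use assms(1) lattice.op_norm_ge_0 in auto)
  then show "c * rotation_seminorm \<theta> a \<le> rotation_seminorm \<theta> (x * a)"
    using assms(1) by (simp add: rotation_seminorm_eq_op_norm field_simps)
qed

lemma rotation_seminorm_1: "rotation_seminorm \<theta> 1 \<noteq> 0"
  using lattice.norm_act_le_op_norm[of \<theta> 1 "basis_vec (0, 0)"] by (auto simp: rotation_seminorm_eq_op_norm)

lemma selfadjoint_rotation_spectrum:
  assumes "selfadjoint p"
  shows "compact (rotation_spectrum p \<theta>)" "rotation_spectrum p \<theta> \<noteq> {}"
    "c \<in> rotation_spectrum p \<theta> \<Longrightarrow> cmod c \<le> coeff_norm p"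
  using assms rot.compact_spec rot.spec_nonempty[OF _ rotation_seminorm_1] rot.spec_norm_le[of c \<theta> p]
    admissible_le_coeff_norm[OF rotation_seminorm_admissible, of \<theta> p]
  by (auto simp: rotation_spectrum_eq_spec selfadjoint_def)

text \<open>A point of the spectrum at \<open>\<theta>\<close> farther than the error from the
  spectrum at \<open>\<theta>'\<close> would sit in a gap at \<open>\<theta>'\<close>, and enough of
  that gap would survive at \<open>\<theta>\<close> to exclude the point.\<close>

lemma infdist_rotation_spectrum_le:
  assumes "selfadjoint p" "c \<in> rotation_spectrum p \<theta>" "M > 0"
  shows "infdist c (rotation_spectrum p \<theta>') \<le> length_norm p * (2 / real M + 2 * real M * \<bar>\<theta>' - \<theta>\<bar>)"
proof (rule ccontr)
  let ?S = "rotation_spectrum p" and ?e = "length_norm p * (2 / real M + 2 * real M * \<bar>\<theta>' - \<theta>\<bar>)"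
  have sa: "formal_adj p = p"
    using assms(1) by (simp add: selfadjoint_def)
  obtain t where t: "c = complex_of_real t"
    using rot.spec_real[OF sa] assms(2) unfolding rotation_spectrum_eq_spec by blast
  assume "\<not> infdist c (?S \<theta>') \<le> ?e"
  \<comment> \<open>Strictly between: below the distance for a strict spectral gap, above the error
    for a positive remaining lower bound.\<close>
  then obtain r where r: "?e < r" "r < infdist c (?S \<theta>')"
    using dense[of ?e "infdist c (?S \<theta>')"] by (auto simp: not_le)
  have "?e \<ge> 0"
    by (intro mult_nonneg_nonneg add_nonneg_nonneg length_norm_ge_0) auto
  with r(1) have r0: "r > 0"
    by linarith
  have gap: "r < dist d c" if "d \<in> ?S \<theta>'" for d
    using r(2) infdist_le[OF that, of c] by (simp add: dist_commute)
  have bb: "rot.bounded_below \<theta>' r (const t - p)"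
    using gap r0 by (intro rot.bounded_below_if_spec_gap sa) (auto simp: rotation_spectrum_eq_spec t)
  have inv: "rot.almost_inv \<theta>' (const t - p)"
    using bb r0 by (intro rot.almost_inv_if_bounded_below[OF _ bb]) (auto simp: star_poly.adj_diff star_poly.adj_sc sa)
  have "rot.bounded_below \<theta> (r - ?e) (const t - p)"
    using lattice_bounded_below[of \<theta> "\<theta>' - \<theta>" r t p M] bb inv r0 r(1) assms(3)
    by (intro rot_bounded_below_if_lattice) auto
  then have "complex_of_real t \<notin> rot.spec \<theta> p"
    unfolding rot.not_in_spec_iff[OF sa] using r(1) by (intro exI[of _ "r - ?e"]) auto
  with assms(2) show False
    by (simp add: rotation_spectrum_eq_spec t)
qed

lemma infdist_rotation_spectrum_holder:
  assumes "selfadjoint p" "c \<in> rotation_spectrum p \<theta>"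
  shows "infdist c (rotation_spectrum p \<theta>') \<le> (6 * length_norm p + 2 * coeff_norm p) * sqrt \<bar>\<theta> - \<theta>'\<bar>"
proof -
  define \<delta> where "\<delta> = \<bar>\<theta>' - \<theta>\<bar>"
  have \<delta>: "\<delta> = \<bar>\<theta> - \<theta>'\<bar>"
    by (simp add: \<delta>_def)
  have K: "length_norm p \<ge> 0" "coeff_norm p \<ge> 0"
    by (simp_all add: length_norm_ge_0 coeff_norm_def sum_nonneg)
  \<comment> \<open>Equal angles are trivial. For \<open>\<delta> > 1\<close> the bound
    \<open>2 * coeff_norm p\<close> on the distance of spectral values suffices, as
    \<open>sqrt \<delta>\<close> exceeds 1. The balance of errors is made for small
    \<open>\<delta>\<close>.\<close>
  consider "\<delta> = 0" | "\<delta> > 1" | "0 < \<delta>" "\<delta> \<le> 1"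
    unfolding \<delta>_def by linarith
  then have "infdist c (rotation_spectrum p \<theta>') \<le> (6 * length_norm p + 2 * coeff_norm p) * sqrt \<delta>"
  proof cases
    case 1
    then show ?thesis
      using assms(2) by (simp add: \<delta>_def)
  next
    case 2
    obtain d where d: "d \<in> rotation_spectrum p \<theta>'"
      using selfadjoint_rotation_spectrum(2)[OF assms(1)] by blast
    have "dist c d \<le> 2 * coeff_norm p"
      using norm_triangle_ineq4[of c d] selfadjoint_rotation_spectrum(3)[OF assms(1) assms(2)]
        selfadjoint_rotation_spectrum(3)[OF assms(1) d]
      by (simp add: dist_norm)
    also have "\<dots> \<le> (6 * length_norm p + 2 * coeff_norm p) * sqrt \<delta>"
      using K 2 mult_mono[of "2 * coeff_norm p" "6 * length_norm p + 2 * coeff_norm p" 1 "sqrt \<delta>"] by simp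
    finally show ?thesis
      by (rule infdist_le2[OF d])
  next
    case 3
    define s where "s = sqrt \<delta>"
    have s: "s > 0" "s \<le> 1" "s * s = \<delta>"
      using 3 by (auto simp: s_def)
    \<comment> \<open>Balances \<open>2 / M\<close> against \<open>2 M \<delta>\<close>. Since
      \<open>s \<le> 1\<close>, rounding up at most doubles \<open>1 / s\<close>, so the two terms
      are at most \<open>2 s\<close> and \<open>4 s\<close>; this is the origin of the constant
      6.\<close>
    define M where "M = nat \<lceil>1 / s\<rceil>"
    have "1 / s \<ge> 1"
      using s by simp
    then have M: "1 / s \<le> real M" "real M \<le> 1 / s + 1"
      unfolding M_def by linarith+
    have "2 / s = 1 / s + 1 / s"
      by simp
    with M(2) \<open>1 / s \<ge> 1\<close> have M': "real M \<le> 2 / s"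
      by linarith
    have "real M > 0"
      using M(1) \<open>1 / s \<ge> 1\<close> by linarith
    then have "M > 0"
      by simp
    have "2 / real M \<le> 2 * s"
      using M(1) s(1) \<open>M > 0\<close> by (simp add: field_simps)
    moreover have "2 * real M * \<delta> \<le> 4 * s"
    proof -
      have "2 * real M * (s * s) \<le> 2 * (2 / s) * (s * s)"
        using s(1) M' by (intro mult_right_mono mult_left_mono) auto
      also have "\<dots> = 4 * s"
        using s(1) by simp
      finally show ?thesis
        by (simp only: s(3))
    qed
    ultimately have le: "2 / real M + 2 * real M * \<delta> \<le> 6 * s"
      by linarith
    have "infdist c (rotation_spectrum p \<theta>') \<le> length_norm p * (2 / real M + 2 * real M * \<delta>)"
      unfolding \<delta>_def by (rule infdist_rotation_spectrum_le[OF assms \<open>M > 0\<close>])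
    also have "\<dots> \<le> length_norm p * (6 * s)"
      by (intro mult_left_mono le K)
    also have "\<dots> \<le> (6 * length_norm p + 2 * coeff_norm p) * s"
      using K s by (simp add: algebra_simps)
    finally show ?thesis
      by (simp add: s_def)
  qed
  then show ?thesis
    by (simp add: \<delta>)
qed

theorem theorem4p4:
  fixes p :: star_poly
  assumes "selfadjoint p"
  shows "(\<forall>\<theta>. compact (rotation_spectrum p \<theta>) \<and> rotation_spectrum p \<theta> \<noteq> {}) \<and>
    (\<exists>C. \<forall>\<theta> \<theta>'. hausdorff_dist (rotation_spectrum p \<theta>) (rotation_spectrum p \<theta>')
                    \<le> C * \<bar>\<theta> - \<theta>'\<bar> powr (1/2))"
proof (intro conjI allI exI)
  fix \<theta> \<theta>' :: real
  have "(SUP c\<in>rotation_spectrum p \<theta>. infdist c (rotation_spectrum p \<theta>'))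
      \<le> (6 * length_norm p + 2 * coeff_norm p) * sqrt \<bar>\<theta> - \<theta>'\<bar>" for \<theta> \<theta>'
    by (rule cSUP_least[OF selfadjoint_rotation_spectrum(2)[OF assms] infdist_rotation_spectrum_holder[OF assms]])
  from this[of \<theta> \<theta>'] this[of \<theta>' \<theta>]
  show "hausdorff_dist (rotation_spectrum p \<theta>) (rotation_spectrum p \<theta>')
      \<le> (6 * length_norm p + 2 * coeff_norm p) * \<bar>\<theta> - \<theta>'\<bar> powr (1/2)"
    by (simp add: hausdorff_dist_def powr_half_sqrt abs_minus_commute)
qed (simp_all add: selfadjoint_rotation_spectrum[OF assms])

end
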